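(* Let $\mathcal{I}$ be the standard Pfaffian system with parameters for type C austere 4-folds in $\mathbb{R}^7$ with $\delta=3$, defined on $\mathcal{F}\times L_0$ (see context). The set of integral 4-folds of $\mathcal I$ (satisfying the independence condition) which lie in the open subset of $\mathcal{F}\times L_0$ where $\lambda_1\neq1$ and $\lambda_2\neq1$ is at most finite-dimensional.
   Context: Index ranges: $1\le i,j\le4$, $1\le a\le3$; summation convention. $\mathcal F$ is the bundle of frames $(e_1,\dots,e_4,\nu_1,\nu_2,\nu_3)$ of $T_p\mathbb{R}^7$, $p\in\mathbb R^7$, such that the $e_i$ are orthonormal and orthogonal to the $\nu_a$. Canonical and connection 1-forms on $\mathcal F$ are defined by $dp=e_i\omega^i+\nu_a\theta^a$, $de_i=e_j\phi^j_i+\nu_a\eta^a_i$, $d\nu_a=e_j\xi^j_a+\nu_b\kappa^b_a$. $L\subset\mathbb{R}^3$ is the set of $(\lambda_1,\lambda_2,\lambda_3)\neq 0$ with $\lambda_1\lambda_2\lambda_3+\lambda_1+\lambda_2+\lambda_3=0$, and $L_0\subset L$ is the subset where $\lambda_1\ge\lambda_2>0$. Set $$S^1=\begin{bmatrix}0&1&0&0\\1&0&0&0\\0&0&0&\lambda_1\\0&0&\lambda_1&0\end{bmatrix},\quad S^2=\begin{bmatrix}0&0&1&0\\0&0&0&\lambda_2\\1&0&0&0\\0&\lambda_2&0&0\end{bmatrix},\quad S^3=\begin{bmatrix}0&0&0&1\\0&0&\lambda_3&0\\0&\lambda_3&0&0\\1&0&0&0\end{bmatrix}.$$ $\mathcal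 I$ is the Pfaffian exterior differential system generated by the 1-forms $\theta^a$ and $\eta^a_i-S^a_{ij}\omega^j$, with independence condition $\omega^1\wedge\omega^2\wedge\omega^3\wedge\omega^4\ne0$. Its integral 4-folds correspond to austere 4-folds $M\subset\mathbb{R}^7$ equipped with frames $(e_i)$ tangent and $(\nu_a)$ normal to $M$ such that $\nu_a\cdot\mathrm{II}(e_i,e_j)=S^a_{ij}$, where the parameters $\lambda_i$ are functions on $M$. "At most finite-dimensional" means that (local, connected) integral 4-folds depend on at most finitely many constants. *)

theory Defs
  imports "HOL-Analysis.Analysis"
begin

section \<open>Smooth maps on open sets\<close>

primrec Ck_on :: "nat \<Rightarrow> 'a::euclidean_space set \<Rightarrow> ('a \<Rightarrow> 'b::euclidean_space) \<Rightarrow> bool" where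
  "Ck_on 0 A f \<longleftrightarrow> continuous_on A f"
| "Ck_on (Suc k) A f \<longleftrightarrow> (\<forall>x\<in>A. f differentiable (at x)) \<and>
     (\<forall>v. Ck_on k A (\<lambda>x. frechet_derivative f (at x) v))"

definition smooth_on :: "'a::euclidean_space set \<Rightarrow> ('a \<Rightarrow> 'b::euclidean_space) \<Rightarrow> bool" where
  "smooth_on A f \<longleftrightarrow> open A \<and> (\<forall>k. Ck_on k A f)"

section \<open>The frame bundle and the parameter surface\<close>

text \<open>
  A configuration \<open>(p, e, \<nu>, l)\<close> is a point of \<open>\<F> \<times> L\<close>, regarded as a subset of the Euclidean
  space of all quadruples. Tangent vectors to \<open>\<F> \<times> L\<close> are vectors \<open>(dp, de, d\<nu>, dl)\<close> of the same
  space. In the index type \<open>4\<close> the numeral \<open>4\<close> denotes the same index as \<open>0\<close>, and likewise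
  \<open>3\<close> in the index type \<open>3\<close>.
\<close>

type_synonym conf = "(real^7) \<times> (real^7^4) \<times> (real^7^3) \<times> (real^3)"

text \<open>Seven vectors spanning \<open>\<real>\<^sup>7\<close> form a basis. The \<open>\<nu>\<^sub>a\<close> are not assumed orthonormal.\<close>

definition frames :: "((real^7) \<times> (real^7^4) \<times> (real^7^3)) set" where
  "frames = {(p, e, \<nu>).
     (\<forall>i j. e $ i \<bullet> e $ j = (if i = j then 1 else 0)) \<and>
     (\<forall>i a. e $ i \<bullet> \<nu> $ a = 0) \<and>
     span (range (($) e) \<union> range (($) \<nu>)) = UNIV}"

definition Lsurf :: "(real^3) set" where
  "Lsurf = {l. l \<noteq> 0 \<and> l$1 * l$2 * l$3 + l$1 + l$2 + l$3 = 0}"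

definition Lsurf0 :: "(real^3) set" where
  "Lsurf0 = {l \<in> Lsurf. l$1 \<ge> l$2 \<and> l$2 > 0}"

definition FL0 :: "conf set" where
  "FL0 = {(p, e, \<nu>, l). (p, e, \<nu>) \<in> frames \<and> l \<in> Lsurf0}"

definition FL0_generic :: "conf set" where
  "FL0_generic = {(p, e, \<nu>, l) \<in> FL0. l$1 \<noteq> 1 \<and> l$2 \<noteq> 1}"

section \<open>The Pfaffian system\<close>

text \<open>
  The components of \<open>w\<close> in the frame \<open>(e, \<nu>)\<close>. Applied to \<open>dp\<close> they are \<open>(\<omega>, \<theta>)\<close>, applied
  to \<open>de\<^sub>i\<close> they are \<open>(\<phi>\<^sub>i, \<eta>\<^sub>i)\<close>.
\<close>

definition frame_coeffs :: "real^7^4 \<Rightarrow> real^7^3 \<Rightarrow> real^7 \<Rightarrow> (real^4) \<times> (real^3)" where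
  "frame_coeffs e \<nu> w =
     (THE (x, y). w = (\<Sum>i\<in>UNIV. x $ i *\<^sub>R e $ i) + (\<Sum>a\<in>UNIV. y $ a *\<^sub>R \<nu> $ a))"

definition omega :: "conf \<Rightarrow> 4 \<Rightarrow> conf \<Rightarrow> real" where
  "omega = (\<lambda>(p, e, \<nu>, l) i (dp, de, d\<nu>, dl). fst (frame_coeffs e \<nu> dp) $ i)"

definition theta :: "conf \<Rightarrow> 3 \<Rightarrow> conf \<Rightarrow> real" where
  "theta = (\<lambda>(p, e, \<nu>, l) a (dp, de, d\<nu>, dl). snd (frame_coeffs e \<nu> dp) $ a)"

definition eta :: "conf \<Rightarrow> 3 \<Rightarrow> 4 \<Rightarrow> conf \<Rightarrow> real" where
  "eta = (\<lambda>(p, e, \<nu>, l) a i (dp, de, d\<nu>, dl). snd (frame_coeffs e \<nu> (de $ i)) $ a)"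

definition Smat :: "real^3 \<Rightarrow> real^4^4^3" where
  "Smat l = vector
    [vector [vector [0, 1, 0, 0],
             vector [1, 0, 0, 0],
             vector [0, 0, 0, l$1],
             vector [0, 0, l$1, 0]],
     vector [vector [0, 0, 1, 0],
             vector [0, 0, 0, l$2],
             vector [1, 0, 0, 0],
             vector [0, l$2, 0, 0]],
     vector [vector [0, 0, 0, 1],
             vector [0, 0, l$3, 0],
             vector [0, l$3, 0, 0],
             vector [1, 0, 0, 0]]]"

definition eta_S :: "conf \<Rightarrow> 3 \<Rightarrow> 4 \<Rightarrow> conf \<Rightarrow> real" where
  "eta_S = (\<lambda>(p, e, \<nu>, l) a i v.
     eta (p, e, \<nu>, l) a i v - (\<Sum>j\<in>UNIV. Smat l $ a $ i $ j * omega (p, e, \<nu>, l) j v))"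

text \<open>
  A parametrized integral 4-fold in \<open>D\<close>: the generating 1-forms pull back to zero, and the
  determinant is the value of the pullback of \<open>\<omega>\<^sup>1 \<and> \<omega>\<^sup>2 \<and> \<omega>\<^sup>3 \<and> \<omega>\<^sup>4\<close> on the coordinate vectors.
\<close>

definition integral_param :: "conf set \<Rightarrow> (real^4) set \<Rightarrow> (real^4 \<Rightarrow> conf) \<Rightarrow> bool" where
  "integral_param D U f \<longleftrightarrow> smooth_on U f \<and> f ` U \<subseteq> D \<and>
     (\<forall>x\<in>U. let df = frechet_derivative f (at x) in
        (\<forall>a v. theta (f x) a (df v) = 0) \<and>
        (\<forall>a i v. eta_S (f x) a i (df v) = 0) \<and>
        det (\<chi> i j. omega (f x) i (df (axis j 1))) \<noteq> 0)"

definition embedding_on :: "'a::topological_space set \<Rightarrow> ('a \<Rightarrow> 'b::topological_space) \<Rightarrow> bool" where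
  "embedding_on U f \<longleftrightarrow> (\<exists>g. homeomorphism U (f ` U) f g)"

text \<open>
  Connected integral 4-folds satisfying the independence condition, as embedded submanifolds.
  The parametrizations are immersions by the independence condition.
\<close>

definition integral_fold :: "conf set \<Rightarrow> conf set \<Rightarrow> bool" where
  "integral_fold D M \<longleftrightarrow> M \<noteq> {} \<and> connected M \<and>
     (\<forall>q\<in>M. \<exists>W U f. open W \<and> q \<in> W \<and> integral_param D U f \<and> embedding_on U f \<and> f ` U = M \<inter> W)"

section \<open>Dependence on finitely many constants\<close>

definition same_germ :: "'a::topological_space set \<Rightarrow> 'a \<Rightarrow> 'a set \<Rightarrow> 'a \<Rightarrow> bool" where
  "same_germ M q M' q' \<longleftrightarrow> q = q' \<and> (\<exists>W. open W \<and> q \<in> W \<and> M \<inter> W = M' \<inter> W)"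

text \<open>A smooth one-parameter family of connected integral 4-folds \<open>F t ` U\<close>, \<open>t \<in> T\<close>.\<close>

definition integral_family ::
    "conf set \<Rightarrow> real set \<Rightarrow> (real^4) set \<Rightarrow> (real \<Rightarrow> real^4 \<Rightarrow> conf) \<Rightarrow> bool" where
  "integral_family D T U F \<longleftrightarrow>
     open T \<and> open U \<and> connected U \<and> U \<noteq> {} \<and> smooth_on (T \<times> U) (\<lambda>(t, x). F t x) \<and>
     (\<forall>t\<in>T. integral_param D U (F t) \<and> embedding_on U (F t))"

text \<open>
  Connected integral 4-folds \<open>M\<close> in \<open>D\<close>, considered locally near a point \<open>q \<in> M\<close>, depend on at
  most \<open>N\<close> constants: there are \<open>N\<close> real quantities \<open>c M q i\<close> which determine the germ of \<open>M\<close> at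
  \<open>q\<close>, are determined by it, and vary continuously in smooth families. Without the continuity
  the condition would be void, since there are only continuum many germs. Continuity along
  smooth one-parameter families gives continuity in smooth families with any number \<open>m\<close> of
  parameters, so by invariance of domain a smooth \<open>m\<close>-parameter family of pairwise distinct
  germs exists only for \<open>m \<le> N\<close>. Continuity along curves inside a fold also shows that two
  connected integral 4-folds which are relatively closed in a common open set and have equal
  constants at one point coincide: the set where their germs agree is open and closed in each.
\<close>

definition depends_on_constants :: "nat \<Rightarrow> conf set \<Rightarrow> bool" where
  "depends_on_constants N D \<longleftrightarrow> (\<exists>c :: conf set \<Rightarrow> conf \<Rightarrow> nat \<Rightarrow> real.
     (\<forall>M M' q q'. integral_fold D M \<and> integral_fold D M' \<and> q \<in> M \<and> q' \<in> M' \<longrightarrow>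
        ((\<forall>i<N. c M q i = c M' q' i) \<longleftrightarrow> same_germ M q M' q')) \<and>
     (\<forall>T U F x. integral_family D T U F \<and> x \<in> U \<longrightarrow>
        (\<forall>i<N. continuous_on T (\<lambda>t. c (F t ` U) (F t x) i))))"

definition at_most_finite_dimensional :: "conf set \<Rightarrow> bool" where
  "at_most_finite_dimensional D \<longleftrightarrow> (\<exists>N. depends_on_constants N D)"

end

theory Submission
  imports Defs
begin

text \<open>
  Let \<open>X\<^sub>k\<close> be the vector fields on an integral 4-fold dual to the \<open>\<omega>\<^sup>k\<close>. The coefficients of
  \<open>\<phi>\<close>, \<open>\<kappa>\<close> and \<open>d\<lambda>\<close> in the coframe \<open>\<omega>\<close> satisfy the Codazzi equations, which are linear with
  coefficients depending on \<open>\<lambda>\<close>; differentiating these along \<open>X\<^sub>i\<close> and adding the Gauss, Ricci and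
  \<open>d(d\<lambda>) = 0\<close> equations gives an inhomogeneous linear system for the \<open>X\<^sub>i\<close>-derivatives of the
  coefficients. Its homogeneous part is the second prolongation of the tableau, and this vanishes
  when all \<open>\<lambda>\<^sub>a \<noteq> 0\<close> and \<open>\<lambda>\<^sub>a\<^sup>2 \<noteq> 1\<close>. So configuration and coefficients together satisfy a closed
  first-order system with locally Lipschitz right-hand side, and by uniqueness for ordinary
  differential equations along rays the germ of an integral 4-fold at a point is determined by its
  tangent frame there. The constants are the coordinates of the point and of this frame.
\<close>

section \<open>Vanishing of the second prolongation\<close>

text \<open>On the surface of parameters the product of the two factors \<open>1 + l_a * l_b\<close>
  that contain a given \<open>l_a\<close> equals \<open>1 - l_a^2\<close>. The condition on the
  squares therefore says that no component of the gradient of the surface function vanishes; these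
  components are the coefficients that recur throughout the algebra. Only uniqueness is wanted, so
  the compatibility of the overdetermined linear system is never examined: its solutions form a
  relation that is Lipschitz where solutions exist, and no vector field is needed. An integral
  4-fold is a set without a preferred parametrization. Two of them are compared in coordinates fixed
  by the base point alone: the position is projected to the span of the vectors \<open>e\<close> at
  that point, and both folds are graphs over this projection. Since the vectors \<open>\<nu>\<close>
  are not orthonormal, \<kappa> has nine independent entries in each direction, and the Gram matrix
  of \<open>\<nu>\<close> enters the Weingarten and Ricci terms. The coefficients are functions of
  the base point and the tangent frame, so they add no constants.\<close>

lemma three_by_three_system_eq_0:
  fixes x y z l1 l2 l3 :: real
  assumes L: "l1*l2*l3 + l1 + l2 + l3 = 0"
    and nz: "1 + l2*l3 \<noteq> 0" "1 + l1*l3 \<noteq> 0" "1 + l1*l2 \<noteq> 0"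
    and e1: "(1+l2)*x - (1-l1)*y - (1+l1*l2)*z = 0"
    and e2: "(1-l3)*x + (1+l1*l3)*y + (1+l1)*z = 0"
    and e3: "(1+l2*l3)*x + (1+l3)*y - (1-l2)*z = 0"
  shows "x = 0 \<and> y = 0 \<and> z = 0"
proof -
  \<comment> \<open>On the surface \<open>L = 0\<close> the determinant of the system is \<open>-4 ?c\<close>.\<close>
  let ?c = "(1 + l2*l3) * (1 + l1*l3) * (1 + l1*l2)"
  have "?c * x = 0" using L e1 e2 e3 by algebra
  moreover have "?c * y = 0" using L e1 e2 e3 by algebra
  moreover have "?c * z = 0" using L e1 e2 e3 by algebra
  ultimately show ?thesis using nz by simp
qed

text \<open>Each of the groups \<open>a\<close>, \<open>b\<close>, \<open>c\<close> contains one
  pair \<open>u\<close>, \<open>t\<close>, which is eliminated by sums and differences of its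
  equations. The other six unknowns then separate into the triples
  \<open>v1+w1, v2-w2, v3+w3\<close> and \<open>v1-w1, v2+w2, v3-w3\<close>. The second triple
  satisfies the system of the first with all \<open>l\<close> negated, a change that preserves the
  surface and the nonvanishing factors.\<close>

lemma degree_zero_block_eq_0:
  fixes l1 l2 l3 :: real
  assumes L: "l1*l2*l3 + l1 + l2 + l3 = 0"
    and nz: "1 + l2*l3 \<noteq> 0" "1 + l1*l3 \<noteq> 0" "1 + l1*l2 \<noteq> 0"
    and a: "2*(v1 + l2*w1) = (1 + l1*l2)*(u3 + v3)" "2*(v2 + l1*w2) = (1 + l1*l2)*(u3 - v3)"
      "2*(w1 + l2* v1) = (1 + l1*l2)*(w3 + t3)" "2*(w2 + l1* v2) = (1 + l1*l2)*(w3 - t3)"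
    and b: "2*(v1 - l3*w1) = - (1 + l1*l3)*(u2 + v2)" "2*(v3 + l1*w3) = (1 + l1*l3)*(u2 - v2)"
      "2*(w1 - l3* v1) = (1 + l1*l3)*(w2 + t2)" "2*(w3 + l1* v3) = (1 + l1*l3)*(w2 - t2)"
    and c: "2*(v2 - l3*w2) = - (1 + l2*l3)*(u1 + v1)" "2*(v3 - l2*w3) = - (1 + l2*l3)*(u1 - v1)"
      "2*(w2 - l3* v2) = (1 + l2*l3)*(w1 + t1)" "2*(w3 - l2* v3) = (1 + l2*l3)*(w1 - t1)"
  shows "u1 = 0 \<and> v1 = 0 \<and> w1 = 0 \<and> t1 = 0 \<and> u2 = 0 \<and> v2 = 0 \<and> w2 = 0 \<and> t2 = 0 \<and>
    u3 = 0 \<and> v3 = 0 \<and> w3 = 0 \<and> t3 = 0"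
proof -
  have A: "v1 + w1 = 0 \<and> v2 - w2 = 0 \<and> v3 + w3 = 0"
    by (rule three_by_three_system_eq_0[OF L nz]; use a b c in algebra)
  have B: "w1 - v1 = 0 \<and> v2 + w2 = 0 \<and> v3 - w3 = 0"
  proof -
    have "(1-l2)*(v1-w1) - (1+l1)*(v2+w2) - (1+l1*l2)*(v3-w3) = 0"
      "(1+l3)*(v1-w1) + (1+l1*l3)*(v2+w2) + (1-l1)*(v3-w3) = 0"
      "(1+l2*l3)*(v1-w1) + (1-l3)*(v2+w2) - (1+l2)*(v3-w3) = 0"
      using a b c by algebra+
    then show ?thesis using three_by_three_system_eq_0[of "-l1" "-l2" "-l3" "v1-w1" "v2+w2" "v3-w3"] L nz
      by (simp add: algebra_simps)
  qed
  from A B have z: "v1 = 0" "w1 = 0" "v2 = 0" "w2 = 0" "v3 = 0" "w3 = 0" by auto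
  with a b c nz show ?thesis by auto
qed

text \<open>The relations \<open>e23\<close> and \<open>e32\<close> force \<open>b = 0\<close> and
  \<open>d = - a\<close>; after that \<open>c\<close> and \<open>a\<close> vanish, and everything is
  a multiple of \<open>p\<close> or \<open>p'\<close>. Of these two, \<open>e21\<close> gives
  \<open>(1 + l1*l3) * p = (1 + l1*l2) * p'\<close>, and \<open>e7\<close>, which expresses tangency
  to the surface of parameters, gives the same relation with the opposite sign.\<close>

lemma degree_nonzero_block_eq_0:
  fixes l1 l2 l3 :: real
  assumes nz: "l1 \<noteq> 0" "l2 \<noteq> 0" "l3 \<noteq> 0"
    and L: "l1*l2*l3 + l1 + l2 + l3 = 0"
    and cz: "1 + l2*l3 \<noteq> 0" "1 + l1*l3 \<noteq> 0" "1 + l1*l2 \<noteq> 0"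
    and e12: "2*(c - l2*b) = - (1 + l1*l2)*(p' + r')" "2*(b - l2*c) = - (1 + l1*l2)*(q' + s')"
    and e21: "2*(p + l1*q) = (1 + l1*l2)*(p' - r')" "2*(s + l1*r) = (1 + l1*l2)*(q' - s')"
    and e13: "2*(c + l3*b) = - (1 + l1*l3)*(p + r)" "2*(b + l3*c) = (1 + l1*l3)*(q + s)"
    and e31: "2*(p' + l1*q') = (1 + l1*l3)*(p - r)" "2*(s' + l1*r') = (1 + l1*l3)*(q - s)"
    and e23: "2*(q - l3* p) = - (1 + l2*l3)*(a + b)" "2*(s - l3*r) = (1 + l2*l3)*(a + b)"
      "2*(q - l3* p) = (1 + l2*l3)*(b + d)"
    and e32: "2*(q' - l2* p') = - (1 + l2*l3)*(a - b)" "2*(s' - l2*r') = (1 + l2*l3)*(a - b)"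
      "2*(s' - l2*r') = (1 + l2*l3)*(b - d)"
    and e7: "(1 + l2*l3)*(c + l1*a) + (1 + l1*l3)*(r - l2*q) + (1 + l1*l2)*(r' - l3*q') = 0"
  shows "a = 0 \<and> b = 0 \<and> c = 0 \<and> d = 0 \<and> p = 0 \<and> q = 0 \<and> r = 0 \<and> s = 0 \<and>
    p' = 0 \<and> q' = 0 \<and> r' = 0 \<and> s' = 0"
proof -
  have "(1 + l2*l3)*(a + b + (b + d)) = 0" "(1 + l2*l3)*((a - b) - (b - d)) = 0"
    using e23 e32 by algebra+
  then have bd: "b = 0" "d = - a" using cz by auto
  have "l2 * c = 0" using e12 e32 unfolding bd by algebra
  then have c: "c = 0" using nz by simp
  have r: "r' = - p'" "r = - p" using e12(1) e13(1) cz unfolding bd c by auto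
  have s: "s' = - q'" "s = - q" using e12(2) e13(2) cz unfolding bd c by auto
  have e: "p + l1*q = (1+l1*l2)* p'" "p' + l1*q' = (1+l1*l3)* p"
    using e21(1) e31(1) unfolding r by auto
  have "l1 * (1 + l2*l3) * a = 0"
    using e e23(1) e32(1) unfolding bd by algebra
  then have a: "a = 0" using nz cz by simp
  have q: "q = l3* p" "q' = l2* p'" using e23(1) e32(1) unfolding bd a by auto
  have "(1 + l1*l3)* p = (1 + l1*l2)* p'" using e q by algebra
  moreover have "(1 + l2*l3) * ((1 + l1*l3)* p + (1 + l1*l2)* p') = 0"
    using e7 unfolding bd a c r q by algebra
  ultimately have "p = 0" "p' = 0" using cz by auto
  then show ?thesis using bd a c r s q by simp
qed

text \<open>This is the covariant derivative of the second fundamental form along the field with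
  index \<open>j\<close>. \<open>Smat\<close> is affine in the parameters, so
  \<open>Smat \<mu> - Smat 0\<close> is its derivative in the direction \<mu>. The expression is
  symmetric in \<open>m\<close> and \<open>k\<close>; the Codazzi equation is its symmetry in
  \<open>k\<close> and \<open>j\<close>.\<close>

definition codazzi_form :: "real^3 \<Rightarrow> (real^4^4^4) \<times> (real^3^3^4) \<times> (real^3^4) \<Rightarrow> 3 \<Rightarrow> 4 \<Rightarrow> 4 \<Rightarrow> 4 \<Rightarrow> real" where
  "codazzi_form l = (\<lambda>(\<phi>, \<kappa>, \<mu>) a m k j.
     (Smat (\<mu>$j) - Smat 0)$a$m$k + (\<Sum>b\<in>UNIV. \<kappa>$j$a$b * Smat l$b$m$k)
       - (\<Sum>n\<in>UNIV. \<phi>$j$n$m * Smat l$a$n$k) - (\<Sum>n\<in>UNIV. \<phi>$j$n$k * Smat l$a$m$n))"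

lemma Smat_simps:
  "Smat l$1$1$1 = 0" "Smat l$1$1$2 = 1" "Smat l$1$1$3 = 0" "Smat l$1$1$4 = 0"
  "Smat l$1$2$1 = 1" "Smat l$1$2$2 = 0" "Smat l$1$2$3 = 0" "Smat l$1$2$4 = 0"
  "Smat l$1$3$1 = 0" "Smat l$1$3$2 = 0" "Smat l$1$3$3 = 0" "Smat l$1$3$4 = l$1"
  "Smat l$1$4$1 = 0" "Smat l$1$4$2 = 0" "Smat l$1$4$3 = l$1" "Smat l$1$4$4 = 0"
  "Smat l$2$1$1 = 0" "Smat l$2$1$2 = 0" "Smat l$2$1$3 = 1" "Smat l$2$1$4 = 0"
  "Smat l$2$2$1 = 0" "Smat l$2$2$2 = 0" "Smat l$2$2$3 = 0" "Smat l$2$2$4 = l$2"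
  "Smat l$2$3$1 = 1" "Smat l$2$3$2 = 0" "Smat l$2$3$3 = 0" "Smat l$2$3$4 = 0"
  "Smat l$2$4$1 = 0" "Smat l$2$4$2 = l$2" "Smat l$2$4$3 = 0" "Smat l$2$4$4 = 0"
  "Smat l$3$1$1 = 0" "Smat l$3$1$2 = 0" "Smat l$3$1$3 = 0" "Smat l$3$1$4 = 1"
  "Smat l$3$2$1 = 0" "Smat l$3$2$2 = 0" "Smat l$3$2$3 = l$3" "Smat l$3$2$4 = 0"
  "Smat l$3$3$1 = 0" "Smat l$3$3$2 = l$3" "Smat l$3$3$3 = 0" "Smat l$3$3$4 = 0"
  "Smat l$3$4$1 = 1" "Smat l$3$4$2 = 0" "Smat l$3$4$3 = 0" "Smat l$3$4$4 = 0"
  unfolding Smat_def by (simp_all add: vector_def)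

lemma Smat_sym: "Smat l$a$i$j = Smat l$a$j$i"
proof -
  have "\<forall>a i j. Smat l$a$i$j = Smat l$a$j$i"
    by (simp add: forall_3 forall_4 Smat_simps)
  then show ?thesis by blast
qed

text \<open>
  The equations are homogeneous for the grading by the Klein four-group in which \<open>e\<^sub>1\<close> has degree
  zero, and \<open>e\<^sub>2, e\<^sub>3, e\<^sub>4\<close> have the degrees of \<open>\<nu>\<^sub>1, \<nu>\<^sub>2, \<nu>\<^sub>3\<close>: they split into a block of degree zero
  and three blocks that are permuted by relabelling the indices.
\<close>

lemma quartic_tensor_eq_0:
  fixes F :: "3 \<Rightarrow> 4 \<Rightarrow> 4 \<Rightarrow> 4 \<Rightarrow> 4 \<Rightarrow> real"
  assumes L: "l1*l2*l3 + l1 + l2 + l3 = 0" and lz: "l1 \<noteq> 0" "l2 \<noteq> 0" "l3 \<noteq> 0"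
    and cz: "1 + l2*l3 \<noteq> 0" "1 + l1*l3 \<noteq> 0" "1 + l1*l2 \<noteq> 0"
    and sym: "\<And>a i j k l. F a i j k l = F a j i k l" "\<And>a i j k l. F a i j k l = F a i k j l"
      "\<And>a i j k l. F a i j k l = F a i j l k"
    and tr: "\<And>i j. F 1 1 1 i j + F 1 2 2 i j = 0" "\<And>i j. F 1 3 3 i j + F 1 4 4 i j = 0"
      "\<And>i j. F 2 1 1 i j + F 2 3 3 i j = 0" "\<And>i j. F 2 2 2 i j + F 2 4 4 i j = 0"
      "\<And>i j. F 3 1 1 i j + F 3 4 4 i j = 0" "\<And>i j. F 3 2 2 i j + F 3 3 3 i j = 0"
    and e12: "\<And>i j. 2 * (F 1 2 4 i j - l2 * F 1 1 3 i j) = - (1 + l1*l2) * (F 3 1 1 i j + F 3 2 2 i j)"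
    and e13: "\<And>i j. 2 * (F 1 2 3 i j - l3 * F 1 1 4 i j) = - (1 + l1*l3) * (F 2 1 1 i j + F 2 2 2 i j)"
    and e21: "\<And>i j. 2 * (F 2 3 4 i j - l1 * F 2 1 2 i j) = - (1 + l1*l2) * (F 3 1 1 i j + F 3 3 3 i j)"
    and e23: "\<And>i j. 2 * (F 2 2 3 i j - l3 * F 2 1 4 i j) = - (1 + l2*l3) * (F 1 1 1 i j + F 1 3 3 i j)"
    and e31: "\<And>i j. 2 * (F 3 3 4 i j - l1 * F 3 1 2 i j) = - (1 + l1*l3) * (F 2 1 1 i j + F 2 4 4 i j)"
    and e32: "\<And>i j. 2 * (F 3 2 4 i j - l2 * F 3 1 3 i j) = - (1 + l2*l3) * (F 1 1 1 i j + F 1 4 4 i j)"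
    and e7: "\<And>i j. (1 + l2*l3) * (F 1 3 4 i j - l1 * F 1 1 2 i j) + (1 + l1*l3) * (F 2 2 4 i j - l2 * F 2 1 3 i j)
       + (1 + l1*l2) * (F 3 2 3 i j - l3 * F 3 1 4 i j) = 0"
  shows "F a i j k l = 0"
proof -
  \<comment> \<open>The trace relations are stated for a repeated index in the front, middle and
    last pair, so that together with the permutation rules they bring every component to a normal
    form.\<close>
  have t1: "F 1 2 2 i j = - F 1 1 1 i j" "F 1 4 4 i j = - F 1 3 3 i j"
    "F 2 3 3 i j = - F 2 1 1 i j" "F 2 4 4 i j = - F 2 2 2 i j"
    "F 3 4 4 i j = - F 3 1 1 i j" "F 3 3 3 i j = - F 3 2 2 i j" for i j
    using tr[of i j] by linarith+
  have t2: "F 1 i 2 2 j = - F 1 i 1 1 j" "F 1 i 4 4 j = - F 1 i 3 3 j"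
    "F 2 i 3 3 j = - F 2 i 1 1 j" "F 2 i 4 4 j = - F 2 i 2 2 j"
    "F 3 i 4 4 j = - F 3 i 1 1 j" "F 3 i 3 3 j = - F 3 i 2 2 j" for i j
    using t1[of i j] by (metis sym(1,2))+
  have t3: "F 1 i j 2 2 = - F 1 i j 1 1" "F 1 i j 4 4 = - F 1 i j 3 3"
    "F 2 i j 3 3 = - F 2 i j 1 1" "F 2 i j 4 4 = - F 2 i j 2 2"
    "F 3 i j 4 4 = - F 3 i j 1 1" "F 3 i j 3 3 = - F 3 i j 2 2" for i j
    using t2[of i j] by (metis sym(2,3))+
  note t = sym t1 t2 t3
  have g0: "F 1 1 1 1 2 = 0 \<and> F 1 1 2 3 3 = 0 \<and> F 1 1 1 3 4 = 0 \<and> F 1 3 3 3 4 = 0 \<and> F 2 1 1 1 3 = 0 \<and> F 2 1 2 2 3 = 0 \<and> F 2 1 1 2 4 = 0 \<and> F 2 2 2 2 4 = 0 \<and> F 3 1 1 1 4 = 0 \<and> F 3 1 2 2 4 = 0 \<and> F 3 1 1 2 3 = 0 \<and> F 3 2 2 2 3 = 0"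
    by (rule degree_zero_block_eq_0[OF L cz];
        use e12[of 1 4] e12[of 2 3] e21[of 1 4] e21[of 2 3] e13[of 1 3] e31[of 1 3] e13[of 2 4] e31[of 2 4]
          e23[of 1 2] e32[of 1 2] e23[of 3 4] e32[of 3 4] in \<open>simp add: t algebra_simps\<close>)
  have g1: "F 1 1 1 1 1 = 0 \<and> F 1 1 1 3 3 = 0 \<and> F 1 1 2 3 4 = 0 \<and> F 1 3 3 3 3 = 0 \<and> F 2 1 1 1 4 = 0 \<and> F 2 1 1 2 3 = 0 \<and> F 2 1 2 2 4 = 0 \<and> F 2 2 2 2 3 = 0 \<and> F 3 1 1 1 3 = 0 \<and> F 3 1 1 2 4 = 0 \<and> F 3 1 2 2 3 = 0 \<and> F 3 2 2 2 4 = 0"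
    apply (rule degree_nonzero_block_eq_0[of l1 l2 l3])
    using lz L cz apply (simp_all add: algebra_simps)[7]
    subgoal using e12[of 1 3] by (simp add: t algebra_simps)
    subgoal using e12[of 2 4] by (simp add: t algebra_simps)
    subgoal using e21[of 1 3] by (simp add: t algebra_simps)
    subgoal using e21[of 2 4] by (simp add: t algebra_simps)
    subgoal using e13[of 1 4] by (simp add: t algebra_simps)
    subgoal using e13[of 2 3] by (simp add: t algebra_simps)
    subgoal using e31[of 1 4] by (simp add: t algebra_simps)
    subgoal using e31[of 2 3] by (simp add: t algebra_simps)
    subgoal using e23[of 1 1] by (simp add: t algebra_simps)
    subgoal using e23[of 2 2] by (simp add: t algebra_simps)
    subgoal using e23[of 3 3] by (simp add: t algebra_simps)
    subgoal using e32[of 1 1] by (simp add: t algebra_simps)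
    subgoal using e32[of 2 2] by (simp add: t algebra_simps)
    subgoal using e32[of 3 3] by (simp add: t algebra_simps)
    subgoal using e7[of 1 2] by (simp add: t algebra_simps)
    done
  \<comment> \<open>The block of the degree of \<open>\<nu>$2\<close>, obtained by exchanging
    \<open>\<nu>$1\<close> with \<open>\<nu>$2\<close> and \<open>e$2\<close> with
    \<open>e$3\<close>.\<close>
  have g2: "F 2 1 1 1 1 = 0 \<and> F 2 1 1 2 2 = 0 \<and> F 2 1 3 2 4 = 0 \<and> F 2 2 2 2 2 = 0 \<and> F 1 1 1 1 4 = 0 \<and> F 1 1 1 3 2 = 0 \<and> F 1 1 3 3 4 = 0 \<and> F 1 3 3 3 2 = 0 \<and> F 3 1 1 1 2 = 0 \<and> F 3 1 1 3 4 = 0 \<and> F 3 1 3 3 2 = 0 \<and> F 3 3 3 3 4 = 0"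
    apply (rule degree_nonzero_block_eq_0[of l2 l1 l3])
    using lz L cz apply (simp_all add: algebra_simps)[7]
    subgoal using e21[of 1 2] by (simp add: t algebra_simps)
    subgoal using e21[of 3 4] by (simp add: t algebra_simps)
    subgoal using e12[of 1 2] by (simp add: t algebra_simps)
    subgoal using e12[of 3 4] by (simp add: t algebra_simps)
    subgoal using e23[of 1 4] by (simp add: t algebra_simps)
    subgoal using e23[of 3 2] by (simp add: t algebra_simps)
    subgoal using e32[of 1 4] by (simp add: t algebra_simps)
    subgoal using e32[of 3 2] by (simp add: t algebra_simps)
    subgoal using e13[of 1 1] by (simp add: t algebra_simps)
    subgoal using e13[of 3 3] by (simp add: t algebra_simps)
    subgoal using e13[of 2 2] by (simp add: t algebra_simps)
    subgoal using e31[of 1 1] by (simp add: t algebra_simps)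
    subgoal using e31[of 3 3] by (simp add: t algebra_simps)
    subgoal using e31[of 2 2] by (simp add: t algebra_simps)
    subgoal using e7[of 1 3] by (simp add: t algebra_simps)
    done
  \<comment> \<open>The block of the degree of \<open>\<nu>$3\<close>, obtained by exchanging
    \<open>\<nu>$1\<close> with \<open>\<nu>$3\<close> and \<open>e$2\<close> with
    \<open>e$4\<close>.\<close>
  have g3: "F 3 1 1 1 1 = 0 \<and> F 3 1 1 3 3 = 0 \<and> F 3 1 4 3 2 = 0 \<and> F 3 3 3 3 3 = 0 \<and> F 2 1 1 1 2 = 0 \<and> F 2 1 1 4 3 = 0 \<and> F 2 1 4 4 2 = 0 \<and> F 2 4 4 4 3 = 0 \<and> F 1 1 1 1 3 = 0 \<and> F 1 1 1 4 2 = 0 \<and> F 1 1 4 4 3 = 0 \<and> F 1 4 4 4 2 = 0"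
    apply (rule degree_nonzero_block_eq_0[of l3 l2 l1])
    using lz L cz apply (simp_all add: algebra_simps)[7]
    subgoal using e32[of 1 3] by (simp add: t algebra_simps)
    subgoal using e32[of 4 2] by (simp add: t algebra_simps)
    subgoal using e23[of 1 3] by (simp add: t algebra_simps)
    subgoal using e23[of 4 2] by (simp add: t algebra_simps)
    subgoal using e31[of 1 2] by (simp add: t algebra_simps)
    subgoal using e31[of 4 3] by (simp add: t algebra_simps)
    subgoal using e13[of 1 2] by (simp add: t algebra_simps)
    subgoal using e13[of 4 3] by (simp add: t algebra_simps)
    subgoal using e21[of 1 1] by (simp add: t algebra_simps)
    subgoal using e21[of 4 4] by (simp add: t algebra_simps)
    subgoal using e21[of 3 3] by (simp add: t algebra_simps)
    subgoal using e12[of 1 1] by (simp add: t algebra_simps)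
    subgoal using e12[of 4 4] by (simp add: t algebra_simps)
    subgoal using e12[of 3 3] by (simp add: t algebra_simps)
    subgoal using e7[of 1 4] by (simp add: t algebra_simps)
    done
  have "\<forall>a i j k l. F a i j k l = 0"
    using g0 g1 g2 g3 by (simp add: forall_3 forall_4 t)
  then show ?thesis by blast
qed

text \<open>
  In \<open>(\<phi>, \<kappa>, \<mu>) :: conn\<close> the first index is that of the direction: \<open>\<phi>$k$n$m\<close>, \<open>\<kappa>$k$a$b\<close>, \<open>\<mu>$k$a\<close> are the
  values of \<open>\<phi>\<^sup>n\<^sub>m\<close>, \<open>\<kappa>\<^sup>a\<^sub>b\<close>, \<open>d\<lambda>\<^sub>a\<close> on \<open>X\<^sub>k\<close>. The components of \<open>conn_symbol\<close> come from the derivatives of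
  the Codazzi equations, the Gauss and Ricci equations, \<open>d(d\<lambda>) = 0\<close>, the skewness of \<open>\<phi>\<close>, and the
  tangency of \<open>d\<lambda>\<close> to the surface of parameters.
\<close>

type_synonym conn = "(real^4^4^4) \<times> (real^3^3^4) \<times> (real^3^4)"

definition Lgrad :: "real^3 \<Rightarrow> real^3" where
  "Lgrad l = vector [1 + l$2 * l$3, 1 + l$1 * l$3, 1 + l$1 * l$2]"

definition conn_symbol :: "real^3 \<Rightarrow> conn^4 \<Rightarrow>
    (real^4^4^4^4^3) \<times> (real^4^4^4^4) \<times> (real^3^3^4^4) \<times> (real^3^4^4) \<times> (real^4^4^4^4) \<times> (real^4^4)" where
  "conn_symbol l \<zeta> =
    (\<chi> a m k j i. codazzi_form l (\<zeta>$i) a m k j - codazzi_form l (\<zeta>$i) a m j k,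
     \<chi> i k n m. fst (\<zeta>$i)$k$n$m - fst (\<zeta>$k)$i$n$m,
     \<chi> i k a b. fst (snd (\<zeta>$i))$k$a$b - fst (snd (\<zeta>$k))$i$a$b,
     \<chi> i k a. snd (snd (\<zeta>$i))$k$a - snd (snd (\<zeta>$k))$i$a,
     \<chi> i k n m. fst (\<zeta>$i)$k$n$m + fst (\<zeta>$i)$k$m$n,
     \<chi> i k. Lgrad l \<bullet> snd (snd (\<zeta>$i))$k)"

text \<open>The factors with index 3 are controlled by the identities for \<open>1 - l$2^2\<close>
  and \<open>1 - l$1^2\<close>, whose common factor \<open>1 + l$1 * l$2\<close> is positive. Thus
  the excluded values 1 are exactly the zeros of the other two factors, and \<open>l$3 = 0\<close>
  would give \<open>l$1 + l$2 = 0\<close>.\<close>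

lemma Lsurf0_generic:
  assumes "l \<in> Lsurf0" "l$1 \<noteq> 1" "l$2 \<noteq> 1"
  shows "l$1 * l$2 * l$3 + l$1 + l$2 + l$3 = 0" "l$1 \<noteq> 0" "l$2 \<noteq> 0" "l$3 \<noteq> 0"
    "1 + l$2 * l$3 \<noteq> 0" "1 + l$1 * l$3 \<noteq> 0" "1 + l$1 * l$2 \<noteq> 0"
proof -
  have p: "l$1 > 0" "l$2 > 0" and L: "l$1 * l$2 * l$3 + l$1 + l$2 + l$3 = 0"
    using assms by (auto simp: Lsurf0_def Lsurf_def)
  have q: "1 + l$1 * l$2 > 0" using p by (simp add: add_pos_pos)
  have "(1 + l$2 * l$3) * (1 + l$1 * l$2) = (1 - l$2) * (1 + l$2)"
       "(1 + l$1 * l$3) * (1 + l$1 * l$2) = (1 - l$1) * (1 + l$1)"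
    using L by algebra+
  then show "1 + l$2 * l$3 \<noteq> 0" "1 + l$1 * l$3 \<noteq> 0"
    using p q assms by auto
  show "l$3 \<noteq> 0" using L p by auto
qed (use assms in \<open>auto simp: Lsurf0_def Lsurf_def add_pos_pos\<close>, 
     metis add_pos_pos less_irrefl less_le_trans mult_pos_pos zero_less_one)

text \<open>One entry for each \<open>a\<close> and each unordered pair \<open>m\<close>,
  \<open>k\<close>, thirty in all. They depend on six entries of \<phi>, nine of \<kappa> and three
  of \<mu>. As \<mu> is also tangent to the surface, seventeen quantities are free; eliminating them
  gives the thirteen relations assumed in \<open>quartic_tensor_eq_0\<close>.\<close>

lemma codazzi_form_simps:
  fixes z :: conn
  defines "\<phi> \<equiv> fst z" and "\<kappa> \<equiv> fst (snd z)" and "\<mu> \<equiv> snd (snd z)"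
  assumes skew: "\<And>k n m. \<phi>$k$n$m = - \<phi>$k$m$n"
  shows
  "codazzi_form l z 1 1 1 j = 2 * \<phi>$j$1$2" "codazzi_form l z 1 2 2 j = - 2 * \<phi>$j$1$2"
  "codazzi_form l z 1 3 3 j = 2 * l$1 * \<phi>$j$3$4" "codazzi_form l z 1 4 4 j = - 2 * l$1 * \<phi>$j$3$4"
  "codazzi_form l z 2 1 1 j = 2 * \<phi>$j$1$3" "codazzi_form l z 2 3 3 j = - 2 * \<phi>$j$1$3"
  "codazzi_form l z 2 2 2 j = 2 * l$2 * \<phi>$j$2$4" "codazzi_form l z 2 4 4 j = - 2 * l$2 * \<phi>$j$2$4"
  "codazzi_form l z 3 1 1 j = 2 * \<phi>$j$1$4" "codazzi_form l z 3 4 4 j = - 2 * \<phi>$j$1$4"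
  "codazzi_form l z 3 2 2 j = 2 * l$3 * \<phi>$j$2$3" "codazzi_form l z 3 3 3 j = - 2 * l$3 * \<phi>$j$2$3"
  "codazzi_form l z 1 1 2 j = \<kappa>$j$1$1" "codazzi_form l z 1 3 4 j = \<mu>$j$1 + l$1 * \<kappa>$j$1$1"
  "codazzi_form l z 2 1 3 j = \<kappa>$j$2$2" "codazzi_form l z 2 2 4 j = \<mu>$j$2 + l$2 * \<kappa>$j$2$2"
  "codazzi_form l z 3 1 4 j = \<kappa>$j$3$3" "codazzi_form l z 3 2 3 j = \<mu>$j$3 + l$3 * \<kappa>$j$3$3"
  "codazzi_form l z 1 1 3 j = \<kappa>$j$1$2 + l$1 * \<phi>$j$1$4 - \<phi>$j$2$3"
  "codazzi_form l z 1 2 4 j = l$2 * \<kappa>$j$1$2 - \<phi>$j$1$4 + l$1 * \<phi>$j$2$3"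
  "codazzi_form l z 1 1 4 j = \<kappa>$j$1$3 + l$1 * \<phi>$j$1$3 - \<phi>$j$2$4"
  "codazzi_form l z 1 2 3 j = l$3 * \<kappa>$j$1$3 - \<phi>$j$1$3 + l$1 * \<phi>$j$2$4"
  "codazzi_form l z 2 1 2 j = \<kappa>$j$2$1 + l$2 * \<phi>$j$1$4 + \<phi>$j$2$3"
  "codazzi_form l z 2 3 4 j = l$1 * \<kappa>$j$2$1 - \<phi>$j$1$4 - l$2 * \<phi>$j$2$3"
  "codazzi_form l z 2 1 4 j = \<kappa>$j$2$3 + l$2 * \<phi>$j$1$2 - \<phi>$j$3$4"
  "codazzi_form l z 2 2 3 j = l$3 * \<kappa>$j$2$3 - \<phi>$j$1$2 + l$2 * \<phi>$j$3$4"
  "codazzi_form l z 3 1 2 j = \<kappa>$j$3$1 + l$3 * \<phi>$j$1$3 + \<phi>$j$2$4"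
  "codazzi_form l z 3 3 4 j = l$1 * \<kappa>$j$3$1 - \<phi>$j$1$3 - l$3 * \<phi>$j$2$4"
  "codazzi_form l z 3 1 3 j = \<kappa>$j$3$2 + l$3 * \<phi>$j$1$2 + \<phi>$j$3$4"
  "codazzi_form l z 3 2 4 j = l$2 * \<kappa>$j$3$2 - \<phi>$j$1$2 - l$3 * \<phi>$j$3$4"
proof -
  have d: "\<phi>$k$n$n = 0" for k n using skew[of k n n] by simp
  have s: "\<phi>$k$2$1 = - \<phi>$k$1$2" "\<phi>$k$3$1 = - \<phi>$k$1$3" "\<phi>$k$4$1 = - \<phi>$k$1$4"
    "\<phi>$k$3$2 = - \<phi>$k$2$3" "\<phi>$k$4$2 = - \<phi>$k$2$4" "\<phi>$k$4$3 = - \<phi>$k$3$4" for k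
    using skew by blast+
  have z: "z = (\<phi>, \<kappa>, \<mu>)" by (simp add: \<phi>_def \<kappa>_def \<mu>_def)
  show
  "codazzi_form l z 1 1 1 j = 2 * \<phi>$j$1$2" "codazzi_form l z 1 2 2 j = - 2 * \<phi>$j$1$2"
  "codazzi_form l z 1 3 3 j = 2 * l$1 * \<phi>$j$3$4" "codazzi_form l z 1 4 4 j = - 2 * l$1 * \<phi>$j$3$4"
  "codazzi_form l z 2 1 1 j = 2 * \<phi>$j$1$3" "codazzi_form l z 2 3 3 j = - 2 * \<phi>$j$1$3"
  "codazzi_form l z 2 2 2 j = 2 * l$2 * \<phi>$j$2$4" "codazzi_form l z 2 4 4 j = - 2 * l$2 * \<phi>$j$2$4"
  "codazzi_form l z 3 1 1 j = 2 * \<phi>$j$1$4" "codazzi_form l z 3 4 4 j = - 2 * \<phi>$j$1$4"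
  "codazzi_form l z 3 2 2 j = 2 * l$3 * \<phi>$j$2$3" "codazzi_form l z 3 3 3 j = - 2 * l$3 * \<phi>$j$2$3"
  "codazzi_form l z 1 1 2 j = \<kappa>$j$1$1" "codazzi_form l z 1 3 4 j = \<mu>$j$1 + l$1 * \<kappa>$j$1$1"
  "codazzi_form l z 2 1 3 j = \<kappa>$j$2$2" "codazzi_form l z 2 2 4 j = \<mu>$j$2 + l$2 * \<kappa>$j$2$2"
  "codazzi_form l z 3 1 4 j = \<kappa>$j$3$3" "codazzi_form l z 3 2 3 j = \<mu>$j$3 + l$3 * \<kappa>$j$3$3"
  "codazzi_form l z 1 1 3 j = \<kappa>$j$1$2 + l$1 * \<phi>$j$1$4 - \<phi>$j$2$3"
  "codazzi_form l z 1 2 4 j = l$2 * \<kappa>$j$1$2 - \<phi>$j$1$4 + l$1 * \<phi>$j$2$3"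
  "codazzi_form l z 1 1 4 j = \<kappa>$j$1$3 + l$1 * \<phi>$j$1$3 - \<phi>$j$2$4"
  "codazzi_form l z 1 2 3 j = l$3 * \<kappa>$j$1$3 - \<phi>$j$1$3 + l$1 * \<phi>$j$2$4"
  "codazzi_form l z 2 1 2 j = \<kappa>$j$2$1 + l$2 * \<phi>$j$1$4 + \<phi>$j$2$3"
  "codazzi_form l z 2 3 4 j = l$1 * \<kappa>$j$2$1 - \<phi>$j$1$4 - l$2 * \<phi>$j$2$3"
  "codazzi_form l z 2 1 4 j = \<kappa>$j$2$3 + l$2 * \<phi>$j$1$2 - \<phi>$j$3$4"
  "codazzi_form l z 2 2 3 j = l$3 * \<kappa>$j$2$3 - \<phi>$j$1$2 + l$2 * \<phi>$j$3$4"
  "codazzi_form l z 3 1 2 j = \<kappa>$j$3$1 + l$3 * \<phi>$j$1$3 + \<phi>$j$2$4"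
  "codazzi_form l z 3 3 4 j = l$1 * \<kappa>$j$3$1 - \<phi>$j$1$3 - l$3 * \<phi>$j$2$4"
  "codazzi_form l z 3 1 3 j = \<kappa>$j$3$2 + l$3 * \<phi>$j$1$2 + \<phi>$j$3$4"
  "codazzi_form l z 3 2 4 j = l$2 * \<kappa>$j$3$2 - \<phi>$j$1$2 - l$3 * \<phi>$j$3$4"
    unfolding z by (simp_all add: codazzi_form_def sum_3 sum_4 Smat_simps d s)
qed

text \<open>The diagonal entries determine \<phi> because no \<open>l$a\<close> vanishes; the
  remaining entries then determine \<kappa> and after it \<mu>. This recovers the derivatives of the
  coefficients once the tensor built from them is known to vanish.\<close>

lemma codazzi_form_inj:
  assumes skew: "\<And>k n m. fst z$k$n$m = - fst z$k$m$n" and l: "l$1 \<noteq> 0" "l$2 \<noteq> 0" "l$3 \<noteq> 0"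
    and 0: "\<And>a m k j. codazzi_form l z a m k j = 0"
  shows "z = 0"
proof -
  note e = codazzi_form_simps[of z, OF skew, where l = l, unfolded 0, symmetric]
  obtain \<phi> \<kappa> \<mu> where z: "z = (\<phi>, \<kappa>, \<mu>)" by (cases z) auto
  have p: "\<phi>$j$1$2 = 0" "\<phi>$j$1$3 = 0" "\<phi>$j$1$4 = 0" "\<phi>$j$2$3 = 0" "\<phi>$j$2$4 = 0" "\<phi>$j$3$4 = 0" for j
    using e(1,3,5,7,9,11)[of j] l by (simp_all add: z)
  have "\<phi>$j$n$n = 0" for j n using skew[of j n n] by (simp add: z)
  then have "\<phi> = 0"
    using p skew[of _ 1 2] skew[of _ 1 3] skew[of _ 1 4] skew[of _ 2 3] skew[of _ 2 4] skew[of _ 3 4]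
    by (simp add: vec_eq_iff forall_4 z)
  moreover have "\<kappa> = 0"
    unfolding vec_eq_iff forall_3 using e[of _] by (simp add: z p)
  moreover have "\<mu> = 0"
    unfolding vec_eq_iff forall_3 using e(13-18) by (simp add: z p)
  ultimately show ?thesis by (simp add: z zero_prod_def)
qed

text \<open>The tensor \<open>F\<close> is symmetric in \<open>m, k\<close> because
  \<open>Smat\<close> is, in \<open>k, j\<close> by the differentiated Codazzi equations, and in
  \<open>j, i\<close> because the principal parts of the Gauss, Ricci and d(d\<lambda>) equations
  make the derivatives of the coefficients symmetric. It is therefore an element of the second
  prolongation.\<close>

lemma conn_symbol_inj:
  assumes l: "l \<in> Lsurf0" "l$1 \<noteq> 1" "l$2 \<noteq> 1" and 0: "conn_symbol l \<zeta> = 0"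
  shows "\<zeta> = 0"
proof -
  note g = Lsurf0_generic[OF l]
  have E: "codazzi_form l (\<zeta>$i) a m k j = codazzi_form l (\<zeta>$i) a m j k"
    "fst (\<zeta>$i)$k$n$m = fst (\<zeta>$k)$i$n$m" "fst (snd (\<zeta>$i))$k$a$b = fst (snd (\<zeta>$k))$i$a$b"
    "snd (snd (\<zeta>$i))$k$a = snd (snd (\<zeta>$k))$i$a"
    "fst (\<zeta>$i)$k$n$m = - fst (\<zeta>$i)$k$m$n" "Lgrad l \<bullet> snd (snd (\<zeta>$i))$k = 0" for i j k m n a b
    using 0 by (simp_all add: conn_symbol_def zero_prod_def vec_eq_iff eq_neg_iff_add_eq_0)
  define F where "F a m k j i = codazzi_form l (\<zeta>$i) a m k j" for a m k j i
  have F0: "F a m k j i = 0" for a m k j i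
  proof (rule quartic_tensor_eq_0[OF g])
    show "F a i j k l = F a j i k l" for a i j k l
      by (simp add: F_def codazzi_form_def case_prod_beta Smat_sym algebra_simps)
    show "F a i j k l = F a i k j l" for a i j k l
      unfolding F_def by (rule E)
    show "F a i j k m = F a i j m k" for a i j k m
    proof -
      have "fst (\<zeta>$m)$k = fst (\<zeta>$k)$m" "fst (snd (\<zeta>$m))$k = fst (snd (\<zeta>$k))$m"
        "snd (snd (\<zeta>$m))$k = snd (snd (\<zeta>$k))$m"
        using E(2-4) by (simp_all add: vec_eq_iff)
      then show ?thesis by (simp add: F_def codazzi_form_def case_prod_beta)
    qed
    have c: "Lgrad l$1 = 1 + l$2 * l$3" "Lgrad l$2 = 1 + l$1 * l$3" "Lgrad l$3 = 1 + l$1 * l$2"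
      by (simp_all add: Lgrad_def)
    note S = codazzi_form_simps[of "\<zeta>$_", OF E(5), where l = l]
    fix i j :: 4
    show "F 1 1 1 i j + F 1 2 2 i j = 0" "F 1 3 3 i j + F 1 4 4 i j = 0"
      "F 2 1 1 i j + F 2 3 3 i j = 0" "F 2 2 2 i j + F 2 4 4 i j = 0"
      "F 3 1 1 i j + F 3 4 4 i j = 0" "F 3 2 2 i j + F 3 3 3 i j = 0"
      by (simp_all add: F_def S)
    \<comment> \<open>Each left side is arranged so that \<kappa> cancels. What remains is linear in
      \<phi>, and the surface equation, in the form
      \<open>l$1 + l$2 = - l$3 * (1 + l$1 * l$2)\<close> and its permutations, turns it into a sum
      of diagonal entries.\<close>
    show "2 * (F 1 2 4 i j - l$2 * F 1 1 3 i j) = - (1 + l$1 * l$2) * (F 3 1 1 i j + F 3 2 2 i j)"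
      "2 * (F 1 2 3 i j - l$3 * F 1 1 4 i j) = - (1 + l$1 * l$3) * (F 2 1 1 i j + F 2 2 2 i j)"
      "2 * (F 2 3 4 i j - l$1 * F 2 1 2 i j) = - (1 + l$1 * l$2) * (F 3 1 1 i j + F 3 3 3 i j)"
      "2 * (F 2 2 3 i j - l$3 * F 2 1 4 i j) = - (1 + l$2 * l$3) * (F 1 1 1 i j + F 1 3 3 i j)"
      "2 * (F 3 3 4 i j - l$1 * F 3 1 2 i j) = - (1 + l$1 * l$3) * (F 2 1 1 i j + F 2 4 4 i j)"
      "2 * (F 3 2 4 i j - l$2 * F 3 1 3 i j) = - (1 + l$2 * l$3) * (F 1 1 1 i j + F 1 4 4 i j)"
      unfolding F_def S using g(1) by algebra+
    \<comment> \<open>In each bracket the diagonal coefficient of \<kappa> cancels and a component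
      of \<mu> is left, so the sum is the tangency condition.\<close>
    show "(1 + l$2 * l$3) * (F 1 3 4 i j - l$1 * F 1 1 2 i j) + (1 + l$1 * l$3) * (F 2 2 4 i j - l$2 * F 2 1 3 i j)
       + (1 + l$1 * l$2) * (F 3 2 3 i j - l$3 * F 3 1 4 i j) = 0"
      unfolding F_def S using E(6)[of j i] by (simp add: inner_vec_def sum_3 c)
  qed
  have "\<zeta>$i = 0" for i
    by (rule codazzi_form_inj[OF E(5) g(2-4)]) (use F0 in \<open>simp add: F_def\<close>)
  then show ?thesis by (simp add: vec_eq_iff)
qed

section \<open>Locally Lipschitz solution maps\<close>

definition loc_lip_at :: "('a::real_normed_vector \<Rightarrow> 'b::real_normed_vector) \<Rightarrow> 'a \<Rightarrow> bool" where
  "loc_lip_at f x \<longleftrightarrow> (\<exists>C\<ge>0. \<exists>r>0. \<forall>y\<in>ball x r. \<forall>z\<in>ball x r. norm (f y - f z) \<le> C * norm (y - z))"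

named_theorems loc_lip_intros

lemma loc_lip_atI:
  assumes "r > 0" "\<And>y z. y \<in> ball x r \<Longrightarrow> z \<in> ball x r \<Longrightarrow> norm (f y - f z) \<le> C * norm (y - z)"
  shows "loc_lip_at f x"
  unfolding loc_lip_at_def
proof (intro exI conjI ballI)
  fix y z assume "y \<in> ball x r" "z \<in> ball x r"
  then have "norm (f y - f z) \<le> C * norm (y - z)" by (rule assms)
  also have "\<dots> \<le> \<bar>C\<bar> * norm (y - z)" by (simp add: mult_right_mono)
  finally show "norm (f y - f z) \<le> \<bar>C\<bar> * norm (y - z)" .
qed (use assms in auto)

lemma loc_lip_atE:
  assumes "loc_lip_at f x"
  obtains C r where "C \<ge> 0" "r > 0"
    "\<And>y z. y \<in> ball x r \<Longrightarrow> z \<in> ball x r \<Longrightarrow> norm (f y - f z) \<le> C * norm (y - z)"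
  using assms unfolding loc_lip_at_def by metis

lemma loc_lip_bounded:
  assumes "loc_lip_at f x"
  obtains M r where "M \<ge> 0" "r > 0" "\<And>y. y \<in> ball x r \<Longrightarrow> norm (f y) \<le> M"
proof -
  from assms obtain C r where C: "C \<ge> 0" "r > 0"
    and l: "\<And>y z. y \<in> ball x r \<Longrightarrow> z \<in> ball x r \<Longrightarrow> norm (f y - f z) \<le> C * norm (y - z)"
    by (rule loc_lip_atE) blast
  show thesis
  proof (rule that[of "norm (f x) + C * r" r])
    fix y assume y: "y \<in> ball x r"
    have "norm (f y) \<le> norm (f x) + norm (f y - f x)"
      by (metis add.commute norm_triangle_sub)
    also have "norm (f y - f x) \<le> C * norm (y - x)"
      using l[OF y] C by simp
    also have "\<dots> \<le> C * r"
      using y C by (intro mult_left_mono) (auto simp: dist_norm norm_minus_commute)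
    finally show "norm (f y) \<le> norm (f x) + C * r" by simp
  qed (use C in auto)
qed

lemma loc_lip_const [loc_lip_intros]: "loc_lip_at (\<lambda>_. c) x"
  by (rule loc_lip_atI[of 1 _ _ 0]) auto

lemma loc_lip_id [loc_lip_intros]: "loc_lip_at (\<lambda>x. x) x"
  by (rule loc_lip_atI[of 1 _ _ 1]) auto

lemma loc_lip_bounded_linear:
  assumes "bounded_linear L" "loc_lip_at f x"
  shows "loc_lip_at (\<lambda>x. L (f x)) x"
proof -
  obtain C r where C: "C \<ge> 0" "r > 0"
    and l: "\<And>y z. y \<in> ball x r \<Longrightarrow> z \<in> ball x r \<Longrightarrow> norm (f y - f z) \<le> C * norm (y - z)"
    using assms(2) by (rule loc_lip_atE) blast
  obtain K where K: "\<And>x. norm (L x) \<le> norm x * K" "K > 0"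
    using bounded_linear.pos_bounded[OF assms(1)] by metis
  show ?thesis
  proof (rule loc_lip_atI[OF C(2), where C = "C * K"])
    fix y z assume "y \<in> ball x r" "z \<in> ball x r"
    then have "norm (f y - f z) * K \<le> C * norm (y - z) * K"
      using l K by (intro mult_right_mono) auto
    then show "norm (L (f y) - L (f z)) \<le> C * K * norm (y - z)"
      using K(1)[of "f y - f z"] by (simp add: linear_diff[OF bounded_linear.linear[OF assms(1)]] algebra_simps)
  qed
qed

lemmas loc_lip_components [loc_lip_intros] =
  loc_lip_bounded_linear[OF bounded_linear_fst] loc_lip_bounded_linear[OF bounded_linear_snd]
  loc_lip_bounded_linear[OF bounded_linear_vec_nth]

lemma loc_lip_add [loc_lip_intros]:
  assumes "loc_lip_at f x" "loc_lip_at g x"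
  shows "loc_lip_at (\<lambda>x. f x + g x) x"
proof -
  obtain C r where C: "C \<ge> 0" "r > 0"
    and l: "\<And>y z. y \<in> ball x r \<Longrightarrow> z \<in> ball x r \<Longrightarrow> norm (f y - f z) \<le> C * norm (y - z)"
    using assms(1) by (rule loc_lip_atE) blast
  obtain C' r' where C': "C' \<ge> 0" "r' > 0"
    and l': "\<And>y z. y \<in> ball x r' \<Longrightarrow> z \<in> ball x r' \<Longrightarrow> norm (g y - g z) \<le> C' * norm (y - z)"
    using assms(2) by (rule loc_lip_atE) blast
  show ?thesis
  proof (rule loc_lip_atI[of "min r r'" _ _ "C + C'"])
    fix y z assume "y \<in> ball x (min r r')" "z \<in> ball x (min r r')"
    then show "norm (f y + g y - (f z + g z)) \<le> (C + C') * norm (y - z)"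
      using l[of y z] l'[of y z] norm_triangle_ineq[of "f y - f z" "g y - g z"]
      by (simp add: algebra_simps)
  qed (use C C' in auto)
qed

lemma loc_lip_minus [loc_lip_intros]: "loc_lip_at f x \<Longrightarrow> loc_lip_at (\<lambda>x. - f x) x"
  by (rule loc_lip_bounded_linear[OF bounded_linear_minus[OF bounded_linear_ident]])

lemma loc_lip_diff [loc_lip_intros]:
  "loc_lip_at f x \<Longrightarrow> loc_lip_at g x \<Longrightarrow> loc_lip_at (\<lambda>x. f x - g x) x"
  using loc_lip_add[of f x "\<lambda>x. - g x"] loc_lip_minus[of g x] by simp

lemma loc_lip_sum [loc_lip_intros]:
  "(\<And>i. i \<in> I \<Longrightarrow> loc_lip_at (f i) x) \<Longrightarrow> loc_lip_at (\<lambda>x. \<Sum>i\<in>I. f i x) x"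
  by (induction I rule: infinite_finite_induct) (simp_all add: loc_lip_const loc_lip_add)

lemma loc_lip_bilinear:
  assumes "bounded_bilinear P" "loc_lip_at f x" "loc_lip_at g x"
  shows "loc_lip_at (\<lambda>x. P (f x) (g x)) x"
proof -
  interpret P: bounded_bilinear P by fact
  obtain C r where C: "C \<ge> 0" "r > 0"
    and l: "\<And>y z. y \<in> ball x r \<Longrightarrow> z \<in> ball x r \<Longrightarrow> norm (f y - f z) \<le> C * norm (y - z)"
    using assms(2) by (rule loc_lip_atE) blast
  obtain C' r' where C': "C' \<ge> 0" "r' > 0"
    and l': "\<And>y z. y \<in> ball x r' \<Longrightarrow> z \<in> ball x r' \<Longrightarrow> norm (g y - g z) \<le> C' * norm (y - z)"
    using assms(3) by (rule loc_lip_atE) blast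
  obtain M q where M: "M \<ge> 0" "q > 0" "\<And>y. y \<in> ball x q \<Longrightarrow> norm (f y) \<le> M"
    using assms(2) by (rule loc_lip_bounded) blast
  obtain M' q' where M': "M' \<ge> 0" "q' > 0" "\<And>y. y \<in> ball x q' \<Longrightarrow> norm (g y) \<le> M'"
    using assms(3) by (rule loc_lip_bounded) blast
  obtain K where K: "\<And>a b. norm (P a b) \<le> norm a * norm b * K" "K > 0"
    using P.pos_bounded by metis
  show ?thesis
  proof (rule loc_lip_atI[of "min (min r r') (min q q')" _ _ "C * M' * K + M * C' * K"])
    fix y z assume "y \<in> ball x (min (min r r') (min q q'))" "z \<in> ball x (min (min r r') (min q q'))"
    then have b: "norm (f y - f z) \<le> C * norm (y - z)" "norm (g y - g z) \<le> C' * norm (y - z)"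
      "norm (f z) \<le> M" "norm (g y) \<le> M'"
      using l[of y z] l'[of y z] M(3)[of z] M'(3)[of y] by simp_all
    have "P (f y) (g y) - P (f z) (g z) = P (f y - f z) (g y) + P (f z) (g y - g z)"
      by (simp add: P.diff_left P.diff_right)
    then have "norm (P (f y) (g y) - P (f z) (g z)) \<le> norm (P (f y - f z) (g y)) + norm (P (f z) (g y - g z))"
      by (simp add: norm_triangle_ineq)
    also have "\<dots> \<le> (C * norm (y - z)) * M' * K + M * (C' * norm (y - z)) * K"
    proof (rule add_mono)
      show "norm (P (f y - f z) (g y)) \<le> (C * norm (y - z)) * M' * K"
        by (rule order_trans[OF K(1)], rule mult_right_mono, rule mult_mono) (use b C M' K in simp_all)
      show "norm (P (f z) (g y - g z)) \<le> M * (C' * norm (y - z)) * K"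
        by (rule order_trans[OF K(1)], rule mult_right_mono, rule mult_mono) (use b C' M K in simp_all)
    qed
    finally show "norm (P (f y) (g y) - P (f z) (g z)) \<le> (C * M' * K + M * C' * K) * norm (y - z)"
      by (simp add: algebra_simps)
  qed (use C C' M M' in auto)
qed

lemmas loc_lip_products [loc_lip_intros] =
  loc_lip_bilinear[OF bounded_bilinear_mult] loc_lip_bilinear[OF bounded_bilinear_scaleR]
  loc_lip_bilinear[OF bounded_bilinear_inner]

lemma loc_lip_Pair [loc_lip_intros]:
  assumes "loc_lip_at f x" "loc_lip_at g x"
  shows "loc_lip_at (\<lambda>x. (f x, g x)) x"
proof -
  obtain C r where C: "C \<ge> 0" "r > 0"
    and l: "\<And>y z. y \<in> ball x r \<Longrightarrow> z \<in> ball x r \<Longrightarrow> norm (f y - f z) \<le> C * norm (y - z)"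
    using assms(1) by (rule loc_lip_atE) blast
  obtain C' r' where C': "C' \<ge> 0" "r' > 0"
    and l': "\<And>y z. y \<in> ball x r' \<Longrightarrow> z \<in> ball x r' \<Longrightarrow> norm (g y - g z) \<le> C' * norm (y - z)"
    using assms(2) by (rule loc_lip_atE) blast
  show ?thesis
  proof (rule loc_lip_atI[of "min r r'" _ _ "C + C'"])
    fix y z assume "y \<in> ball x (min r r')" "z \<in> ball x (min r r')"
    then show "norm ((f y, g y) - (f z, g z)) \<le> (C + C') * norm (y - z)"
      using l[of y z] l'[of y z] norm_Pair_le[of "f y - f z" "g y - g z"]
      by (simp add: algebra_simps)
  qed (use C C' in auto)
qed

lemma loc_lip_vec_lambda [loc_lip_intros]:
  fixes f :: "'a::real_normed_vector \<Rightarrow> 'i::finite \<Rightarrow> 'b::euclidean_space"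
  assumes "\<And>i. loc_lip_at (\<lambda>x. f x i) x"
  shows "loc_lip_at (\<lambda>x. \<chi> i. f x i) x"
proof -
  have "bounded_linear (\<lambda>a::'b. axis i a :: 'b^'i)" for i
    by (rule linear_conv_bounded_linear[THEN iffD1], rule linearI)
      (simp_all add: axis_def vec_eq_iff)
  then have "loc_lip_at (\<lambda>x. \<Sum>i\<in>UNIV. axis i (f x i)) x"
    using loc_lip_bounded_linear[OF _ assms] by (intro loc_lip_sum) blast
  moreover have "(\<Sum>i\<in>UNIV. axis i (f x i)) = (\<chi> i. f x i)" for x
    by (simp add: vec_eq_iff axis_def if_distrib cong: if_cong)
  ultimately show ?thesis by simp
qed

text \<open>A relation takes the place of a solution map because the linear system for the
  derivatives is overdetermined and may have no solution at points away from the integral 4-folds.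
  It implies that solutions near \<open>s\<close> are unique: take \<open>x = x'\<close>.\<close>

definition lip_rel :: "('a::real_normed_vector \<times> 'b::real_normed_vector) set \<Rightarrow> 'a \<Rightarrow> bool" where
  "lip_rel R s \<longleftrightarrow> (\<exists>C\<ge>0. \<exists>r>0. \<forall>x z x' z'. (x, z) \<in> R \<longrightarrow> (x', z') \<in> R \<longrightarrow> x \<in> ball s r \<longrightarrow> x' \<in> ball s r
     \<longrightarrow> norm (z - z') \<le> C * norm (x - x'))"

lemma lip_relI:
  assumes "r > 0" "C \<ge> 0" "\<And>x z x' z'. (x, z) \<in> R \<Longrightarrow> (x', z') \<in> R \<Longrightarrow> x \<in> ball s r \<Longrightarrow> x' \<in> ball s r
     \<Longrightarrow> norm (z - z') \<le> C * norm (x - x')"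
  shows "lip_rel R s"
  unfolding lip_rel_def using assms by blast

lemma lip_relE:
  assumes "lip_rel R s"
  obtains C r where "C \<ge> 0" "r > 0" "\<And>x z x' z'. (x, z) \<in> R \<Longrightarrow> (x', z') \<in> R \<Longrightarrow> x \<in> ball s r \<Longrightarrow> x' \<in> ball s r
     \<Longrightarrow> norm (z - z') \<le> C * norm (x - x')"
  using assms unfolding lip_rel_def by metis

text \<open>Injectivity at \<open>s\<close> is a lower bound on \<open>L s\<close>, half of which
  survives for nearby \<open>x\<close>. Subtracting the equations for two solutions and applying
  this bound gives the estimate; no surjectivity enters.\<close>

lemma lip_rel_linear_system:
  fixes L :: "'a::real_normed_vector \<Rightarrow> 'b::euclidean_space \<Rightarrow> 'c::euclidean_space"
  assumes lin: "\<And>s. linear (L s)"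
    and L: "loc_lip_at (\<lambda>p. L (fst p) (snd p)) (s, 0)" and Q: "loc_lip_at Q s"
    and inj: "\<And>z. L s z = 0 \<Longrightarrow> z = 0"
  shows "lip_rel {(x, z). L x z = Q x} s"
proof -
  obtain B where B: "B > 0" "\<And>z. B * norm z \<le> norm (L s z)"
    using linear_inj_bounded_below_pos[OF lin, of s] inj linear_injective_0[OF lin, of s] by metis
  obtain C r where C: "C \<ge> 0" "r > 0"
    and l: "\<And>y z. y \<in> ball (s, 0) r \<Longrightarrow> z \<in> ball (s, 0) r \<Longrightarrow>
       norm (L (fst y) (snd y) - L (fst z) (snd z)) \<le> C * norm (y - z)"
    using L by (rule loc_lip_atE) blast
  obtain D q where D: "D \<ge> 0" "q > 0"
    and lQ: "\<And>y z. y \<in> ball s q \<Longrightarrow> z \<in> ball s q \<Longrightarrow> norm (Q y - Q z) \<le> D * norm (y - z)"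
    using Q by (rule loc_lip_atE) blast
  obtain M t where M: "M \<ge> 0" "t > 0" "\<And>y. y \<in> ball s t \<Longrightarrow> norm (Q y) \<le> M"
    using Q by (rule loc_lip_bounded) blast
  \<comment> \<open>By linearity in \<open>z\<close> the Lipschitz estimate near
    \<open>(s, 0)\<close> extends to all \<open>z\<close>: rescaling to length \<open>r / 2\<close>
    costs the factor \<open>2 / r\<close>.\<close>
  define K where "K = C * (2 / r)"
  have K: "K \<ge> 0" using C by (simp add: K_def)
  have LL: "norm (L x z - L x' z) \<le> K * norm (x - x') * norm z"
    if x: "x \<in> ball s (r/2)" "x' \<in> ball s (r/2)" for x x' z
  proof (cases "z = 0")
    case True
    then show ?thesis using linear_0[OF lin] by simp
  next
    case False
    define e where "e = (r / 2) / norm z"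
    have e: "e > 0" using False C by (simp add: e_def)
    have "norm (e *\<^sub>R z) = r / 2" using False C by (simp add: e_def)
    then have "(x, e *\<^sub>R z) \<in> ball (s, 0) r" "(x', e *\<^sub>R z) \<in> ball (s, 0) r"
      using x norm_Pair_le[of "s - x" "- (e *\<^sub>R z)"] norm_Pair_le[of "s - x'" "- (e *\<^sub>R z)"] 
      by (auto simp: dist_norm)
    from l[OF this] have "e * norm (L x z - L x' z) \<le> C * norm (x - x')"
      using e by (simp add: linear_scale[OF lin] norm_Pair flip: scaleR_diff_right)
    then have "norm (L x z - L x' z) \<le> C * norm (x - x') / e"
      using e by (simp add: field_simps)
    also have "\<dots> = K * norm (x - x') * norm z"
      using False C by (simp add: e_def K_def field_simps)
    finally show ?thesis .
  qed
  \<comment> \<open>Within \<open>B / (2 * (K + 1))\<close> of \<open>s\<close> the perturbation of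
    \<open>L\<close> uses up at most half of the bound \<open>B\<close>; \<open>q\<close> and
    \<open>t\<close> keep \<open>Q\<close> Lipschitz and bounded.\<close>
  define p where "p = min (min (r/2) (B / (2 * (K + 1)))) (min q t)"
  have low: "B / 2 * norm z \<le> norm (L x z)" if "x \<in> ball s p" for x z
  proof -
    have "norm (L x z - L s z) \<le> K * norm (x - s) * norm z"
      using that C by (intro LL) (auto simp: p_def)
    also have "\<dots> \<le> (B / 2) * norm z"
    proof (rule mult_right_mono)
      have "norm (x - s) \<le> B / (2 * (K + 1))"
        using that by (auto simp: p_def dist_norm norm_minus_commute)
      then have "(K + 1) * norm (x - s) \<le> B / 2"
        using K by (simp add: field_simps)
      then show "K * norm (x - s) \<le> B / 2"
        using norm_ge_zero[of "x - s"] by (simp add: algebra_simps del: norm_ge_zero)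
    qed simp
    finally show ?thesis
      using B(2)[of z] norm_triangle_ineq2[of "L s z" "L x z"] by (simp add: norm_minus_commute)
  qed
  \<comment> \<open>The factor \<open>2 / B\<close> inverts the surviving lower bound, and
    \<open>2 * M / B\<close> bounds every solution over the ball.\<close>
  define A where "A = (2 / B) * (D + K * (2 * M / B))"
  show ?thesis
  proof (rule lip_relI[of p A])
    show "p > 0" using C B K D M by (simp add: p_def)
    show "A \<ge> 0" using B D K M by (simp add: A_def)
    fix x z x' z' assume R: "(x, z) \<in> {(x, z). L x z = Q x}" "(x', z') \<in> {(x, z). L x z = Q x}"
      and x: "x \<in> ball s p" "x' \<in> ball s p"
    have "norm (Q x') \<le> M" using M x by (auto simp: p_def)
    then have "B / 2 * norm z' \<le> M" using low[OF x(2), of z'] R by simp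
    then have z': "norm z' \<le> 2 * M / B" using B by (simp add: field_simps)
    have "L x (z - z') = (Q x - Q x') - (L x z' - L x' z')"
      using R by (simp add: linear_diff[OF lin])
    then have "norm (L x (z - z')) \<le> norm (Q x - Q x') + norm (L x z' - L x' z')"
      by (simp add: norm_triangle_ineq4)
    also have "\<dots> \<le> D * norm (x - x') + K * norm (x - x') * norm z'"
      using x by (intro add_mono lQ LL) (auto simp: p_def)
    also have "\<dots> \<le> D * norm (x - x') + K * norm (x - x') * (2 * M / B)"
      using z' K by (intro add_left_mono mult_left_mono) auto
    finally have "B / 2 * norm (z - z') \<le> D * norm (x - x') + K * norm (x - x') * (2 * M / B)"
      using low[OF x(1), of "z - z'"] by simp
    then show "norm (z - z') \<le> A * norm (x - x')"
      using B by (simp add: A_def field_simps)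
  qed
qed

lemma lip_rel_Pair:
  assumes "lip_rel R s" "lip_rel R' s"
  shows "lip_rel {(x, z, w). (x, z) \<in> R \<and> (x, w) \<in> R'} s"
proof -
  obtain C r where C: "C \<ge> 0" "r > 0" and l: "\<And>x z x' z'. (x, z) \<in> R \<Longrightarrow> (x', z') \<in> R \<Longrightarrow> x \<in> ball s r \<Longrightarrow> x' \<in> ball s r
     \<Longrightarrow> norm (z - z') \<le> C * norm (x - x')" using assms(1) by (rule lip_relE) blast
  obtain C' r' where C': "C' \<ge> 0" "r' > 0" and l': "\<And>x z x' z'. (x, z) \<in> R' \<Longrightarrow> (x', z') \<in> R' \<Longrightarrow> x \<in> ball s r' \<Longrightarrow> x' \<in> ball s r'
     \<Longrightarrow> norm (z - z') \<le> C' * norm (x - x')" using assms(2) by (rule lip_relE) blast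
  show ?thesis
  proof (rule lip_relI[of "min r r'" "C + C'"], goal_cases)
    case (3 x z x' z')
    then show ?case
      using l[of x "fst z" x' "fst z'"] l'[of x "snd z" x' "snd z'"]
        norm_Pair_le[of "fst z - fst z'" "snd z - snd z'"]
      by (auto simp: algebra_simps case_prod_beta minus_prod_def)
  qed (use C C' in auto)
qed

text \<open>Since \<open>(s, z0)\<close> is in the relation, the Lipschitz estimate forces all pairs
  over points near \<open>s\<close> to lie near \<open>(s, z0)\<close>, where \<open>W\<close> is
  Lipschitz.\<close>

lemma lip_rel_image:
  assumes "lip_rel R s" "(s, z0) \<in> R" "loc_lip_at (\<lambda>p. W (fst p) (snd p)) (s, z0)"
  shows "lip_rel {(x, W x z) | x z. (x, z) \<in> R} s"
proof -
  obtain C r where C: "C \<ge> 0" "r > 0" and l: "\<And>x z x' z'. (x, z) \<in> R \<Longrightarrow> (x', z') \<in> R \<Longrightarrow> x \<in> ball s r \<Longrightarrow> x' \<in> ball s r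
     \<Longrightarrow> norm (z - z') \<le> C * norm (x - x')" using assms(1) by (rule lip_relE) blast
  obtain D q where D: "D \<ge> 0" "q > 0"
    and lW: "\<And>y z. y \<in> ball (s, z0) q \<Longrightarrow> z \<in> ball (s, z0) q \<Longrightarrow> norm (W (fst y) (snd y) - W (fst z) (snd z)) \<le> D * norm (y - z)"
    using assms(3) by (rule loc_lip_atE) blast
  have near: "(x, z) \<in> ball (s, z0) q" if "(x, z) \<in> R" "x \<in> ball s (min r (q / (1 + C)))" for x z
  proof -
    have "norm (x - s) < q / (1 + C)" using that by (auto simp: dist_norm norm_minus_commute)
    then have "(1 + C) * norm (x - s) < q" using C by (simp add: field_simps)
    moreover have "norm (z - z0) \<le> C * norm (x - s)"
      using that assms(2) C by (intro l) auto
    ultimately show ?thesis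
      using norm_Pair_le[of "s - x" "z0 - z"] by (simp add: dist_norm norm_minus_commute algebra_simps)
  qed
  show ?thesis
  proof (rule lip_relI[of "min r (q / (1 + C))" "D * (1 + C)"], goal_cases)
    case (3 x w x' w')
    then obtain z z' where z: "w = W x z" "(x, z) \<in> R" "w' = W x' z'" "(x', z') \<in> R" by blast
    have "norm (w - w') \<le> D * norm ((x, z) - (x', z'))"
      using lW[OF near[OF z(2) 3(3)] near[OF z(4) 3(4)]] z by simp
    also have "\<dots> \<le> D * (norm (x - x') + C * norm (x - x'))"
      using norm_Pair_le[of "x - x'" "z - z'"] l[OF z(2,4)] 3 D
      by (intro mult_left_mono) auto
    finally show ?case by (simp add: algebra_simps)
  qed (use C D in auto)
qed

section \<open>Uniqueness along rays and symmetry of second derivatives\<close>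

lemma continuous_at_distE:
  assumes "continuous (at x) f" "e > 0"
  obtains d where "d > 0" "\<And>y. dist y x < d \<Longrightarrow> dist (f y) (f x) < e"
  using assms unfolding continuous_at_eps_delta by blast

text \<open>Restricted to a segment from \<open>y0\<close>, the total differential system becomes an
  ordinary differential equation, and Gronwall's argument applies to the difference of the two
  solutions.\<close>

lemma lip_rel_ode_unique:
  fixes \<sigma> \<tau> :: "real^'n \<Rightarrow> 'b::euclidean_space" and R :: "('b \<times> ('b^'n)) set"
  assumes V: "open V" "y0 \<in> V"
    and s: "\<And>y. y \<in> V \<Longrightarrow> \<exists>W. (\<sigma> y, W) \<in> R \<and> (\<sigma> has_derivative (\<lambda>v. \<Sum>j\<in>UNIV. v$j *\<^sub>R W$j)) (at y)"
    and t: "\<And>y. y \<in> V \<Longrightarrow> \<exists>W. (\<tau> y, W) \<in> R \<and> (\<tau> has_derivative (\<lambda>v. \<Sum>j\<in>UNIV. v$j *\<^sub>R W$j)) (at y)"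
    and R: "lip_rel R (\<sigma> y0)" and eq: "\<sigma> y0 = \<tau> y0"
  obtains \<rho> where "\<rho> > 0" "ball y0 \<rho> \<subseteq> V" "\<And>y. y \<in> ball y0 \<rho> \<Longrightarrow> \<sigma> y = \<tau> y"
proof -
  obtain C r where C: "C \<ge> 0" "r > 0" and l: "\<And>x z x' z'. (x, z) \<in> R \<Longrightarrow> (x', z') \<in> R \<Longrightarrow> x \<in> ball (\<sigma> y0) r \<Longrightarrow>
     x' \<in> ball (\<sigma> y0) r \<Longrightarrow> norm (z - z') \<le> C * norm (x - x')" using R by (rule lip_relE) blast
  have "continuous (at y0) \<sigma>" "continuous (at y0) \<tau>"
    using s[OF V(2)] t[OF V(2)] has_derivative_continuous by blast+
  then obtain d e where d: "d > 0" "\<And>y. dist y y0 < d \<Longrightarrow> dist (\<sigma> y) (\<sigma> y0) < r"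
    and e: "e > 0" "\<And>y. dist y y0 < e \<Longrightarrow> dist (\<tau> y) (\<tau> y0) < r"
    using C(2) continuous_at_distE by metis
  obtain q where q: "q > 0" "ball y0 q \<subseteq> V" using V openE by blast
  define \<rho> where "\<rho> = min q (min d e)"
  show thesis
  proof (rule that[of \<rho>])
    show "\<rho> > 0" "ball y0 \<rho> \<subseteq> V" using q d e by (auto simp: \<rho>_def)
    fix y assume y: "y \<in> ball y0 \<rho>"
    define v where "v = y - y0"
    define p where "p u = y0 + u *\<^sub>R v" for u :: real
    have p: "p u \<in> ball y0 \<rho>" if "0 \<le> u" "u \<le> 1" for u
    proof -
      have "dist y0 (p u) = u * norm v" using that by (simp add: p_def dist_norm)
      also have "\<dots> \<le> norm v" using that by (simp add: mult_left_le_one_le)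
      finally show ?thesis using y by (simp add: v_def dist_norm norm_minus_commute)
    qed
    define \<delta> where "\<delta> u = \<sigma> (p u) - \<tau> (p u)" for u
    define K where "K = norm v * C * CARD('n)"
    have "\<exists>D. (\<delta> has_vector_derivative D) (at u) \<and> norm D \<le> K * norm (\<delta> u)" if u: "0 \<le> u" "u \<le> 1" for u
    proof -
      have pu: "p u \<in> V" "p u \<in> ball y0 \<rho>" using p[OF u] q by (auto simp: \<rho>_def)
      obtain W where W: "(\<sigma> (p u), W) \<in> R" "(\<sigma> has_derivative (\<lambda>v. \<Sum>j\<in>UNIV. v$j *\<^sub>R W$j)) (at (p u))"
        using s[OF pu(1)] by blast
      obtain X where X: "(\<tau> (p u), X) \<in> R" "(\<tau> has_derivative (\<lambda>v. \<Sum>j\<in>UNIV. v$j *\<^sub>R X$j)) (at (p u))"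
        using t[OF pu(1)] by blast
      have pd: "(p has_vector_derivative v) (at u)"
        unfolding p_def by (auto intro!: derivative_eq_intros)
      have "((\<lambda>u. \<sigma> (p u)) has_vector_derivative (\<Sum>j\<in>UNIV. v$j *\<^sub>R W$j)) (at u)"
        using vector_derivative_diff_chain_within[of p v u UNIV \<sigma>] pd W(2) 
        by (auto simp: o_def intro: has_derivative_at_withinI)
      moreover have "((\<lambda>u. \<tau> (p u)) has_vector_derivative (\<Sum>j\<in>UNIV. v$j *\<^sub>R X$j)) (at u)"
        using vector_derivative_diff_chain_within[of p v u UNIV \<tau>] pd X(2)
        by (auto simp: o_def intro: has_derivative_at_withinI)
      ultimately have "(\<delta> has_vector_derivative (\<Sum>j\<in>UNIV. v$j *\<^sub>R W$j) - (\<Sum>j\<in>UNIV. v$j *\<^sub>R X$j)) (at u)"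
        unfolding \<delta>_def by (rule has_vector_derivative_diff)
      moreover have "norm ((\<Sum>j\<in>UNIV. v$j *\<^sub>R W$j) - (\<Sum>j\<in>UNIV. v$j *\<^sub>R X$j)) \<le> K * norm (\<delta> u)"
      proof -
        have n: "norm (W - X) \<le> C * norm (\<delta> u)"
          unfolding \<delta>_def using d(2)[of "p u"] e(2)[of "p u"] pu(2)
          by (intro l[OF W(1) X(1)]) (auto simp: \<rho>_def dist_commute eq)
        have "(\<Sum>j\<in>UNIV. v$j *\<^sub>R W$j) - (\<Sum>j\<in>UNIV. v$j *\<^sub>R X$j) = (\<Sum>j\<in>UNIV. v$j *\<^sub>R (W - X)$j)"
          by (simp add: sum_subtractf scaleR_diff_right)
        also have "norm \<dots> \<le> (\<Sum>j\<in>(UNIV::'n set). norm v * (C * norm (\<delta> u)))"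
        proof (rule sum_norm_le)
          fix j :: 'n
          have "norm (v$j *\<^sub>R (W - X)$j) \<le> norm v * norm (W - X)"
            using component_le_norm_cart[of v j] Finite_Cartesian_Product.norm_nth_le[of "W - X" j]
            by (simp add: mult_mono)
          also have "\<dots> \<le> norm v * (C * norm (\<delta> u))" using n by (intro mult_left_mono) auto
          finally show "norm (v$j *\<^sub>R (W - X)$j) \<le> norm v * (C * norm (\<delta> u))" .
        qed
        finally show ?thesis by (simp add: K_def algebra_simps)
      qed
      ultimately show ?thesis by blast
    qed
    then obtain D where D: "\<And>u. 0 \<le> u \<Longrightarrow> u \<le> 1 \<Longrightarrow> (\<delta> has_vector_derivative D u) (at u)"
      "\<And>u. 0 \<le> u \<Longrightarrow> u \<le> 1 \<Longrightarrow> norm (D u) \<le> K * norm (\<delta> u)" by metis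
    \<comment> \<open>As the derivative of \<delta> is at most \<open>K\<close> times \<delta> in
      norm, this weighted square does not increase, and it starts at 0.\<close>
    define h where "h u = exp (- 2 * K * u) * (\<delta> u \<bullet> \<delta> u)" for u
    have "h 1 \<le> h 0"
    proof (rule DERIV_nonpos_imp_nonincreasing[of 0 1 h])
      fix u :: real assume u: "0 \<le> u" "u \<le> 1"
      have "((\<lambda>u. \<delta> u \<bullet> \<delta> u) has_vector_derivative (\<delta> u \<bullet> D u + D u \<bullet> \<delta> u)) (at u)"
        by (rule bounded_bilinear.has_vector_derivative[OF bounded_bilinear_inner D(1)[OF u] D(1)[OF u]])
      then have "((\<lambda>u. \<delta> u \<bullet> \<delta> u) has_real_derivative 2 * (\<delta> u \<bullet> D u)) (at u)"
        by (simp add: has_real_derivative_iff_has_vector_derivative inner_commute)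
      then have "(h has_real_derivative exp (- 2 * K * u) * (2 * (\<delta> u \<bullet> D u) - 2 * K * (\<delta> u \<bullet> \<delta> u))) (at u)"
        unfolding h_def by (auto intro!: derivative_eq_intros simp: algebra_simps)
      moreover have "\<delta> u \<bullet> D u \<le> K * (\<delta> u \<bullet> \<delta> u)"
      proof -
        have "\<delta> u \<bullet> D u \<le> norm (\<delta> u) * norm (D u)" by (rule norm_cauchy_schwarz)
        also have "\<dots> \<le> norm (\<delta> u) * (K * norm (\<delta> u))" using D(2)[OF u] by (intro mult_left_mono) auto
        finally show ?thesis by (simp add: power2_norm_eq_inner[symmetric] power2_eq_square algebra_simps)
      qed
      ultimately show "\<exists>y. (h has_real_derivative y) (at u) \<and> y \<le> 0"
        by (intro exI conjI) (auto intro!: mult_nonneg_nonpos)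
    qed simp
    moreover have "h 0 = 0" by (simp add: h_def \<delta>_def p_def eq)
    ultimately have "\<delta> 1 \<bullet> \<delta> 1 \<le> 0" by (simp add: h_def mult_le_0_iff)
    then have "\<delta> 1 = 0" by (metis inner_eq_zero_iff inner_ge_zero order_antisym)
    then show "\<sigma> y = \<tau> y" by (simp add: \<delta>_def p_def v_def)
  qed
qed

section \<open>Symmetry of second derivatives\<close>

lemma smooth_on_open: "smooth_on U f \<Longrightarrow> open U"
  by (simp add: smooth_on_def)

lemma smooth_on_has_derivative:
  assumes "smooth_on U f" "x \<in> U"
  shows "(f has_derivative frechet_derivative f (at x)) (at x)"
proof -
  have "Ck_on (Suc 0) U f" using assms by (simp add: smooth_on_def)
  then show ?thesis using assms frechet_derivative_works by auto
qed

lemma smooth_on_directional: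
  assumes "smooth_on U f"
  shows "smooth_on U (\<lambda>x. frechet_derivative f (at x) v)"
  unfolding smooth_on_def
proof (intro conjI allI)
  show "open U" using assms by (simp add: smooth_on_def)
  fix k
  have "Ck_on (Suc k) U f" using assms by (simp add: smooth_on_def)
  then show "Ck_on k U (\<lambda>x. frechet_derivative f (at x) v)" by simp
qed

lemma smooth_on_continuous: "smooth_on U f \<Longrightarrow> continuous_on U f"
  by (metis Ck_on.simps(1) smooth_on_def)

text \<open>The mean value theorem is applied in the direction \<open>v\<close> to the difference of
  two parallel edges, and then in the direction \<open>w\<close> to the derivative obtained.\<close>

lemma second_difference_mvt:
  fixes F :: "'a::real_normed_vector \<Rightarrow> real"
  assumes s: "s > 0" and S: "\<And>a b. 0 \<le> a \<Longrightarrow> a \<le> s \<Longrightarrow> 0 \<le> b \<Longrightarrow> b \<le> s \<Longrightarrow> x + a *\<^sub>R v + b *\<^sub>R w \<in> S"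
    and F: "\<And>y. y \<in> S \<Longrightarrow> (F has_derivative F' y) (at y)"
    and G: "\<And>y. y \<in> S \<Longrightarrow> ((\<lambda>y. F' y v) has_derivative G y) (at y)"
  obtains a b where "0 \<le> a" "a \<le> s" "0 \<le> b" "b \<le> s"
    "F (x + s *\<^sub>R v + s *\<^sub>R w) - F (x + s *\<^sub>R v) - F (x + s *\<^sub>R w) + F x = s * s * G (x + a *\<^sub>R v + b *\<^sub>R w) w"
proof -
  define \<phi> where "\<phi> t = F (x + t *\<^sub>R v + s *\<^sub>R w) - F (x + t *\<^sub>R v + 0 *\<^sub>R w)" for t
  have line: "((\<lambda>t. H (c + t *\<^sub>R u)) has_real_derivative H' u) (at t)"
    if "(H has_derivative H') (at (c + t *\<^sub>R u))" for H :: "'a \<Rightarrow> real" and H' c u t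
  proof -
    have "((\<lambda>t. c + t *\<^sub>R u) has_vector_derivative u) (at t)"
      by (auto intro!: derivative_eq_intros)
    then have "((H \<circ> (\<lambda>t. c + t *\<^sub>R u)) has_vector_derivative H' u) (at t)"
      by (rule vector_derivative_diff_chain_within) (use that in \<open>auto intro: has_derivative_at_withinI\<close>)
    then show ?thesis by (simp add: o_def has_real_derivative_iff_has_vector_derivative)
  qed
  have d1: "(\<phi> has_real_derivative (F' (x + t *\<^sub>R v + s *\<^sub>R w) v - F' (x + t *\<^sub>R v + 0 *\<^sub>R w) v)) (at t)"
    if t: "0 \<le> t" "t \<le> s" for t
  proof -
    have "((\<lambda>t. F ((x + b *\<^sub>R w) + t *\<^sub>R v)) has_real_derivative F' ((x + b *\<^sub>R w) + t *\<^sub>R v) v) (at t)"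
      if "0 \<le> b" "b \<le> s" for b
      using S[OF t that] by (intro line F) (simp add: algebra_simps)
    from this[of s] this[of 0] show ?thesis
      unfolding \<phi>_def using s by (auto intro!: derivative_eq_intros simp: algebra_simps)
  qed
  obtain a where a: "0 < a" "a < s" "\<phi> s - \<phi> 0 = (s - 0) * (F' (x + a *\<^sub>R v + s *\<^sub>R w) v - F' (x + a *\<^sub>R v + 0 *\<^sub>R w) v)"
    using MVT2[OF s d1] by blast
  have d2: "((\<lambda>t. F' (x + a *\<^sub>R v + t *\<^sub>R w) v) has_real_derivative G (x + a *\<^sub>R v + t *\<^sub>R w) w) (at t)"
    if "0 \<le> t" "t \<le> s" for t
    using S[of a t] a that by (intro line[where H = "\<lambda>y. F' y v"] G) auto
  obtain b where b: "0 < b" "b < s" "F' (x + a *\<^sub>R v + s *\<^sub>R w) v - F' (x + a *\<^sub>R v + 0 *\<^sub>R w) v = (s - 0) * G (x + a *\<^sub>R v + b *\<^sub>R w) w"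
    using MVT2[OF s d2] by blast
  show thesis
    by (rule that[of a b]) (use a b in \<open>auto simp: \<phi>_def\<close>)
qed

text \<open>The second difference over a small parallelogram is symmetric in \<open>v\<close> and
  \<open>w\<close>, so a value of \<open>G\<close> in the direction \<open>w\<close> equals a value
  of \<open>H\<close> in the direction \<open>v\<close> at points near \<open>x\<close>. Continuity
  excludes a gap of \<open>2 * e\<close> between the values at \<open>x\<close>.\<close>

lemma frechet_derivative_symmetric_real:
  fixes F :: "'a::euclidean_space \<Rightarrow> real"
  assumes U: "open U" "x \<in> U"
    and F: "\<And>y. y \<in> U \<Longrightarrow> (F has_derivative F' y) (at y)"
    and G: "\<And>y. y \<in> U \<Longrightarrow> ((\<lambda>y. F' y v) has_derivative G y) (at y)"
    and H: "\<And>y. y \<in> U \<Longrightarrow> ((\<lambda>y. F' y w) has_derivative H y) (at y)"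
    and c: "continuous_on U (\<lambda>y. G y w)" "continuous_on U (\<lambda>y. H y v)"
  shows "G x w = H x v"
proof (rule ccontr)
  assume ne: "G x w \<noteq> H x v"
  define e where "e = \<bar>G x w - H x v\<bar> / 2"
  have e: "e > 0" using ne by (simp add: e_def)
  have "continuous (at x) (\<lambda>y. G y w)" "continuous (at x) (\<lambda>y. H y v)"
    using c U by (auto simp: continuous_on_eq_continuous_at)
  then obtain d d' where d: "d > 0" "\<And>y. dist y x < d \<Longrightarrow> dist (G y w) (G x w) < e"
    and d': "d' > 0" "\<And>y. dist y x < d' \<Longrightarrow> dist (H y v) (H x v) < e"
    using e continuous_at_distE by metis
  obtain q where q: "q > 0" "ball x q \<subseteq> U" using U openE by blast
  define m where "m = min q (min d d')"
  define s where "s = m / (norm v + norm w + 1)"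
  have m: "m > 0" using q d d' by (simp add: m_def)
  have s: "s > 0" using m by (simp add: s_def add_nonneg_pos)
  have near: "dist (x + a *\<^sub>R v + b *\<^sub>R w) x < m" if "0 \<le> a" "a \<le> s" "0 \<le> b" "b \<le> s" for a b
  proof -
    have "dist (x + a *\<^sub>R v + b *\<^sub>R w) x \<le> a * norm v + b * norm w"
      using norm_triangle_ineq[of "a *\<^sub>R v" "b *\<^sub>R w"] that by (simp add: dist_norm add.assoc)
    also have "\<dots> \<le> s * norm v + s * norm w"
      using that by (intro add_mono mult_right_mono) auto
    also have "\<dots> < s * (norm v + norm w + 1)" using s by (simp add: algebra_simps)
    also have "\<dots> = m"
      by (simp add: s_def add_nonneg_pos less_imp_neq[symmetric])
    finally show ?thesis .
  qed
  have inU: "x + a *\<^sub>R v + b *\<^sub>R w \<in> U" if "0 \<le> a" "a \<le> s" "0 \<le> b" "b \<le> s" for a b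
    using near[OF that] q by (auto simp: m_def dist_commute)
  obtain a b where ab: "0 \<le> a" "a \<le> s" "0 \<le> b" "b \<le> s"
    "F (x + s *\<^sub>R v + s *\<^sub>R w) - F (x + s *\<^sub>R v) - F (x + s *\<^sub>R w) + F x = s * s * G (x + a *\<^sub>R v + b *\<^sub>R w) w"
    using second_difference_mvt[OF s inU F G] by blast
  have inU': "x + a *\<^sub>R w + b *\<^sub>R v \<in> U" if "0 \<le> a" "a \<le> s" "0 \<le> b" "b \<le> s" for a b
    using inU[of b a] that by (simp add: algebra_simps)
  obtain a' b' where ab': "0 \<le> a'" "a' \<le> s" "0 \<le> b'" "b' \<le> s"
    "F (x + s *\<^sub>R w + s *\<^sub>R v) - F (x + s *\<^sub>R w) - F (x + s *\<^sub>R v) + F x = s * s * H (x + a' *\<^sub>R w + b' *\<^sub>R v) v"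
    using second_difference_mvt[OF s inU' F H] by blast
  have "s * s * G (x + a *\<^sub>R v + b *\<^sub>R w) w = s * s * H (x + b' *\<^sub>R v + a' *\<^sub>R w) v"
    using ab(5) ab'(5) by (simp add: algebra_simps)
  then have "G (x + a *\<^sub>R v + b *\<^sub>R w) w = H (x + b' *\<^sub>R v + a' *\<^sub>R w) v" using s by simp
  moreover have "dist (G (x + a *\<^sub>R v + b *\<^sub>R w) w) (G x w) < e"
    using near[OF ab(1-4)] by (intro d) (simp add: m_def)
  moreover have "dist (H (x + b' *\<^sub>R v + a' *\<^sub>R w) v) (H x v) < e"
    using near[OF ab'(3,4,1,2)] by (intro d') (simp add: m_def)
  ultimately show False unfolding e_def dist_real_def by (auto simp: abs_if split: if_splits)
qed

lemma smooth_on_second_derivative_symmetric: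
  fixes f :: "'a::euclidean_space \<Rightarrow> 'b::euclidean_space"
  assumes f: "smooth_on U f" and x: "x \<in> U"
  shows "frechet_derivative (\<lambda>y. frechet_derivative f (at y) v) (at x) w
       = frechet_derivative (\<lambda>y. frechet_derivative f (at y) w) (at x) v"
proof (rule euclidean_eqI)
  fix b :: 'b assume "b \<in> Basis"
  let ?D = "\<lambda>v y. frechet_derivative f (at y) v"
  let ?DD = "\<lambda>v y. frechet_derivative (?D v) (at y)"
  have I: "((\<lambda>y. g y \<bullet> b) has_derivative (\<lambda>u. g' u \<bullet> b)) (at y)" if "(g has_derivative g') (at y)"
    for g :: "'a \<Rightarrow> 'b" and g' y
    using that by (auto intro!: derivative_eq_intros)
  show "?DD v x w \<bullet> b = ?DD w x v \<bullet> b"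
  proof (rule frechet_derivative_symmetric_real[where F = "\<lambda>y. f y \<bullet> b" and F' = "\<lambda>y u. ?D u y \<bullet> b"
        and G = "\<lambda>y u. ?DD v y u \<bullet> b" and H = "\<lambda>y u. ?DD w y u \<bullet> b"])
    show "open U" "x \<in> U" using f x smooth_on_open by auto
    fix y assume y: "y \<in> U"
    show "((\<lambda>y. f y \<bullet> b) has_derivative (\<lambda>u. ?D u y \<bullet> b)) (at y)"
      by (rule I[OF smooth_on_has_derivative[OF f y]])
    show "((\<lambda>y. ?D v y \<bullet> b) has_derivative (\<lambda>u. ?DD v y u \<bullet> b)) (at y)" 
      "((\<lambda>y. ?D w y \<bullet> b) has_derivative (\<lambda>u. ?DD w y u \<bullet> b)) (at y)"
      by (rule I[OF smooth_on_has_derivative[OF smooth_on_directional[OF f] y]])+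
  next
    show "continuous_on U (\<lambda>y. ?DD v y w \<bullet> b)" "continuous_on U (\<lambda>y. ?DD w y v \<bullet> b)"
      by (intro continuous_intros smooth_on_continuous[OF smooth_on_directional[OF smooth_on_directional[OF f]]])+
  qed
qed

section \<open>Moving frames\<close>

text \<open>Cramer's formula exhibits the solution as a quotient of polynomials in the entries, so
  differentiability and continuity of the dual vector fields and of normal components reduce to
  those of determinants.\<close>

definition cramer_vec :: "real^'n^'n \<Rightarrow> real^'n \<Rightarrow> real^'n" where
  "cramer_vec A b = (\<chi> k. det (\<chi> i j. if j = k then b$i else A$i$j) / det A)"

lemma cramer_vec_iff: "det A \<noteq> 0 \<Longrightarrow> A *v x = b \<longleftrightarrow> x = cramer_vec A b"
  unfolding cramer_vec_def by (rule cramer)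

lemma differentiable_linear:
  "bounded_linear L \<Longrightarrow> f differentiable (at x) \<Longrightarrow> (\<lambda>y. L (f y)) differentiable (at x)"
  by (rule differentiable_compose[of L]) (rule bounded_linear_imp_differentiable)

lemmas differentiable_components = differentiable_linear[OF bounded_linear_fst]
  differentiable_linear[OF bounded_linear_snd] differentiable_linear[OF bounded_linear_vec_nth]

lemma differentiable_vec_lambda:
  fixes f :: "'a::real_normed_vector \<Rightarrow> 'i::finite \<Rightarrow> 'b::euclidean_space"
  assumes "\<And>i. (\<lambda>y. f y i) differentiable (at x)"
  shows "(\<lambda>y. \<chi> i. f y i) differentiable (at x)"
proof -
  have "bounded_linear (\<lambda>a::'b. axis i a :: 'b^'i)" for i
    by (rule linear_conv_bounded_linear[THEN iffD1], rule linearI)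
      (simp_all add: axis_def vec_eq_iff)
  then have "(\<lambda>y. \<Sum>i\<in>UNIV. axis i (f y i)) differentiable (at x)"
    using differentiable_linear[OF _ assms] by (intro differentiable_sum) auto
  moreover have "(\<Sum>i\<in>UNIV. axis i (f x i)) = (\<chi> i. f x i)" for x
    by (simp add: vec_eq_iff axis_def if_distrib cong: if_cong)
  ultimately show ?thesis by simp
qed

lemma differentiable_prod:
  fixes f :: "'i \<Rightarrow> 'a::real_normed_vector \<Rightarrow> real"
  assumes "\<And>i. i \<in> I \<Longrightarrow> f i differentiable (at x)"
  shows "(\<lambda>y. \<Prod>i\<in>I. f i y) differentiable (at x)"
proof -
  from assms have "\<forall>i. \<exists>D. i \<in> I \<longrightarrow> (f i has_derivative D) (at x)"
    by (auto simp: differentiable_def)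
  then obtain D where "\<And>i. i \<in> I \<Longrightarrow> (f i has_derivative D i) (at x)" by metis
  from has_derivative_prod[of I f D, OF this] show ?thesis by (auto simp: differentiable_def)
qed

lemma differentiable_det:
  fixes A :: "'a::real_normed_vector \<Rightarrow> real^'n^'n"
  assumes "\<And>i j. (\<lambda>y. A y $ i $ j) differentiable (at x)"
  shows "(\<lambda>y. det (A y)) differentiable (at x)"
  unfolding det_def
  by (intro differentiable_sum ballI differentiable_mult differentiable_const differentiable_prod assms)
     (auto intro: finite_permutations)

lemma differentiable_cramer_vec:
  fixes A :: "'a::real_normed_vector \<Rightarrow> real^'n^'n"
  assumes "\<And>i j. (\<lambda>y. A y $ i $ j) differentiable (at x)" "\<And>i. (\<lambda>y. b y $ i) differentiable (at x)"
    and "det (A x) \<noteq> 0"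
  shows "(\<lambda>y. cramer_vec (A y) (b y)) differentiable (at x)"
  unfolding cramer_vec_def
proof (intro differentiable_vec_lambda differentiable_divide differentiable_det)
  show "(\<lambda>y. (\<chi> i j. if j = k then b y $ i else A y $ i $ j) $ i $ j) differentiable (at x)" for i j k
    using assms by (cases "j = k") auto
qed (use assms in auto)

lemma continuous_on_det:
  fixes A :: "'a::topological_space \<Rightarrow> real^'n^'n"
  assumes "continuous_on T A"
  shows "continuous_on T (\<lambda>y. det (A y))"
  unfolding det_def using assms by (intro continuous_intros)

lemma continuous_on_cramer_vec:
  fixes A :: "'a::topological_space \<Rightarrow> real^'n^'n"
  assumes "continuous_on T A" "continuous_on T b" "\<And>y. y \<in> T \<Longrightarrow> det (A y) \<noteq> 0"
  shows "continuous_on T (\<lambda>y. cramer_vec (A y) (b y))"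
  unfolding cramer_vec_def
proof (intro continuous_on_vec_lambda continuous_on_divide continuous_on_det)
  fix k
  have "continuous_on T (\<lambda>y. if j = k then b y $ i else A y $ i $ j)" for i j
    using assms(1,2) by (cases "j = k") (auto intro!: continuous_intros)
  then show "continuous_on T (\<lambda>y. if j = k then b y $ i else A y $ i $ j)" for i j .
qed (use assms in auto)

section \<open>Components with respect to a frame\<close>

definition frame_comb :: "real^7^4 \<Rightarrow> real^7^3 \<Rightarrow> (real^4) \<times> (real^3) \<Rightarrow> real^7" where
  "frame_comb e \<nu> = (\<lambda>(x, y). (\<Sum>i\<in>UNIV. x$i *\<^sub>R e$i) + (\<Sum>a\<in>UNIV. y$a *\<^sub>R \<nu>$a))"

abbreviation normal_coeffs :: "real^7^4 \<Rightarrow> real^7^3 \<Rightarrow> real^7 \<Rightarrow> real^3" where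
  "normal_coeffs e \<nu> w \<equiv> snd (frame_coeffs e \<nu> w)"

lemma linear_frame_comb: "linear (frame_comb e \<nu>)"
  by (rule linearI) (auto simp: frame_comb_def scaleR_left_distrib sum.distrib scaleR_sum_right algebra_simps)

lemma bij_frame_comb:
  assumes "(p, e, \<nu>) \<in> frames"
  shows "bij (frame_comb e \<nu>)"
proof -
  have "e$i = frame_comb e \<nu> (axis i 1, 0)" "\<nu>$a = frame_comb e \<nu> (0, axis a 1)" for i a
    by (auto simp: frame_comb_def axis_def if_distrib[of "\<lambda>c. c *\<^sub>R _"] cong: if_cong)
  then have "range (($) e) \<union> range (($) \<nu>) \<subseteq> range (frame_comb e \<nu>)" by blast
  then have "span (range (($) e) \<union> range (($) \<nu>)) \<subseteq> range (frame_comb e \<nu>)"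
    by (intro span_minimal linear_subspace_image linear_frame_comb subspace_UNIV)
  then have s: "surj (frame_comb e \<nu>)" using assms by (auto simp: frames_def)
  moreover have "inj (frame_comb e \<nu>)"
    by (rule linear_surjective_imp_injective[OF linear_frame_comb s]) (simp add: dim_UNIV)
  ultimately show ?thesis by (simp add: bij_def)
qed

lemma frame_coeffs_eq_inv:
  assumes "(p, e, \<nu>) \<in> frames"
  shows "frame_coeffs e \<nu> w = inv (frame_comb e \<nu>) w"
proof -
  have "frame_coeffs e \<nu> w = (THE z. w = frame_comb e \<nu> z)"
    unfolding frame_coeffs_def frame_comb_def by (simp add: case_prod_beta')
  also have "\<dots> = inv (frame_comb e \<nu>) w"
    using bij_frame_comb[OF assms] by (intro the_equality) (auto simp: bij_is_surj surj_f_inv_f bij_inv_eq_iff)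
  finally show ?thesis .
qed

context
  fixes p e \<nu>
  assumes fr: "(p, e, \<nu>) \<in> frames"
begin

lemma frame_coeffs_comb: "frame_coeffs e \<nu> (frame_comb e \<nu> z) = z"
  using frame_coeffs_eq_inv[OF fr] bij_frame_comb[OF fr] by (simp add: bij_is_inj)

lemma frame_comb_coeffs: "frame_comb e \<nu> (frame_coeffs e \<nu> w) = w"
  using frame_coeffs_eq_inv[OF fr] bij_frame_comb[OF fr] by (simp add: bij_is_surj surj_f_inv_f)

lemma linear_frame_coeffs: "linear (frame_coeffs e \<nu>)"
proof -
  have "frame_coeffs e \<nu> (frame_comb e \<nu> a + frame_comb e \<nu> b) = a + b"
    "frame_coeffs e \<nu> (c *\<^sub>R frame_comb e \<nu> a) = c *\<^sub>R a" for a b c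
    by (simp_all add: frame_coeffs_comb flip: linear_add[OF linear_frame_comb] linear_scale[OF linear_frame_comb])
  then show ?thesis by (intro linearI) (metis frame_coeffs_comb frame_comb_coeffs)+
qed

lemma frame_orthonormal:
  "e$i \<bullet> e$j = (if i = j then 1 else 0)" "e$i \<bullet> \<nu>$a = 0" "\<nu>$a \<bullet> e$i = 0"
  using fr by (auto simp: frames_def inner_commute)

lemma tangent_coeffs: "fst (frame_coeffs e \<nu> w) $ i = e$i \<bullet> w"
proof -
  have "e$i \<bullet> frame_comb e \<nu> z = fst z $ i" for z
    by (simp add: frame_comb_def case_prod_beta inner_add_right inner_sum_right frame_orthonormal
        if_distrib[of "\<lambda>c. _ * c"] cong: if_cong)
  then show ?thesis by (metis frame_comb_coeffs)
qed

lemma frame_decomp: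
  "w = (\<Sum>i\<in>UNIV. (e$i \<bullet> w) *\<^sub>R e$i) + (\<Sum>a\<in>UNIV. normal_coeffs e \<nu> w $ a *\<^sub>R \<nu>$a)"
  using frame_comb_coeffs[of w] by (simp add: frame_comb_def case_prod_beta tangent_coeffs)

lemma linear_normal_coeffs: "linear (\<lambda>w. normal_coeffs e \<nu> w $ a)"
  using linear_frame_coeffs by (intro linearI) (simp_all add: linear_add[OF linear_frame_coeffs] linear_scale[OF linear_frame_coeffs])

lemma normal_coeffs_frame:
  "normal_coeffs e \<nu> (e$i) $ a = 0" "normal_coeffs e \<nu> (\<nu>$b) $ a = (if a = b then 1 else 0)"
proof -
  have "e$i = frame_comb e \<nu> (axis i 1, 0)" "\<nu>$b = frame_comb e \<nu> (0, axis b 1)"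
    by (auto simp: frame_comb_def axis_def if_distrib[of "\<lambda>c. c *\<^sub>R _"] cong: if_cong)
  then have "frame_coeffs e \<nu> (e$i) = (axis i 1, 0)" "frame_coeffs e \<nu> (\<nu>$b) = (0, axis b 1)"
    using frame_coeffs_comb by metis+
  then show "normal_coeffs e \<nu> (e$i) $ a = 0" "normal_coeffs e \<nu> (\<nu>$b) $ a = (if a = b then 1 else 0)"
    by (auto simp: axis_def)
qed

text \<open>Normal components solve a linear system with the Gram matrix of \<open>\<nu>\<close>. A
  vector in its kernel gives a normal vector orthogonal to the whole frame, which is 0 because the
  frame spans. The formula makes the components differentiable in the frame.\<close>

lemma normal_coeffs_cramer:
  "det (\<chi> a b. \<nu>$a \<bullet> \<nu>$b) \<noteq> 0"
  "normal_coeffs e \<nu> w = cramer_vec (\<chi> a b. \<nu>$a \<bullet> \<nu>$b) (\<chi> a. \<nu>$a \<bullet> w)"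
proof -
  let ?g = "\<chi> a b. \<nu>$a \<bullet> \<nu>$b"
  have g: "(?g *v y) $ a = \<nu>$a \<bullet> frame_comb e \<nu> (x, y)" for x y a
    by (simp add: frame_comb_def inner_add_right inner_sum_right frame_orthonormal matrix_vector_mult_def mult.commute)
  have "y = 0" if "?g *v y = 0" for y
  proof -
    let ?w = "frame_comb e \<nu> (0, y)"
    have "\<nu>$a \<bullet> ?w = 0" for a using g[of y a 0] that by simp
    moreover have "e$i \<bullet> ?w = 0" for i using tangent_coeffs[of ?w i] by (simp add: frame_coeffs_comb)
    ultimately have "v \<bullet> ?w = 0" if "v \<in> range (($) e) \<union> range (($) \<nu>)" for v
      using that by auto
    then have "?w \<bullet> ?w = 0"
      using fr orthogonal_to_span[of ?w "range (($) e) \<union> range (($) \<nu>)" ?w]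
      by (auto simp: frames_def orthogonal_def inner_commute)
    then have "frame_coeffs e \<nu> ?w = 0" using linear_0[OF linear_frame_coeffs] by simp
    then show "y = 0" by (simp add: frame_coeffs_comb zero_prod_def)
  qed
  then show d: "det ?g \<noteq> 0"
    by (metis (no_types, lifting) invertible_det_nz invertible_left_inverse matrix_left_invertible_ker)
  have "?g *v normal_coeffs e \<nu> w = (\<chi> a. \<nu>$a \<bullet> w)"
    using g[of "normal_coeffs e \<nu> w" _ "fst (frame_coeffs e \<nu> w)"]
    by (simp add: vec_eq_iff frame_comb_coeffs)
  then show "normal_coeffs e \<nu> w = cramer_vec ?g (\<chi> a. \<nu>$a \<bullet> w)"
    using cramer_vec_iff[OF d] by blast
qed

end

section \<open>Directional derivatives of identities\<close>

definition dir_deriv :: "('a::real_normed_vector \<Rightarrow> 'b::real_normed_vector) \<Rightarrow> 'a \<Rightarrow> 'a \<Rightarrow> 'b \<Rightarrow> bool" where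
  "dir_deriv F x v d \<longleftrightarrow> ((\<lambda>t. F (x + t *\<^sub>R v)) has_vector_derivative d) (at 0)"

named_theorems dir_deriv_intros

lemma dir_deriv_frechet:
  assumes "(F has_derivative F') (at x)"
  shows "dir_deriv F x v (F' v)"
proof -
  have "((\<lambda>t. x + t *\<^sub>R v) has_vector_derivative v) (at 0)"
    by (auto intro!: derivative_eq_intros)
  then have "((F \<circ> (\<lambda>t. x + t *\<^sub>R v)) has_vector_derivative F' v) (at 0)"
    by (rule vector_derivative_diff_chain_within) (use assms in \<open>auto intro: has_derivative_at_withinI\<close>)
  then show ?thesis by (simp add: dir_deriv_def o_def)
qed

text \<open>Two expressions that agree on an open set have the same derivative. The structure
  equations below are obtained in this way, by computing one derivative from two
  expressions.\<close>

lemma dir_deriv_unique: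
  assumes "open U" "x \<in> U" "\<And>y. y \<in> U \<Longrightarrow> F y = G y" "dir_deriv F x v d" "dir_deriv G x v d'"
  shows "d = d'"
proof -
  have "open ((\<lambda>t. x + t *\<^sub>R v) -` U)"
    by (intro open_vimage assms continuous_intros)
  then have "((\<lambda>t. F (x + t *\<^sub>R v)) has_vector_derivative d') (at 0)"
    using has_vector_derivative_transform_within_open[of "\<lambda>t. G (x + t *\<^sub>R v)" d' 0 "(\<lambda>t. x + t *\<^sub>R v) -` U" "\<lambda>t. F (x + t *\<^sub>R v)"]
      assms(2,3,5) unfolding dir_deriv_def by simp
  then show ?thesis
    using assms(4) vector_derivative_unique_at unfolding dir_deriv_def by blast
qed

lemma dir_deriv_linear:
  "bounded_linear L \<Longrightarrow> dir_deriv F x v d \<Longrightarrow> dir_deriv (\<lambda>y. L (F y)) x v (L d)"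
  unfolding dir_deriv_def by (rule bounded_linear.has_vector_derivative)

lemma dir_deriv_bilinear:
  assumes "bounded_bilinear P" "dir_deriv F x v d" "dir_deriv G x v d'"
  shows "dir_deriv (\<lambda>y. P (F y) (G y)) x v (P (F x) d' + P d (G x))"
  using bounded_bilinear.has_vector_derivative[OF assms(1) assms(2,3)[unfolded dir_deriv_def]]
  by (simp add: dir_deriv_def)

lemma dir_deriv_const [dir_deriv_intros]: "dir_deriv (\<lambda>_. c) x v 0"
  by (simp add: dir_deriv_def)

lemma dir_deriv_add [dir_deriv_intros]:
  "dir_deriv F x v d \<Longrightarrow> dir_deriv G x v d' \<Longrightarrow> dir_deriv (\<lambda>y. F y + G y) x v (d + d')"
  unfolding dir_deriv_def by (rule has_vector_derivative_add)

lemma dir_deriv_diff [dir_deriv_intros]: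
  "dir_deriv F x v d \<Longrightarrow> dir_deriv G x v d' \<Longrightarrow> dir_deriv (\<lambda>y. F y - G y) x v (d - d')"
  unfolding dir_deriv_def by (rule has_vector_derivative_diff)

lemma dir_deriv_sum [dir_deriv_intros]:
  "(\<And>i. i \<in> I \<Longrightarrow> dir_deriv (F i) x v (d i)) \<Longrightarrow> dir_deriv (\<lambda>y. \<Sum>i\<in>I. F i y) x v (\<Sum>i\<in>I. d i)"
  by (induction I rule: infinite_finite_induct) (simp_all add: dir_deriv_const dir_deriv_add)

lemmas dir_deriv_products [dir_deriv_intros] =
  dir_deriv_bilinear[OF bounded_bilinear_mult] dir_deriv_bilinear[OF bounded_bilinear_scaleR]
  dir_deriv_bilinear[OF bounded_bilinear_inner]

section \<open>Structure equations\<close>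

abbreviation "cpos c \<equiv> fst c"
abbreviation "ctan c \<equiv> fst (snd c)"
abbreviation "cnor c \<equiv> fst (snd (snd c))"
abbreviation "clam c \<equiv> snd (snd (snd c))"

text \<open>The structure equations along the dual fields when \<open>\<theta>\<close> vanishes and
  \<open>\<eta>\<close> equals \<open>S\<close> applied to \<open>\<omega>\<close>. The tangential
  part of the derivative of \<open>\<nu>$b\<close> is forced by orthogonality to the
  \<open>e$n\<close>, and the Gram matrix appears in it because the normal frame is not
  orthonormal.\<close>

definition frame_vel :: "conf \<Rightarrow> conn \<Rightarrow> conf^4" where
  "frame_vel c z = (\<chi> k. (ctan c$k,
     \<chi> m. (\<Sum>n\<in>UNIV. fst z$k$n$m *\<^sub>R ctan c$n) + (\<Sum>a\<in>UNIV. Smat (clam c)$a$m$k *\<^sub>R cnor c$a),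
     \<chi> b. (\<Sum>a\<in>UNIV. fst (snd z)$k$a$b *\<^sub>R cnor c$a)
       - (\<Sum>n\<in>UNIV. (\<Sum>a\<in>UNIV. Smat (clam c)$a$n$k * (cnor c$a \<bullet> cnor c$b)) *\<^sub>R ctan c$n),
     snd (snd z)$k))"

definition conn_of :: "conf \<Rightarrow> conf^4 \<Rightarrow> conn" where
  "conn_of c P = (\<chi> k n m. ctan c$n \<bullet> ctan (P$k)$m,
     \<chi> k a b. normal_coeffs (ctan c) (cnor c) (cnor (P$k)$b) $ a,
     \<chi> k. clam (P$k))"

text \<open>The terms without derivatives of the coefficients, in the order of the components of
  \<open>conn_symbol\<close>: Codazzi, Gauss, Ricci, d(d\<lambda>), skewness, tangency. The
  differences \<open>\<phi>$i$q$k - \<phi>$k$q$i\<close> are the components of the bracket of the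
  fields with indices \<open>i\<close> and \<open>k\<close>.\<close>

definition conn_rhs :: "conf \<Rightarrow> conn \<Rightarrow>
    (real^4^4^4^4^3) \<times> (real^4^4^4^4) \<times> (real^3^3^4^4) \<times> (real^3^4^4) \<times> (real^4^4^4^4) \<times> (real^4^4)" where
  "conn_rhs c z = (let l = clam c; \<phi> = fst z; \<kappa> = fst (snd z); \<mu> = snd (snd z); S = Smat l;
      E = (\<lambda>k m. ctan (frame_vel c z$k)$m);
      dS = (\<lambda>i a m k. (Smat (\<mu>$i) - Smat 0)$a$m$k);
      dC = (\<lambda>a m k j i. (\<Sum>b\<in>UNIV. \<kappa>$j$a$b * dS i b m k) - (\<Sum>n\<in>UNIV. \<phi>$j$n$m * dS i a n k)
         - (\<Sum>n\<in>UNIV. \<phi>$j$n$k * dS i a m n))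
    in (\<chi> a m k j i. dC a m j k i - dC a m k j i,
      \<chi> i k n m. E i n \<bullet> E k m - E k n \<bullet> E i m + (\<Sum>q\<in>UNIV. (\<phi>$i$q$k - \<phi>$k$q$i) * \<phi>$q$n$m),
      \<chi> i k a b. (\<Sum>n\<in>UNIV. \<Sum>d\<in>UNIV. (cnor c$d \<bullet> cnor c$b) * (S$d$n$k * S$a$n$i - S$d$n$i * S$a$n$k))
         - (\<Sum>d\<in>UNIV. \<kappa>$k$d$b * \<kappa>$i$a$d - \<kappa>$i$d$b * \<kappa>$k$a$d)
         + (\<Sum>q\<in>UNIV. (\<phi>$i$q$k - \<phi>$k$q$i) * \<kappa>$q$a$b),
      \<chi> i k a. \<Sum>q\<in>UNIV. (\<phi>$i$q$k - \<phi>$k$q$i) * \<mu>$q$a,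
      0,
      \<chi> i k. - ((\<mu>$i$2 * l$3 + l$2 * \<mu>$i$3) * \<mu>$k$1 + (\<mu>$i$1 * l$3 + l$1 * \<mu>$i$3) * \<mu>$k$2
         + (\<mu>$i$1 * l$2 + l$1 * \<mu>$i$2) * \<mu>$k$3)))"

lemma linear_sum_axis:
  fixes L :: "real^'n \<Rightarrow> 'b::real_vector"
  assumes "linear L"
  shows "L v = (\<Sum>i\<in>UNIV. v$i *\<^sub>R L (axis i 1))"
proof -
  have "v = (\<Sum>i\<in>UNIV. v$i *\<^sub>R axis i 1)"
    by (simp add: vec_eq_iff axis_def if_distrib[of "\<lambda>c. _ * c"] cong: if_cong)
  then have "L v = L (\<Sum>i\<in>UNIV. v$i *\<^sub>R axis i 1)" by simp
  then show ?thesis by (simp add: linear_sum[OF assms] linear_scale[OF assms])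
qed

lemma differentiable_transform_open:
  assumes "f differentiable (at x)" "open U" "x \<in> U" "\<And>y. y \<in> U \<Longrightarrow> f y = g y"
  shows "g differentiable (at x)"
proof -
  obtain D where "(f has_derivative D) (at x)" using assms(1) by (auto simp: differentiable_def)
  from has_derivative_transform_within_open[OF this assms(2-4)] show ?thesis
    by (auto simp: differentiable_def)
qed

lemma bounded_linear_Smat: "bounded_linear (\<lambda>m. (Smat m - Smat 0)$a$i$j)"
proof -
  have "\<forall>a i j x y c. Smat (x + y)$a$i$j - Smat 0$a$i$j = Smat x$a$i$j - Smat 0$a$i$j + (Smat y$a$i$j - Smat 0$a$i$j)
     \<and> Smat (c *\<^sub>R x)$a$i$j - Smat 0$a$i$j = c * (Smat x$a$i$j - Smat 0$a$i$j)"
    by (simp add: forall_3 forall_4 Smat_simps)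
  then have "linear (\<lambda>m. (Smat m - Smat 0)$a$i$j)" by (intro linearI) simp_all
  then show ?thesis by (simp add: linear_conv_bounded_linear)
qed

lemma dir_deriv_Smat:
  assumes "dir_deriv l x v m"
  shows "dir_deriv (\<lambda>y. Smat (l y)$a$i$j) x v ((Smat m - Smat 0)$a$i$j)"
proof -
  have "dir_deriv (\<lambda>y. (Smat (l y) - Smat 0)$a$i$j + Smat 0$a$i$j) x v ((Smat m - Smat 0)$a$i$j + 0)"
    by (intro dir_deriv_add dir_deriv_const dir_deriv_linear[OF bounded_linear_Smat assms])
  then show ?thesis by simp
qed

lemmas dir_deriv_components = dir_deriv_linear[OF bounded_linear_fst]
  dir_deriv_linear[OF bounded_linear_snd] dir_deriv_linear[OF bounded_linear_vec_nth]

section \<open>The dual vector fields of an integral 4-fold in a chart\<close>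

locale integral_chart =
  fixes U :: "(real^4) set" and f :: "real^4 \<Rightarrow> conf"
  assumes param: "integral_param FL0_generic U f"
begin

definition Df :: "real^4 \<Rightarrow> real^4 \<Rightarrow> conf" where "Df x v = frechet_derivative f (at x) v"
definition coframe :: "real^4 \<Rightarrow> real^4^4" where "coframe x = (\<chi> i j. omega (f x) i (Df x (axis j 1)))"
definition dual :: "real^4 \<Rightarrow> 4 \<Rightarrow> real^4" where "dual x k = cramer_vec (coframe x) (axis k 1)"
definition P :: "real^4 \<Rightarrow> conf^4" where "P x = (\<chi> k. Df x (dual x k))"
definition conn :: "real^4 \<Rightarrow> conn" where "conn x = conn_of (f x) (P x)"

abbreviation "e x \<equiv> ctan (f x)"
abbreviation "\<nu> x \<equiv> cnor (f x)"
abbreviation "l x \<equiv> clam (f x)"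
abbreviation "\<phi> x \<equiv> fst (conn x)"
abbreviation "\<kappa> x \<equiv> fst (snd (conn x))"
abbreviation "\<mu> x \<equiv> snd (snd (conn x))"

lemma smooth: "smooth_on U f" and open_U: "open U"
  using param smooth_on_open by (auto simp: integral_param_def)

lemma in_FL0: assumes "x \<in> U"
  shows "(cpos (f x), e x, \<nu> x) \<in> frames" "l x \<in> Lsurf0" "l x$1 \<noteq> 1" "l x$2 \<noteq> 1"
proof -
  have "f x \<in> FL0_generic" using param assms by (auto simp: integral_param_def)
  then show "(cpos (f x), e x, \<nu> x) \<in> frames" "l x \<in> Lsurf0" "l x$1 \<noteq> 1" "l x$2 \<noteq> 1"
    by (auto simp: FL0_generic_def FL0_def)
qed

lemma f_derivative: "x \<in> U \<Longrightarrow> (f has_derivative Df x) (at x)"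
  unfolding Df_def using smooth_on_has_derivative[OF smooth] by (simp add: eta_contract_eq)

lemma linear_Df: "x \<in> U \<Longrightarrow> linear (Df x)"
  using f_derivative has_derivative_linear by blast

lemma omega_eq: assumes "x \<in> U" shows "omega (f x) i v = e x$i \<bullet> cpos v"
  using tangent_coeffs[OF in_FL0(1)[OF assms]] by (simp add: omega_def case_prod_beta)

lemma coframe_mult: assumes x: "x \<in> U" shows "(coframe x *v v)$i = e x$i \<bullet> cpos (Df x v)"
proof -
  have "linear (\<lambda>v. e x$i \<bullet> cpos (Df x v))"
    using linear_Df[OF x] by (intro linearI) (simp_all add: linear_add[OF linear_Df[OF x]] linear_scale[OF linear_Df[OF x]] inner_add_right)
  from linear_sum_axis[OF this, of v] show ?thesis
    by (simp add: coframe_def matrix_vector_mult_def omega_eq[OF x] mult.commute)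
qed

lemma coframe_det: "x \<in> U \<Longrightarrow> det (coframe x) \<noteq> 0"
  using param by (auto simp: integral_param_def Let_def coframe_def Df_def)

lemma coframe_dual: "x \<in> U \<Longrightarrow> coframe x *v dual x k = axis k 1"
  using cramer_vec_iff[OF coframe_det] by (auto simp: dual_def)

lemma dual_unique: "x \<in> U \<Longrightarrow> coframe x *v v = axis k 1 \<Longrightarrow> v = dual x k"
  using cramer_vec_iff[OF coframe_det] by (auto simp: dual_def)

lemma dual_expansion:
  assumes x: "x \<in> U"
  shows "v = (\<Sum>k\<in>UNIV. (e x$k \<bullet> cpos (Df x v)) *\<^sub>R dual x k)"
proof -
  have "(coframe x *v (\<Sum>k\<in>UNIV. (e x$k \<bullet> cpos (Df x v)) *\<^sub>R dual x k)) 
     = (\<Sum>k\<in>UNIV. (e x$k \<bullet> cpos (Df x v)) *\<^sub>R axis k 1)"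
    by (simp add: linear_sum[OF matrix_vector_mul_linear] linear_scale[OF matrix_vector_mul_linear] coframe_dual[OF x])
  also have "\<dots> = coframe x *v v"
    by (simp add: vec_eq_iff coframe_mult[OF x] axis_def if_distrib[of "\<lambda>c. _ * c"] cong: if_cong)
  finally have *: "coframe x *v (\<Sum>k\<in>UNIV. (e x$k \<bullet> cpos (Df x v)) *\<^sub>R dual x k) = coframe x *v v" .
  show ?thesis
    using cramer_vec_iff[OF coframe_det[OF x], THEN iffD1, OF *]
      cramer_vec_iff[OF coframe_det[OF x], THEN iffD1, OF refl, of v] by (rule trans[OF _ sym, rotated])
qed

lemma e_cpos_P: "x \<in> U \<Longrightarrow> e x$i \<bullet> cpos (P x$k) = (if i = k then 1 else 0)"
  using coframe_mult[of x "dual x k" i] by (simp add: coframe_dual P_def axis_def)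

lemma cpos_P: assumes x: "x \<in> U" shows "cpos (P x$k) = e x$k"
proof -
  have "theta (f x) a (Df x v) = 0" for a v
    using param x by (auto simp: integral_param_def Let_def Df_def)
  then have "normal_coeffs (e x) (\<nu> x) (cpos (Df x v)) $ a = 0" for a v
    by (simp add: theta_def case_prod_beta)
  then have "cpos (P x$k) = (\<Sum>i\<in>UNIV. (e x$i \<bullet> cpos (P x$k)) *\<^sub>R e x$i)"
    using frame_decomp[OF in_FL0(1)[OF x], of "cpos (P x$k)"] by (simp add: P_def)
  then show ?thesis by (simp add: e_cpos_P[OF x] if_distrib[of "\<lambda>c. c *\<^sub>R _"] cong: if_cong)
qed

lemma normal_coeffs_ctan_P:
  assumes x: "x \<in> U" shows "normal_coeffs (e x) (\<nu> x) (ctan (P x$k)$m) $ a = Smat (l x)$a$m$k"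
proof -
  have "eta_S (f x) a m (Df x v) = 0" for v
    using param x by (auto simp: integral_param_def Let_def Df_def)
  then have "normal_coeffs (e x) (\<nu> x) (ctan (Df x v)$m) $ a = (\<Sum>j\<in>UNIV. Smat (l x)$a$m$j * omega (f x) j (Df x v))" for v
    by (simp add: eta_S_def eta_def case_prod_beta)
  from this[of "dual x k"] show ?thesis
    using e_cpos_P[OF x] by (simp add: omega_eq[OF x] P_def if_distrib[of "\<lambda>c. _ * c"] cong: if_cong)
qed

lemma conn_simps:
  "\<phi> x$k$n$m = e x$n \<bullet> ctan (P x$k)$m" "\<kappa> x$k$a$b = normal_coeffs (e x) (\<nu> x) (cnor (P x$k)$b) $ a"
  "\<mu> x$k = clam (P x$k)"
  by (simp_all add: conn_def conn_of_def)

lemma ctan_P: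
  assumes x: "x \<in> U"
  shows "ctan (P x$k)$m = (\<Sum>n\<in>UNIV. \<phi> x$k$n$m *\<^sub>R e x$n) + (\<Sum>a\<in>UNIV. Smat (l x)$a$m$k *\<^sub>R \<nu> x$a)"
  using frame_decomp[OF in_FL0(1)[OF x], of "ctan (P x$k)$m"]
  by (simp add: normal_coeffs_ctan_P[OF x] conn_simps)

lemma dir_f: assumes x: "x \<in> U" shows "dir_deriv f x (dual x j) (P x$j)"
  using dir_deriv_frechet[OF f_derivative[OF x]] by (simp add: P_def)

lemma dir_comps: assumes x: "x \<in> U"
  shows "dir_deriv (\<lambda>y. e y$n) x (dual x j) (ctan (P x$j)$n)"
    "dir_deriv (\<lambda>y. \<nu> y$a) x (dual x j) (cnor (P x$j)$a)"
    "dir_deriv l x (dual x j) (\<mu> x$j)"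
  using dir_f[OF x, of j] unfolding conn_simps
  by (auto intro!: dir_deriv_components)

text \<open>Differentiate the orthogonality of \<open>e\<close> and \<open>\<nu>\<close>; only the
  normal part of the derivative of \<open>e\<close>, which is given by \<open>Smat\<close>, meets
  \<open>\<nu>\<close>.\<close>

lemma e_cnor_P:
  assumes x: "x \<in> U"
  shows "e x$n \<bullet> cnor (P x$k)$b = - (\<Sum>a\<in>UNIV. Smat (l x)$a$n$k * (\<nu> x$a \<bullet> \<nu> x$b))"
proof -
  note fr = frame_orthonormal[OF in_FL0(1)]
  have "e x$n \<bullet> cnor (P x$k)$b + ctan (P x$k)$n \<bullet> \<nu> x$b = 0"
    by (rule dir_deriv_unique[OF open_U x _ dir_deriv_products(3)[OF dir_comps(1,2)[OF x]] dir_deriv_const[of 0]])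
      (rule fr(2))
  moreover have "ctan (P x$k)$n \<bullet> \<nu> x$b = (\<Sum>a\<in>UNIV. Smat (l x)$a$n$k * (\<nu> x$a \<bullet> \<nu> x$b))"
    by (simp add: ctan_P[OF x] inner_add_left inner_sum_left fr[OF x])
  ultimately show ?thesis by simp
qed

lemma P_eq_frame_vel: assumes x: "x \<in> U" shows "P x = frame_vel (f x) (conn x)"
proof -
  have "cnor (P x$k)$b = (\<Sum>a\<in>UNIV. \<kappa> x$k$a$b *\<^sub>R \<nu> x$a)
       - (\<Sum>n\<in>UNIV. (\<Sum>a\<in>UNIV. Smat (l x)$a$n$k * (\<nu> x$a \<bullet> \<nu> x$b)) *\<^sub>R e x$n)" for k b
    using frame_decomp[OF in_FL0(1)[OF x], of "cnor (P x$k)$b"]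
    by (simp add: e_cnor_P[OF x] conn_simps sum_negf)
  then have "P x$k = frame_vel (f x) (conn x)$k" for k
    by (simp add: frame_vel_def prod_eq_iff vec_eq_iff[of "fst (snd (P x$k))"] vec_eq_iff[of "fst (snd (snd (P x$k)))"]
        cpos_P[OF x] ctan_P[OF x] conn_simps(3))
  then show ?thesis by (simp add: vec_eq_iff)
qed

end

section \<open>Commutators of the dual fields and the Codazzi equations\<close>

context integral_chart
begin

lemma differentiable_Df: "x \<in> U \<Longrightarrow> (\<lambda>y. Df y v) differentiable (at x)"
  unfolding Df_def using smooth_on_has_derivative[OF smooth_on_directional[OF smooth]]
  by (auto simp: differentiable_def)

lemma differentiable_f: "x \<in> U \<Longrightarrow> f differentiable (at x)"
  using f_derivative by (auto simp: differentiable_def)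

lemma differentiable_dual: assumes x: "x \<in> U" shows "(\<lambda>y. dual y k) differentiable (at x)"
  unfolding dual_def
proof (rule differentiable_cramer_vec)
  fix i j
  have "(\<lambda>y. e y$i \<bullet> cpos (Df y (axis j 1))) differentiable (at x)"
    using differentiable_f[OF x] differentiable_Df[OF x]
    by (intro differentiable_inner differentiable_components) auto
  then show "(\<lambda>y. coframe y$i$j) differentiable (at x)"
    by (rule differentiable_transform_open[OF _ open_U x]) (simp add: coframe_def omega_eq)
qed (use coframe_det[OF x] in auto)

lemma differentiable_P: assumes x: "x \<in> U" shows "P differentiable (at x)"
proof -
  have "(\<lambda>y. Df y (dual y k)) differentiable (at x)" for k
  proof (rule differentiable_transform_open[OF _ open_U x])
    show "(\<lambda>y. \<Sum>i\<in>UNIV. dual y k$i *\<^sub>R Df y (axis i 1)) differentiable (at x)"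
      using differentiable_dual[OF x] differentiable_Df[OF x]
      by (intro differentiable_sum ballI differentiable_scaleR differentiable_components) auto
  qed (rule linear_sum_axis[OF linear_Df, symmetric])
  then show ?thesis unfolding P_def by (rule differentiable_vec_lambda)
qed

lemma differentiable_conn: assumes x: "x \<in> U" shows "conn differentiable (at x)"
proof -
  have d: "(\<lambda>y. ctan (P y$k)$m) differentiable (at x)" "(\<lambda>y. cnor (P y$k)$b) differentiable (at x)"
    "(\<lambda>y. clam (P y$k)) differentiable (at x)" "(\<lambda>y. e y$n) differentiable (at x)" "(\<lambda>y. \<nu> y$a) differentiable (at x)"
    for k m b n a
    using differentiable_P[OF x] differentiable_f[OF x] by (auto intro!: differentiable_components)
  have "(\<lambda>y. normal_coeffs (e y) (\<nu> y) (cnor (P y$k)$b)) differentiable (at x)" for k b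
  proof (rule differentiable_transform_open[OF _ open_U x])
    show "(\<lambda>y. cramer_vec (\<chi> a b. \<nu> y$a \<bullet> \<nu> y$b) (\<chi> a. \<nu> y$a \<bullet> cnor (P y$k)$b)) differentiable (at x)"
      using d normal_coeffs_cramer(1)[OF in_FL0(1)[OF x]]
      by (intro differentiable_cramer_vec) simp_all
  qed (rule normal_coeffs_cramer(2)[OF in_FL0(1), symmetric])
  then have "(\<lambda>y. normal_coeffs (e y) (\<nu> y) (cnor (P y$k)$b)$a) differentiable (at x)" for k b a
    by (rule differentiable_components)
  then show ?thesis
    unfolding conn_def conn_of_def
    by (intro differentiable_Pair differentiable_vec_lambda differentiable_inner d)
qed

text \<open>\<open>Z j k\<close> is the derivative of the \<open>k\<close>-th vector of the tangent
  frame along the \<open>j\<close>-th dual field. Second derivatives of \<open>f\<close> cancel in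
  the antisymmetrization, which leaves the image of a bracket. Its components are read off from the
  position part alone, where they are differences of \<phi>.\<close>

lemma commutator:
  assumes x: "x \<in> U"
  obtains Z :: "4 \<Rightarrow> 4 \<Rightarrow> conf" where
    "\<And>j k. dir_deriv (\<lambda>y. P y$k) x (dual x j) (Z j k)"
    "\<And>j k. Z j k - Z k j = (\<Sum>q\<in>UNIV. (\<phi> x$j$q$k - \<phi> x$k$q$j) *\<^sub>R P x$q)"
proof -
  define H where "H v = frechet_derivative (\<lambda>y. Df y v) (at x)" for v
  have H: "((\<lambda>y. Df y v) has_derivative H v) (at x)" for v
    using differentiable_Df[OF x] frechet_derivative_works unfolding H_def by blast
  have Hsym: "H v w = H w v" for v w
    unfolding H_def Df_def by (rule smooth_on_second_derivative_symmetric[OF smooth x])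
  have linH: "linear (H v)" for v using H has_derivative_linear by blast
  define A where "A k = frechet_derivative (\<lambda>y. dual y k) (at x)" for k
  have A: "((\<lambda>y. dual y k) has_derivative A k) (at x)" for k
    using differentiable_dual[OF x] frechet_derivative_works unfolding A_def by blast
  define Z where "Z j k = (\<Sum>i\<in>UNIV. dual x k$i *\<^sub>R H (axis i 1) (dual x j)) + Df x (A k (dual x j))" for j k
  have dZ: "dir_deriv (\<lambda>y. P y$k) x (dual x j) (Z j k)" for j k
  proof -
    define F where "F y = (\<Sum>i\<in>UNIV. dual y k$i *\<^sub>R Df y (axis i 1))" for y
    have "dir_deriv F x (dual x j) (\<Sum>i\<in>UNIV. dual x k$i *\<^sub>R H (axis i 1) (dual x j) + A k (dual x j)$i *\<^sub>R Df x (axis i 1))"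
      unfolding F_def
      by (intro dir_deriv_sum dir_deriv_products dir_deriv_components dir_deriv_frechet H A)
    also have "(\<Sum>i\<in>UNIV. dual x k$i *\<^sub>R H (axis i 1) (dual x j) + A k (dual x j)$i *\<^sub>R Df x (axis i 1)) = Z j k"
      unfolding Z_def by (simp add: sum.distrib linear_sum_axis[OF linear_Df[OF x], of "A k (dual x j)"])
    finally have F: "dir_deriv F x (dual x j) (Z j k)" .
    obtain D where D: "(P has_derivative D) (at x)" using differentiable_P[OF x] by (auto simp: differentiable_def)
    have P: "dir_deriv (\<lambda>y. P y$k) x (dual x j) (D (dual x j)$k)"
      by (intro dir_deriv_components dir_deriv_frechet D)
    have "D (dual x j)$k = Z j k"
      by (rule dir_deriv_unique[OF open_U x _ P F])
        (simp add: P_def F_def linear_sum_axis[OF linear_Df, symmetric])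
    with P show ?thesis by simp
  qed
  \<comment> \<open>The position part of \<open>P x$k\<close> is \<open>e x$k\<close>, so
    differentiating it gives a derivative of the frame.\<close>
  have cZ: "cpos (Z j k) = ctan (P x$j)$k" for j k
    by (rule dir_deriv_unique[OF open_U x _ _ dir_comps(1)[OF x]])
      (rule cpos_P, assumption, intro dir_deriv_components dZ)
  have "Z j k - Z k j = (\<Sum>q\<in>UNIV. (\<phi> x$j$q$k - \<phi> x$k$q$j) *\<^sub>R P x$q)" for j k
  proof -
    \<comment> \<open>The coordinate expression of the bracket of the dual fields with indices
      \<open>j\<close> and \<open>k\<close>.\<close>
    define w where "w = A k (dual x j) - A j (dual x k)"
    have H2: "(\<Sum>i\<in>UNIV. dual x k$i *\<^sub>R H (axis i 1) (dual x j)) = H (dual x j) (dual x k)" for j k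
      by (simp add: linear_sum_axis[OF linH, of _ "dual x k"] Hsym[of "dual x j"])
    have Zw: "Z j k - Z k j = Df x w"
      unfolding Z_def H2 w_def by (simp add: linear_diff[OF linear_Df[OF x]] Hsym[of "dual x j"])
    have "Df x w = (\<Sum>q\<in>UNIV. (e x$q \<bullet> cpos (Df x w)) *\<^sub>R P x$q)"
      by (subst (1) dual_expansion[OF x, of w])
        (simp add: linear_sum[OF linear_Df[OF x]] linear_scale[OF linear_Df[OF x]] P_def)
    then show ?thesis
      by (simp add: cZ conn_simps inner_diff_right flip: Zw)
  qed
  with dZ show thesis by (rule that)
qed

definition conn_deriv :: "real^4 \<Rightarrow> conn^4" where
  "conn_deriv x = (\<chi> j. frechet_derivative conn (at x) (dual x j))"

lemma dir_conn: "x \<in> U \<Longrightarrow> dir_deriv conn x (dual x j) (conn_deriv x$j)"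
  unfolding conn_deriv_def vec_lambda_beta
  by (rule dir_deriv_frechet) (use differentiable_conn frechet_derivative_works in blast)

lemma dir_conn_comps: assumes x: "x \<in> U"
  shows "dir_deriv (\<lambda>y. \<phi> y$k$n$m) x (dual x j) (fst (conn_deriv x$j)$k$n$m)"
    "dir_deriv (\<lambda>y. \<kappa> y$k$a$b) x (dual x j) (fst (snd (conn_deriv x$j))$k$a$b)"
    "dir_deriv (\<lambda>y. \<mu> y$k$a) x (dual x j) (snd (snd (conn_deriv x$j))$k$a)"
    "dir_deriv (\<lambda>y. \<mu> y$k) x (dual x j) (snd (snd (conn_deriv x$j))$k)"
  by (intro dir_deriv_components dir_conn[OF x])+

lemma phi_skew: assumes x: "x \<in> U" shows "\<phi> x$k$n$m = - \<phi> x$k$m$n"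
proof -
  have "e x$n \<bullet> ctan (P x$k)$m + ctan (P x$k)$n \<bullet> e x$m = 0"
    by (rule dir_deriv_unique[OF open_U x _ dir_deriv_products(3)[OF dir_comps(1)[OF x] dir_comps(1)[OF x]]
          dir_deriv_const[of "if n = m then 1 else 0"]]) (rule frame_orthonormal(1)[OF in_FL0(1)])
  then show ?thesis by (simp add: conn_simps inner_commute)
qed

text \<open>The normal part of the antisymmetrized second derivative of \<open>e\<close> is computed
  twice: by differentiating the expansion of \<open>ctan (P x$k)\<close> in the frame, and from the
  commutator. Derivatives of \<phi> multiply tangent vectors and drop out.\<close>

lemma codazzi: assumes x: "x \<in> U"
  shows "codazzi_form (l x) (conn x) a m k j = codazzi_form (l x) (conn x) a m j k"
proof -
  obtain Z where Z: "\<And>j k. dir_deriv (\<lambda>y. P y$k) x (dual x j) (Z j k)"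
    "\<And>j k. Z j k - Z k j = (\<Sum>q\<in>UNIV. (\<phi> x$j$q$k - \<phi> x$k$q$j) *\<^sub>R P x$q)"
    using commutator[OF x] by blast
  let ?N = "\<lambda>w. normal_coeffs (e x) (\<nu> x) w $ a"
  note lin = linear_normal_coeffs[OF in_FL0(1)[OF x], of a]
  note Nsimps = linear_add[OF lin] linear_diff[OF lin] linear_sum[OF lin] linear_scale[OF lin]
    normal_coeffs_frame[OF in_FL0(1)[OF x]]
  have N: "?N (ctan (Z j k)$m) = (\<Sum>n\<in>UNIV. \<phi> x$k$n$m * Smat (l x)$a$n$j) + (Smat (\<mu> x$j) - Smat 0)$a$m$k
       + (\<Sum>b\<in>UNIV. Smat (l x)$b$m$k * \<kappa> x$j$a$b)" for j k
  proof -
    have "ctan (Z j k)$m = (\<Sum>n\<in>UNIV. \<phi> x$k$n$m *\<^sub>R ctan (P x$j)$n + fst (conn_deriv x$j)$k$n$m *\<^sub>R e x$n)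
        + (\<Sum>b\<in>UNIV. Smat (l x)$b$m$k *\<^sub>R cnor (P x$j)$b + (Smat (\<mu> x$j) - Smat 0)$b$m$k *\<^sub>R \<nu> x$b)"
    proof (rule dir_deriv_unique[OF open_U x])
      show "dir_deriv (\<lambda>y. ctan (P y$k)$m) x (dual x j) (ctan (Z j k)$m)"
        by (intro dir_deriv_components Z)
      show "dir_deriv (\<lambda>y. (\<Sum>n\<in>UNIV. \<phi> y$k$n$m *\<^sub>R e y$n) + (\<Sum>b\<in>UNIV. Smat (l y)$b$m$k *\<^sub>R \<nu> y$b)) x (dual x j)
        ((\<Sum>n\<in>UNIV. \<phi> x$k$n$m *\<^sub>R ctan (P x$j)$n + fst (conn_deriv x$j)$k$n$m *\<^sub>R e x$n)
        + (\<Sum>b\<in>UNIV. Smat (l x)$b$m$k *\<^sub>R cnor (P x$j)$b + (Smat (\<mu> x$j) - Smat 0)$b$m$k *\<^sub>R \<nu> x$b))"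
        by (intro dir_deriv_add dir_deriv_sum dir_deriv_products dir_comps[OF x] dir_conn_comps[OF x] dir_deriv_Smat)
    qed (rule ctan_P)
    then show ?thesis
      by (simp add: Nsimps sum.distrib normal_coeffs_ctan_P[OF x] if_distrib[of "\<lambda>c. _ * c"]
          flip: conn_simps(2) cong: if_cong)
  qed
  have "?N (ctan (Z j k)$m) - ?N (ctan (Z k j)$m) = ?N (ctan (Z j k - Z k j)$m)"
    by (simp add: Nsimps)
  also have "ctan (Z j k - Z k j)$m = (\<Sum>q\<in>UNIV. (\<phi> x$j$q$k - \<phi> x$k$q$j) *\<^sub>R ctan (P x$q)$m)"
    unfolding Z by (simp add: fst_sum snd_sum)
  also have "?N \<dots> = (\<Sum>q\<in>UNIV. (\<phi> x$j$q$k - \<phi> x$k$q$j) * Smat (l x)$a$m$q)"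
    by (simp add: Nsimps normal_coeffs_ctan_P[OF x])
  finally show ?thesis
    unfolding N codazzi_form_def
    by (simp add: case_prod_beta sum_subtractf algebra_simps)
qed

end

section \<open>The linear system for the derivatives of the coefficients\<close>

context integral_chart
begin

text \<open>The first component differentiates the Codazzi equations. The next three differentiate
  the expressions for \<phi>, \<kappa>, \<mu> and antisymmetrize, so that second derivatives of the
  configuration are removed by the commutator. The last two differentiate the skewness of \<phi> and
  the tangency of \<mu>.\<close>

lemma conn_equations: assumes x: "x \<in> U"
  shows "conn_symbol (l x) (conn_deriv x) = conn_rhs (f x) (conn x)"
proof -
  let ?\<zeta> = "conn_deriv x"
  let ?t = "\<lambda>i q k. \<phi> x$i$q$k - \<phi> x$k$q$i"
  obtain Z where Z: "\<And>j k. dir_deriv (\<lambda>y. P y$k) x (dual x j) (Z j k)"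
    "\<And>j k. Z j k - Z k j = (\<Sum>q\<in>UNIV. ?t j q k *\<^sub>R P x$q)"
    using commutator[OF x] by blast
  have ZZ: "ctan (Z i k)$m - ctan (Z k i)$m = (\<Sum>q\<in>UNIV. ?t i q k *\<^sub>R ctan (P x$q)$m)"
    "cnor (Z i k)$b - cnor (Z k i)$b = (\<Sum>q\<in>UNIV. ?t i q k *\<^sub>R cnor (P x$q)$b)"
    "clam (Z i k)$a - clam (Z k i)$a = (\<Sum>q\<in>UNIV. ?t i q k * clam (P x$q)$a)" for i k m b a
    using Z(2)[of i k] by (simp_all add: prod_eq_iff vec_eq_iff fst_sum snd_sum)
  note fr = frame_orthonormal[OF in_FL0(1)[OF x]]
  define dS where "dS i a m k = (Smat (\<mu> x$i) - Smat 0)$a$m$k" for i a m k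
  define dC where "dC a m k j i = (\<Sum>b\<in>UNIV. \<kappa> x$j$a$b * dS i b m k) - (\<Sum>n\<in>UNIV. \<phi> x$j$n$m * dS i a n k)
         - (\<Sum>n\<in>UNIV. \<phi> x$j$n$k * dS i a m n)" for a m k j i
  have dcod: "dir_deriv (\<lambda>y. codazzi_form (l y) (conn y) a m k j) x (dual x i)
     (codazzi_form (l x) (?\<zeta>$i) a m k j + dC a m k j i)" for a m k j i
  proof -
    have "dir_deriv (\<lambda>y. codazzi_form (l y) (conn y) a m k j) x (dual x i)
      ((Smat (snd (snd (?\<zeta>$i))$j) - Smat 0)$a$m$k
       + (\<Sum>b\<in>UNIV. \<kappa> x$j$a$b * dS i b m k + fst (snd (?\<zeta>$i))$j$a$b * Smat (l x)$b$m$k)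
       - (\<Sum>n\<in>UNIV. \<phi> x$j$n$m * dS i a n k + fst (?\<zeta>$i)$j$n$m * Smat (l x)$a$n$k)
       - (\<Sum>n\<in>UNIV. \<phi> x$j$n$k * dS i a m n + fst (?\<zeta>$i)$j$n$k * Smat (l x)$a$m$n))"
      unfolding codazzi_form_def case_prod_beta dS_def
      by (intro dir_deriv_add dir_deriv_diff dir_deriv_sum dir_deriv_products dir_deriv_linear[OF bounded_linear_Smat]
          dir_comps[OF x] dir_conn_comps[OF x] dir_deriv_Smat)
    then show ?thesis
      unfolding codazzi_form_def case_prod_beta dC_def by (simp add: sum.distrib algebra_simps)
  qed
  have 1: "codazzi_form (l x) (?\<zeta>$i) a m k j - codazzi_form (l x) (?\<zeta>$i) a m j k = dC a m j k i - dC a m k j i" for a m k j i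
  proof -
    have "codazzi_form (l x) (?\<zeta>$i) a m k j + dC a m k j i = codazzi_form (l x) (?\<zeta>$i) a m j k + dC a m j k i"
      by (rule dir_deriv_unique[OF open_U x codazzi dcod dcod])
    then show ?thesis by simp
  qed
  have 2: "fst (?\<zeta>$i)$k$n$m - fst (?\<zeta>$k)$i$n$m = ctan (P x$i)$n \<bullet> ctan (P x$k)$m - ctan (P x$k)$n \<bullet> ctan (P x$i)$m
       + (\<Sum>q\<in>UNIV. ?t i q k * \<phi> x$q$n$m)" for i k n m
  proof -
    have D: "fst (?\<zeta>$i)$k$n$m = e x$n \<bullet> ctan (Z i k)$m + ctan (P x$i)$n \<bullet> ctan (P x$k)$m" for i k
    proof (rule dir_deriv_unique[OF open_U x _ dir_conn_comps(1)[OF x]])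
      show "dir_deriv (\<lambda>y. e y$n \<bullet> ctan (P y$k)$m) x (dual x i) (e x$n \<bullet> ctan (Z i k)$m + ctan (P x$i)$n \<bullet> ctan (P x$k)$m)"
        by (intro dir_deriv_products dir_comps[OF x] dir_deriv_components Z)
    qed (rule conn_simps)
    have "e x$n \<bullet> ctan (Z i k)$m - e x$n \<bullet> ctan (Z k i)$m = (\<Sum>q\<in>UNIV. ?t i q k * \<phi> x$q$n$m)"
      unfolding inner_diff_right[symmetric] ZZ by (simp add: inner_sum_right conn_simps)
    then show ?thesis unfolding D by simp
  qed
  have 3: "fst (snd (?\<zeta>$i))$k$a$b - fst (snd (?\<zeta>$k))$i$a$b
      = (\<Sum>n\<in>UNIV. \<Sum>d\<in>UNIV. (\<nu> x$d \<bullet> \<nu> x$b) * (Smat (l x)$d$n$k * Smat (l x)$a$n$i - Smat (l x)$d$n$i * Smat (l x)$a$n$k))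
         - (\<Sum>d\<in>UNIV. \<kappa> x$k$d$b * \<kappa> x$i$a$d - \<kappa> x$i$d$b * \<kappa> x$k$a$d)
         + (\<Sum>q\<in>UNIV. ?t i q k * \<kappa> x$q$a$b)" for i k a b
  proof -
    let ?N = "\<lambda>w. normal_coeffs (e x) (\<nu> x) w $ a"
    note lin = linear_normal_coeffs[OF in_FL0(1)[OF x], of a]
    note Nsimps = linear_add[OF lin] linear_diff[OF lin] linear_sum[OF lin] linear_scale[OF lin]
      normal_coeffs_frame[OF in_FL0(1)[OF x]]
    \<comment> \<open>Only normal parts count: multiples of \<open>e x$n\<close> vanish under
      \<open>?N\<close>, and the tangential part of the derivative of \<open>\<nu>\<close>
      contributes through \<open>Smat\<close>, which produces the curvature term of the Ricci
      equation.\<close>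
    have D: "?N (cnor (Z i k)$b) = fst (snd (?\<zeta>$i))$k$a$b + (\<Sum>d\<in>UNIV. \<kappa> x$k$d$b * \<kappa> x$i$a$d)
       + (\<Sum>n\<in>UNIV. (e x$n \<bullet> cnor (P x$k)$b) * Smat (l x)$a$n$i)" for i k
    proof -
      have "cnor (Z i k)$b = (\<Sum>n\<in>UNIV. (e x$n \<bullet> cnor (P x$k)$b) *\<^sub>R ctan (P x$i)$n
           + (e x$n \<bullet> cnor (Z i k)$b + ctan (P x$i)$n \<bullet> cnor (P x$k)$b) *\<^sub>R e x$n)
         + (\<Sum>d\<in>UNIV. \<kappa> x$k$d$b *\<^sub>R cnor (P x$i)$d + fst (snd (?\<zeta>$i))$k$d$b *\<^sub>R \<nu> x$d)"
      proof (rule dir_deriv_unique[OF open_U x])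
        show "dir_deriv (\<lambda>y. cnor (P y$k)$b) x (dual x i) (cnor (Z i k)$b)"
          by (intro dir_deriv_components Z)
        show "dir_deriv (\<lambda>y. (\<Sum>n\<in>UNIV. (e y$n \<bullet> cnor (P y$k)$b) *\<^sub>R e y$n) + (\<Sum>d\<in>UNIV. \<kappa> y$k$d$b *\<^sub>R \<nu> y$d)) x (dual x i)
          ((\<Sum>n\<in>UNIV. (e x$n \<bullet> cnor (P x$k)$b) *\<^sub>R ctan (P x$i)$n
             + (e x$n \<bullet> cnor (Z i k)$b + ctan (P x$i)$n \<bullet> cnor (P x$k)$b) *\<^sub>R e x$n)
           + (\<Sum>d\<in>UNIV. \<kappa> x$k$d$b *\<^sub>R cnor (P x$i)$d + fst (snd (?\<zeta>$i))$k$d$b *\<^sub>R \<nu> x$d))"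
          by (intro dir_deriv_add dir_deriv_sum dir_deriv_products dir_comps[OF x] dir_conn_comps[OF x]
              dir_deriv_components Z)
        fix y assume y: "y \<in> U"
        show "cnor (P y$k)$b = (\<Sum>n\<in>UNIV. (e y$n \<bullet> cnor (P y$k)$b) *\<^sub>R e y$n) + (\<Sum>d\<in>UNIV. \<kappa> y$k$d$b *\<^sub>R \<nu> y$d)"
          using frame_decomp[OF in_FL0(1)[OF y], of "cnor (P y$k)$b"] by (simp add: conn_simps)
      qed
      from arg_cong[OF this, of ?N] show ?thesis
        by (simp add: Nsimps sum.distrib normal_coeffs_ctan_P[OF x] if_distrib[of "\<lambda>c. _ * c"]
          flip: conn_simps(2) cong: if_cong)
    qed
    have "?N (cnor (Z i k)$b) - ?N (cnor (Z k i)$b) = ?N (cnor (Z i k)$b - cnor (Z k i)$b)"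
      by (simp add: Nsimps)
    also have "\<dots> = (\<Sum>q\<in>UNIV. ?t i q k * \<kappa> x$q$a$b)"
      unfolding ZZ by (simp add: Nsimps conn_simps)
    finally have N: "?N (cnor (Z i k)$b) - ?N (cnor (Z k i)$b) = (\<Sum>q\<in>UNIV. ?t i q k * \<kappa> x$q$a$b)" .
    have G: "(\<Sum>n\<in>UNIV. (e x$n \<bullet> cnor (P x$k)$b) * Smat (l x)$a$n$i) =
       - (\<Sum>n\<in>UNIV. \<Sum>d\<in>UNIV. (\<nu> x$d \<bullet> \<nu> x$b) * (Smat (l x)$d$n$k * Smat (l x)$a$n$i))" for i k
      by (simp add: e_cnor_P[OF x] sum_distrib_right sum_negf mult.assoc mult.commute mult.left_commute sum_distrib_left)
    show ?thesis
      using N unfolding D G by (simp add: sum_subtractf right_diff_distrib)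
  qed
  have 4: "snd (snd (?\<zeta>$i))$k$a - snd (snd (?\<zeta>$k))$i$a = (\<Sum>q\<in>UNIV. ?t i q k * \<mu> x$q$a)" for i k a
  proof -
    have D: "snd (snd (?\<zeta>$i))$k$a = clam (Z i k)$a" for i k
      by (rule dir_deriv_unique[OF open_U x _ dir_conn_comps(3)[OF x]])
        (simp add: conn_simps, intro dir_deriv_components Z)
    show ?thesis unfolding D ZZ by (simp add: conn_simps)
  qed
  have 5: "fst (?\<zeta>$i)$k$n$m + fst (?\<zeta>$i)$k$m$n = 0" for i k n m
  proof (rule dir_deriv_unique[OF open_U x])
    show "dir_deriv (\<lambda>y. \<phi> y$k$n$m + \<phi> y$k$m$n) x (dual x i) (fst (?\<zeta>$i)$k$n$m + fst (?\<zeta>$i)$k$m$n)"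
      by (intro dir_deriv_add dir_conn_comps[OF x])
  qed (auto intro: dir_deriv_const simp: phi_skew[of _ k n m])
  have L: "l y$1 * l y$2 * l y$3 + l y$1 + l y$2 + l y$3 = 0" if "y \<in> U" for y
    using in_FL0[OF that] by (auto simp: Lsurf0_def Lsurf_def)
  have dl: "dir_deriv (\<lambda>y. l y$a) y (dual y j) (\<mu> y$j$a)" if "y \<in> U" for y j a
    by (rule dir_deriv_components(3)[OF dir_comps(3)[OF that]])
  \<comment> \<open>The derivative of the surface equation along a dual field; it is differentiated
    once more for the last component.\<close>
  have tangent: "(1 + l y$2 * l y$3) * \<mu> y$k$1 + (1 + l y$1 * l y$3) * \<mu> y$k$2 + (1 + l y$1 * l y$2) * \<mu> y$k$3 = 0"
    if y: "y \<in> U" for y k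
  proof -
    have "l y$1 * l y$2 * \<mu> y$k$3 + (l y$1 * \<mu> y$k$2 + \<mu> y$k$1 * l y$2) * l y$3 + \<mu> y$k$1 + \<mu> y$k$2 + \<mu> y$k$3 = 0"
      by (rule dir_deriv_unique[OF open_U y L _ dir_deriv_const[where v = "dual y k"]])
        (assumption, intro dir_deriv_add dir_deriv_products dl[OF y])
    then show ?thesis by (simp add: algebra_simps)
  qed
  have 6: "Lgrad (l x) \<bullet> snd (snd (?\<zeta>$i))$k = - ((\<mu> x$i$2 * l x$3 + l x$2 * \<mu> x$i$3) * \<mu> x$k$1
      + (\<mu> x$i$1 * l x$3 + l x$1 * \<mu> x$i$3) * \<mu> x$k$2 + (\<mu> x$i$1 * l x$2 + l x$1 * \<mu> x$i$2) * \<mu> x$k$3)" for i k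
  proof -
    let ?z = "snd (snd (?\<zeta>$i))$k"
    have "((1 + l x$2 * l x$3) * ?z$1 + (0 + (l x$2 * \<mu> x$i$3 + \<mu> x$i$2 * l x$3)) * \<mu> x$k$1)
      + ((1 + l x$1 * l x$3) * ?z$2 + (0 + (l x$1 * \<mu> x$i$3 + \<mu> x$i$1 * l x$3)) * \<mu> x$k$2)
      + ((1 + l x$1 * l x$2) * ?z$3 + (0 + (l x$1 * \<mu> x$i$2 + \<mu> x$i$1 * l x$2)) * \<mu> x$k$3) = 0"
      by (rule dir_deriv_unique[OF open_U x tangent[of _ k] _ dir_deriv_const[where v = "dual x i"]])
        (assumption, intro dir_deriv_add dir_deriv_products dir_deriv_const dl[OF x] dir_conn_comps[OF x])
    then show ?thesis by (simp add: inner_vec_def sum_3 Lgrad_def algebra_simps)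
  qed
  show ?thesis
    unfolding conn_symbol_def conn_rhs_def Let_def
    by (simp add: vec_eq_iff 1 2 3 4 5 6 dC_def dS_def flip: P_eq_frame_vel[OF x])
qed

end

section \<open>The closed first-order system\<close>

lemma loc_lip_Smat [loc_lip_intros]:
  assumes "loc_lip_at l s"
  shows "loc_lip_at (\<lambda>s. Smat (l s)$a$i$j) s"
proof -
  have "loc_lip_at (\<lambda>s. (Smat (l s) - Smat 0)$a$i$j + Smat 0$a$i$j) s"
    by (intro loc_lip_add loc_lip_const loc_lip_bounded_linear[OF bounded_linear_Smat assms])
  then show ?thesis by simp
qed

lemma Lgrad_inner: "Lgrad l \<bullet> m = (1 + l$2 * l$3) * m$1 + (1 + l$1 * l$3) * m$2 + (1 + l$1 * l$2) * m$3"
  by (simp add: Lgrad_def inner_vec_def sum_3)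

lemma codazzi_form_linear:
  "codazzi_form l (z + z') a m k j = codazzi_form l z a m k j + codazzi_form l z' a m k j"
  "codazzi_form l (c *\<^sub>R z) a m k j = c * codazzi_form l z a m k j"
proof -
  note lin = bounded_linear.linear[OF bounded_linear_Smat, of a m k]
  show "codazzi_form l (z + z') a m k j = codazzi_form l z a m k j + codazzi_form l z' a m k j"
    using linear_add[OF lin, of "snd (snd z)$j" "snd (snd z')$j"]
    by (simp add: codazzi_form_def case_prod_beta algebra_simps sum.distrib)
  show "codazzi_form l (c *\<^sub>R z) a m k j = c * codazzi_form l z a m k j"
    using linear_scale[OF lin, of c "snd (snd z)$j"]
    by (simp add: codazzi_form_def case_prod_beta algebra_simps sum_distrib_left)
qed

lemma linear_conn_symbol: "linear (conn_symbol l)"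
  by (rule linearI)
    (simp_all add: conn_symbol_def vec_eq_iff codazzi_form_linear algebra_simps inner_add_right)

lemma loc_lip_conn_symbol:
  "loc_lip_at (\<lambda>p. conn_symbol (clam (fst (fst p))) (snd p)) (s :: (conf \<times> conn) \<times> (conn^4))"
  unfolding conn_symbol_def codazzi_form_def case_prod_beta Lgrad_inner vector_minus_component
  \<comment> \<open>All entries are polynomial. The rule for \<open>Smat\<close> precedes the
    general ones, since the component rule would split an entry of \<open>Smat\<close>.\<close>
  by (rule loc_lip_const loc_lip_Smat loc_lip_intros)+

lemma loc_lip_frame_vel [loc_lip_intros]:
  assumes "loc_lip_at c s" "loc_lip_at z s"
  shows "loc_lip_at (\<lambda>s. frame_vel (c s) (z s)) s"
  unfolding frame_vel_def by (rule loc_lip_const loc_lip_Smat assms loc_lip_intros)+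

lemma loc_lip_conn_rhs: "loc_lip_at (\<lambda>s. conn_rhs (fst s) (snd s)) s"
  unfolding conn_rhs_def Let_def vector_minus_component by (rule loc_lip_const loc_lip_Smat loc_lip_intros)+

definition proj_conf :: "conf \<Rightarrow> conf \<Rightarrow> real^4" where
  "proj_conf q c = (\<chi> i. ctan q$i \<bullet> cpos c)"

lemma bounded_linear_proj_conf: "bounded_linear (proj_conf q)"
  unfolding linear_conv_bounded_linear[symmetric]
  by (rule linearI) (simp_all add: proj_conf_def vec_eq_iff inner_add_right)

text \<open>
  Points of an integral 4-fold near \<open>q\<close> are parametrized by their projection \<open>proj_conf q\<close>;
  \<open>b$j$k\<close> are the components of the \<open>j\<close>-th coordinate field of this parametrization in the \<open>X\<^sub>k\<close>.
\<close>

definition graph_rel :: "conf \<Rightarrow> ((conf \<times> conn) \<times> ((conf \<times> conn)^4)) set" where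
  "graph_rel q = {(s, \<chi> j. \<Sum>k\<in>UNIV. b$j$k *\<^sub>R (frame_vel (fst s) (snd s)$k, \<zeta>$k)) | s \<zeta> b.
     conn_symbol (clam (fst s)) \<zeta> = conn_rhs (fst s) (snd s) \<and>
     (\<chi> j i. \<Sum>k\<in>UNIV. b$j$k * (ctan q$i \<bullet> ctan (fst s)$k)) = (\<chi> j i. axis j 1 $ i)}"

text \<open>The derivatives \<zeta> and the coefficients \<open>b\<close> each solve a linear system
  that is injective at \<open>s\<close>, and the right-hand side is polynomial in them. The assumed
  \<open>W\<close> supplies the solution over \<open>s\<close> near which all others lie.\<close>

lemma lip_graph_rel:
  assumes s: "fst s \<in> FL0_generic" and W: "(s, W) \<in> graph_rel (fst s)"
  shows "lip_rel (graph_rel (fst s)) s"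
proof -
  let ?q = "fst s"
  have gen: "clam ?q \<in> Lsurf0" "clam ?q$1 \<noteq> 1" "clam ?q$2 \<noteq> 1" and fr: "(cpos ?q, ctan ?q, cnor ?q) \<in> frames"
    using s by (auto simp: FL0_generic_def FL0_def)
  let ?R1 = "{(s, \<zeta>). conn_symbol (clam (fst s)) \<zeta> = conn_rhs (fst s) (snd s)}"
  let ?L = "\<lambda>s b. \<chi> j i. \<Sum>k\<in>UNIV. b$j$k * (ctan ?q$i \<bullet> ctan (fst s)$k)"
  let ?R2 = "{(s :: conf \<times> conn, b :: real^4^4). ?L s b = (\<chi> j i. axis j 1 $ i)}"
  have R1: "lip_rel ?R1 s"
    by (rule lip_rel_linear_system[OF linear_conn_symbol loc_lip_conn_symbol loc_lip_conn_rhs])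
      (rule conn_symbol_inj[OF gen])
  have R2: "lip_rel ?R2 s"
  proof (rule lip_rel_linear_system)
    show "linear (?L s)" for s :: "conf \<times> conn"
      by (rule linearI) (simp_all add: vec_eq_iff sum.distrib sum_distrib_left algebra_simps)
    show "loc_lip_at (\<lambda>p. ?L (fst p) (snd p)) (s, 0)" by (rule loc_lip_const loc_lip_Smat loc_lip_intros)+
    show "loc_lip_at (\<lambda>_. \<chi> j i. axis j 1 $ i) s" by (rule loc_lip_const)
    \<comment> \<open>At \<open>s\<close> the frame is that of the base point itself, so the matrix
      of inner products is the identity.\<close>
    show "b = 0" if "?L s b = 0" for b
      using that by (simp add: vec_eq_iff frame_orthonormal[OF fr] if_distrib[of "\<lambda>c. _ * c"] cong: if_cong)
  qed
  let ?W = "\<lambda>s z. \<chi> j. \<Sum>k\<in>UNIV. snd z$j$k *\<^sub>R (frame_vel (fst s) (snd s)$k, fst z$k)"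
  have eq: "graph_rel ?q = {(s, ?W s z) |s z. (s, z) \<in> {(s, z, w). (s, z) \<in> ?R1 \<and> (s, w) \<in> ?R2}}"
    unfolding graph_rel_def by (auto simp: split_paired_Ex)
  obtain z where z: "(s, z) \<in> {(s, z, w). (s, z) \<in> ?R1 \<and> (s, w) \<in> ?R2}"
    using W unfolding eq by blast
  show ?thesis
    unfolding eq by (rule lip_rel_image[OF lip_rel_Pair[OF R1 R2] z]) (rule loc_lip_const loc_lip_intros)+
qed

section \<open>Integral 4-folds as graphs over a projection\<close>

context integral_chart
begin

definition state :: "real^4 \<Rightarrow> conf \<times> conn" where "state x = (f x, conn x)"

text \<open>The condition \<open>inv\<close> says that \<open>g\<close> inverts the projection to
  first order, so the images of the coordinate vectors have components \<open>b\<close> determined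
  by the linear system in \<open>graph_rel\<close>. The chain rule then expresses the derivative of
  the state by the derivatives along the dual fields.\<close>

lemma state_derivative:
  assumes x: "x \<in> U" and x': "x = g y" and g: "(g has_derivative g') (at y)"
    and inv: "\<And>v. proj_conf q (Df x (g' v)) = v"
  shows "\<exists>W. (state x, W) \<in> graph_rel q \<and> ((\<lambda>y. state (g y)) has_derivative (\<lambda>v. \<Sum>j\<in>UNIV. v$j *\<^sub>R W$j)) (at y)"
proof -
  define b :: "real^4^4" where "b = (\<chi> j k. e x$k \<bullet> cpos (Df x (g' (axis j 1))))"
  define W where "W = (\<chi> j. \<Sum>k\<in>UNIV. b$j$k *\<^sub>R (frame_vel (f x) (conn x)$k, conn_deriv x$k))"
  have g': "g' (axis j 1) = (\<Sum>k\<in>UNIV. b$j$k *\<^sub>R dual x k)" for j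
    unfolding b_def using dual_expansion[OF x, of "g' (axis j 1)"] by simp
  have "(\<Sum>k\<in>UNIV. b$j$k * (ctan q$i \<bullet> e x$k)) = axis j 1 $ i" for j i
  proof -
    have "axis j 1 $ i = ctan q$i \<bullet> cpos (Df x (g' (axis j 1)))"
      using arg_cong[OF inv[of "axis j 1"], of "\<lambda>v. v$i"] by (simp add: proj_conf_def)
    also have "cpos (Df x (g' (axis j 1))) = (\<Sum>k\<in>UNIV. b$j$k *\<^sub>R e x$k)"
      unfolding g' by (simp add: linear_sum[OF linear_Df[OF x]] linear_scale[OF linear_Df[OF x]] fst_sum
          cpos_P[OF x, unfolded P_def vec_lambda_beta])
    finally show ?thesis by (simp add: inner_sum_right)
  qed
  then have R: "(state x, W) \<in> graph_rel q"
    unfolding graph_rel_def W_def state_def using conn_equations[OF x] 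
    by (intro CollectI exI[of _ "(f x, conn x)"] exI[of _ "conn_deriv x"] exI[of _ b]) (simp add: vec_eq_iff)
  obtain C where C: "(conn has_derivative C) (at x)" using differentiable_conn[OF x] by (auto simp: differentiable_def)
  have Cd: "conn_deriv x$k = C (dual x k)" for k
    unfolding conn_deriv_def using frechet_derivative_at[OF C] by simp
  have lin: "linear (\<lambda>v. (Df x v, C v))" "linear g'"
    using has_derivative_linear[OF C] has_derivative_linear[OF g] linear_Df[OF x]
    by (auto simp: linear_iff)
  have "((\<lambda>y. state (g y)) has_derivative (\<lambda>v. (Df x (g' v), C (g' v)))) (at y)"
    unfolding state_def using f_derivative[OF x] C x'
    by (intro has_derivative_Pair has_derivative_compose[OF g]) auto
  also have "(\<lambda>v. (Df x (g' v), C (g' v))) = (\<lambda>v. \<Sum>j\<in>UNIV. v$j *\<^sub>R W$j)"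
  proof
    fix v
    have "(Df x (g' (axis j 1)), C (g' (axis j 1))) = W$j" for j
      unfolding g' W_def linear_sum[OF lin(1)] 
      by (simp add: linear_scale[OF lin(1), simplified] Cd P_eq_frame_vel[OF x, symmetric] P_def)
    then show "(Df x (g' v), C (g' v)) = (\<Sum>j\<in>UNIV. v$j *\<^sub>R W$j)"
      using linear_sum_axis[OF linear_compose[OF lin(2,1)], of v] by (simp add: o_def)
  qed
  finally show ?thesis using R by blast
qed

text \<open>The derivative of the projection at the base point is the coframe matrix, which is
  invertible by the independence condition; the inverse function theorem gives the graph. The
  embedding makes the image of a smaller chart domain open in \<open>M\<close>, so the graph is all
  of \<open>M\<close> near the point.\<close>

lemma graph_chart:
  assumes x0: "x0 \<in> U" and emb: "embedding_on U f" and M: "f ` U = M \<inter> W" "open W"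
  obtains V W0 g g' where "open V" "proj_conf (f x0) (f x0) \<in> V" "open W0" "f x0 \<in> W0"
    "M \<inter> W0 = (\<lambda>y. f (g y)) ` V" "g ` V \<subseteq> U" "g (proj_conf (f x0) (f x0)) = x0"
    "\<And>y. y \<in> V \<Longrightarrow> proj_conf (f x0) (f (g y)) = y"
    "\<And>y. y \<in> V \<Longrightarrow> (g has_derivative g' y) (at y)"
    "\<And>y v. y \<in> V \<Longrightarrow> proj_conf (f x0) (Df (g y) (g' y v)) = v"
proof -
  let ?\<pi> = "proj_conf (f x0)"
  define h where "h x = ?\<pi> (f x)" for x
  define h' where "h' x = Blinfun (\<lambda>v. ?\<pi> (Df x v))" for x
  have h': "blinfun_apply (h' x) = (\<lambda>v. ?\<pi> (Df x v))" if "x \<in> U" for x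
    unfolding h'_def
    by (intro bounded_linear_Blinfun_apply bounded_linear_compose[OF bounded_linear_proj_conf]
        has_derivative_bounded_linear[OF f_derivative[OF that]])
  have der: "(h has_derivative (\<lambda>v. ?\<pi> (Df x v))) (at x)" if "x \<in> U" for x
    unfolding h_def by (rule bounded_linear.has_derivative[OF bounded_linear_proj_conf f_derivative[OF that]])
  have "continuous_on U (\<lambda>x. ?\<pi> (Df x v))" for v
    unfolding Df_def
    by (intro bounded_linear.continuous_on[OF bounded_linear_proj_conf] smooth_on_continuous[OF smooth_on_directional[OF smooth]])
  then have cont: "continuous_on U h'"
    by (intro continuous_on_blinfun_componentwise) (simp add: h' cong: continuous_on_cong)
  obtain A where A: "A ** coframe x0 = mat 1"
    using coframe_det[OF x0] unfolding invertible_det_nz[symmetric] invertible_def by blast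
  define B where "B = Blinfun ((*v) A)"
  have B: "blinfun_apply B = (*v) A"
    unfolding B_def by (intro bounded_linear_Blinfun_apply matrix_vector_mul_bounded_linear)
  have hA: "?\<pi> (Df x0 v) = coframe x0 *v v" for v
    by (simp add: vec_eq_iff coframe_mult[OF x0] proj_conf_def)
  have inv: "B o\<^sub>L h' x0 = id_blinfun"
    by (intro blinfun_eqI) (simp add: B h'[OF x0] hA matrix_vector_mul_assoc A)
  obtain U' V g g' where ift: "open U'" "U' \<subseteq> U" "x0 \<in> U'" "open V" "h x0 \<in> V" "homeomorphism U' V h g"
    "\<And>y. y \<in> V \<Longrightarrow> (g has_derivative (g' y)) (at y)"
    using inverse_function_theorem[OF open_U _ cont x0 inv] der h' by metis
  have gV: "g y \<in> U'" "h (g y) = y" if "y \<in> V" for y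
    using ift(6) that unfolding homeomorphism_def by auto
  have gh: "g (h x) = x" "h x \<in> V" if "x \<in> U'" for x
    using ift(6) that unfolding homeomorphism_def by auto
  obtain k where k: "homeomorphism U (f ` U) f k" using emb by (auto simp: embedding_on_def)
  have "openin (top_of_set (f ` U)) (f ` U')"
    using k ift(1,2) by (intro homeomorphism_imp_open_map[OF k]) (auto simp: openin_open)
  then obtain W1 where W1: "open W1" "f ` U' = f ` U \<inter> W1" by (auto simp: openin_open)
  show thesis
  proof (rule that[of V "W \<inter> W1" g g'])
    show "open V" "?\<pi> (f x0) \<in> V" "open (W \<inter> W1)" using ift M W1 by (auto simp: h_def)
    have "f x0 \<in> f ` U'" using ift by blast
    then show "f x0 \<in> W \<inter> W1" using W1 M by auto
    have "f ` U' = (\<lambda>y. f (g y)) ` V" using gV gh by force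
    then show "M \<inter> (W \<inter> W1) = (\<lambda>y. f (g y)) ` V" using W1 M by auto
    show "g ` V \<subseteq> U" using gV ift by blast
    show "g (?\<pi> (f x0)) = x0" using gh(1)[OF ift(3)] by (simp add: h_def)
    show pg: "?\<pi> (f (g y)) = y" if "y \<in> V" for y using gV[OF that] by (simp add: h_def)
    show g: "(g has_derivative g' y) (at y)" if "y \<in> V" for y using ift that by blast
    show "?\<pi> (Df (g y) (g' y v)) = v" if y: "y \<in> V" for y v
    proof -
      have "((\<lambda>y. h (g y)) has_derivative (\<lambda>v. ?\<pi> (Df (g y) (g' y v)))) (at y)"
        by (rule has_derivative_compose[OF g[OF y] der]) (use gV[OF y] ift in auto)
      then have "((\<lambda>y. y) has_derivative (\<lambda>v. ?\<pi> (Df (g y) (g' y v)))) (at y)"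
        by (rule has_derivative_transform_within_open[OF _ ift(4) y]) (rule gV)
      then have "(\<lambda>v. ?\<pi> (Df (g y) (g' y v))) = (\<lambda>v. v)"
        using has_derivative_unique has_derivative_ident by blast
      then show ?thesis by metis
    qed
  qed
qed

end

section \<open>Germs and tangent frames\<close>

definition local_chart :: "conf set \<Rightarrow> (real^4) set \<Rightarrow> (real^4 \<Rightarrow> conf) \<Rightarrow> real^4 \<Rightarrow> bool" where
  "local_chart M U f x \<longleftrightarrow> integral_param FL0_generic U f \<and> embedding_on U f \<and> x \<in> U \<and>
     (\<exists>W. open W \<and> f ` U = M \<inter> W)"

lemma integral_fold_local_chart:
  assumes "integral_fold FL0_generic M" "q \<in> M"
  obtains U f x where "local_chart M U f x" "f x = q"
proof -
  have "\<forall>q\<in>M. \<exists>W U f. open W \<and> q \<in> W \<and> integral_param FL0_generic U f \<and> embedding_on U f \<and> f ` U = M \<inter> W"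
    using assms(1) unfolding integral_fold_def by (elim conjE)
  from bspec[OF this assms(2)] obtain W U f
    where W: "open W \<and> q \<in> W \<and> integral_param FL0_generic U f \<and> embedding_on U f \<and> f ` U = M \<inter> W"
    by (elim exE)
  have "q \<in> f ` U" using W assms(2) by (simp only: Int_iff)
  then obtain x where x: "f x = q" "x \<in> U" by (elim imageE) simp
  have "local_chart M U f x"
    unfolding local_chart_def
    using conjI[OF W[THEN conjunct2, THEN conjunct2, THEN conjunct1]
        conjI[OF W[THEN conjunct2, THEN conjunct2, THEN conjunct2, THEN conjunct1]
          conjI[OF x(2) exI[of "\<lambda>W. open W \<and> f ` U = M \<inter> W", OF conjI[OF W[THEN conjunct1]
            W[THEN conjunct2, THEN conjunct2, THEN conjunct2, THEN conjunct2]]]]]] .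
  then show thesis using x(1) by (rule that)
qed

text \<open>A tangent vector of the fold is determined by its projection to the span of the frame at
  that point. This characterizes \<open>P\<close> without reference to the parametrization.\<close>

lemma (in integral_chart) P_eqI:
  assumes "x \<in> U" "proj_conf (f x) (Df x w) = axis k 1"
  shows "P x$k = Df x w"
proof -
  have "coframe x *v w = proj_conf (f x) (Df x w)"
    by (simp add: vec_eq_iff coframe_mult[OF assms(1)] proj_conf_def)
  then have "w = dual x k" using dual_unique[OF assms(1)] assms(2) by simp
  then show ?thesis by (simp add: P_def)
qed

text \<open>Both folds are graphs over the projection of the same point. Equal germs give equal
  graph maps nearby, hence equal derivatives, and these contain the tangent frames.\<close>

lemma same_germ_tangent_frame:
  assumes M: "local_chart M U f x" and M': "local_chart M' U' f' x'" and germ: "same_germ M (f x) M' (f' x')"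
  shows "integral_chart.P f x = integral_chart.P f' x'"
proof -
  interpret A: integral_chart U f using M by unfold_locales (simp add: local_chart_def)
  interpret B: integral_chart U' f' using M' by unfold_locales (simp add: local_chart_def)
  have x: "x \<in> U" "x' \<in> U'" and q: "f' x' = f x"
    using M M' germ by (auto simp: local_chart_def same_germ_def)
  obtain N where N: "embedding_on U f" "f ` U = M \<inter> N" "open N"
    using M by (auto simp: local_chart_def)
  obtain N' where N': "embedding_on U' f'" "f' ` U' = M' \<inter> N'" "open N'"
    using M' by (auto simp: local_chart_def)
  let ?\<pi> = "proj_conf (f x)"
  let ?y = "?\<pi> (f x)"
  obtain V W g g' where g: "open V" "?y \<in> V" "open W" "f x \<in> W"
    "M \<inter> W = (\<lambda>y. f (g y)) ` V" "g ` V \<subseteq> U" "g ?y = x"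
    "\<And>y. y \<in> V \<Longrightarrow> ?\<pi> (f (g y)) = y" "\<And>y. y \<in> V \<Longrightarrow> (g has_derivative g' y) (at y)"
    "\<And>y v. y \<in> V \<Longrightarrow> ?\<pi> (A.Df (g y) (g' y v)) = v"
    by (rule A.graph_chart[OF x(1) N(1,2,3)]) (rule that; assumption)
  obtain V2 W2 h h' where h: "open V2" "?y \<in> V2" "open W2" "f x \<in> W2"
    "M' \<inter> W2 = (\<lambda>y. f' (h y)) ` V2" "h ` V2 \<subseteq> U'" "h ?y = x'"
    "\<And>y. y \<in> V2 \<Longrightarrow> ?\<pi> (f' (h y)) = y" "\<And>y. y \<in> V2 \<Longrightarrow> (h has_derivative h' y) (at y)"
    "\<And>y v. y \<in> V2 \<Longrightarrow> ?\<pi> (B.Df (h y) (h' y v)) = v"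
    by (rule B.graph_chart[OF x(2) N'(1,2,3), unfolded q]) (rule that; assumption)
  obtain W1 where W1: "open W1" "f x \<in> W1" "M \<inter> W1 = M' \<inter> W1"
    using germ by (auto simp: same_germ_def)
  have dg: "((\<lambda>y. f (g y)) has_derivative (\<lambda>v. A.Df (g y) (g' y v))) (at y)" if "y \<in> V" for y
    by (rule has_derivative_compose[OF g(9) A.f_derivative]) (use that g(6) in auto)
  have dh: "((\<lambda>y. f' (h y)) has_derivative (\<lambda>v. B.Df (h y) (h' y v))) (at y)" if "y \<in> V2" for y
    by (rule has_derivative_compose[OF h(9) B.f_derivative]) (use that h(6) in auto)
  define S where "S = V2 \<inter> (V \<inter> (\<lambda>y. f (g y)) -` (W1 \<inter> W2))"
  have "continuous_on V (\<lambda>y. f (g y))"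
    using dg has_derivative_continuous by (intro continuous_at_imp_continuous_on) blast
  then have "open (V \<inter> (\<lambda>y. f (g y)) -` (W1 \<inter> W2))"
    by (rule continuous_open_preimage[OF _ g(1) open_Int[OF W1(1) h(3)]])
  then have "open S" unfolding S_def by (rule open_Int[OF h(1)])
  moreover have "?y \<in> S" unfolding S_def using g(2) h(2,4) W1(2) by (simp add: g(7))
  ultimately have S: "open S" "?y \<in> S" .
  have eq: "f (g y) = f' (h y)" if "y \<in> S" for y
  proof -
    have "y \<in> V" "f (g y) \<in> W1 \<inter> W2" using that by (auto simp: S_def)
    then have "f (g y) \<in> M' \<inter> W2" using g(5) W1(3) by blast
    then obtain z where z: "z \<in> V2" "f (g y) = f' (h z)" using h(5) by auto
    then have "z = y" using h(8)[OF z(1)] g(8)[OF \<open>y \<in> V\<close>] by simp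
    then show ?thesis using z by simp
  qed
  have "((\<lambda>y. f (g y)) has_derivative (\<lambda>v. B.Df (h ?y) (h' ?y v))) (at ?y)"
    by (rule has_derivative_transform_within_open[OF dh[OF h(2)] S]) (simp add: eq)
  from has_derivative_unique[OF dg[OF g(2)] this]
  have "A.Df x (g' ?y v) = B.Df x' (h' ?y v)" for v
    unfolding g(7) h(7) by metis
  moreover have "A.P x$k = A.Df x (g' ?y (axis k 1))" "B.P x'$k = B.Df x' (h' ?y (axis k 1))" for k
    using A.P_eqI[OF x(1)] B.P_eqI[OF x(2)] g(10)[OF g(2)] h(10)[OF h(2)] unfolding g(7) h(7) q by blast+
  ultimately show ?thesis by (simp add: vec_eq_iff)
qed

text \<open>Over the common projection both folds, with their coefficients, solve the same closed
  system. Equal points and tangent frames give equal coefficients, hence equal initial values, and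
  uniqueness along rays makes the graphs agree.\<close>

lemma tangent_frame_same_germ:
  assumes M: "local_chart M U f x" and M': "local_chart M' U' f' x'"
    and q: "f x = f' x'" and P: "integral_chart.P f x = integral_chart.P f' x'"
  shows "same_germ M (f x) M' (f' x')"
proof -
  interpret A: integral_chart U f using M by unfold_locales (simp add: local_chart_def)
  interpret B: integral_chart U' f' using M' by unfold_locales (simp add: local_chart_def)
  have x: "x \<in> U" "x' \<in> U'" using M M' by (auto simp: local_chart_def)
  obtain N where N: "embedding_on U f" "f ` U = M \<inter> N" "open N"
    using M by (auto simp: local_chart_def)
  obtain N' where N': "embedding_on U' f'" "f' ` U' = M' \<inter> N'" "open N'"
    using M' by (auto simp: local_chart_def)
  let ?\<pi> = "proj_conf (f x)"
  let ?y = "?\<pi> (f x)"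
  obtain V W g g' where g: "open V" "?y \<in> V" "open W" "f x \<in> W"
    "M \<inter> W = (\<lambda>y. f (g y)) ` V" "g ` V \<subseteq> U" "g ?y = x"
    "\<And>y. y \<in> V \<Longrightarrow> ?\<pi> (f (g y)) = y" "\<And>y. y \<in> V \<Longrightarrow> (g has_derivative g' y) (at y)"
    "\<And>y v. y \<in> V \<Longrightarrow> ?\<pi> (A.Df (g y) (g' y v)) = v"
    by (rule A.graph_chart[OF x(1) N(1,2,3)]) (rule that; assumption)
  obtain V2 W2 h h' where h: "open V2" "?y \<in> V2" "open W2" "f x \<in> W2"
    "M' \<inter> W2 = (\<lambda>y. f' (h y)) ` V2" "h ` V2 \<subseteq> U'" "h ?y = x'"
    "\<And>y. y \<in> V2 \<Longrightarrow> ?\<pi> (f' (h y)) = y" "\<And>y. y \<in> V2 \<Longrightarrow> (h has_derivative h' y) (at y)"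
    "\<And>y v. y \<in> V2 \<Longrightarrow> ?\<pi> (B.Df (h y) (h' y v)) = v"
    by (rule B.graph_chart[OF x(2) N'(1,2,3), folded q]) (rule that; assumption)
  have sg: "\<exists>W. (A.state (g y), W) \<in> graph_rel (f x) \<and>
      ((\<lambda>y. A.state (g y)) has_derivative (\<lambda>v. \<Sum>j\<in>UNIV. v$j *\<^sub>R W$j)) (at y)" if "y \<in> V" for y
    by (rule A.state_derivative[OF _ refl g(9)]) (use that g(6,10) in auto)
  have sh: "\<exists>W. (B.state (h y), W) \<in> graph_rel (f x) \<and>
      ((\<lambda>y. B.state (h y)) has_derivative (\<lambda>v. \<Sum>j\<in>UNIV. v$j *\<^sub>R W$j)) (at y)" if "y \<in> V2" for y
    by (rule B.state_derivative[OF _ refl h(9)]) (use that h(6,10) in auto)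
  have fs: "fst (A.state (g ?y)) = f x" by (simp add: g(7) A.state_def)
  have "f x \<in> FL0_generic" using A.param x by (auto simp: integral_param_def)
  then have lip: "lip_rel (graph_rel (f x)) (A.state (g ?y))"
    using sg[OF g(2)] lip_graph_rel[of "A.state (g ?y)", unfolded fs] by blast
  have st: "A.state (g ?y) = B.state (h ?y)"
    unfolding g(7) h(7) A.state_def B.state_def A.conn_def B.conn_def by (simp add: q P)
  obtain \<rho> where \<rho>: "\<rho> > 0" "ball ?y \<rho> \<subseteq> V \<inter> V2" "\<And>y. y \<in> ball ?y \<rho> \<Longrightarrow> A.state (g y) = B.state (h y)"
    by (rule lip_rel_ode_unique[of "V \<inter> V2" ?y "\<lambda>y. A.state (g y)" "graph_rel (f x)" "\<lambda>y. B.state (h y)"])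
      (use g(1,2) h(1,2) sg sh lip st in auto)
  have eq: "f (g y) = f' (h y)" if "y \<in> ball ?y \<rho>" for y
    using \<rho>(3)[OF that] by (simp add: A.state_def B.state_def)
  \<comment> \<open>The parameter of a point in either graph is its projection, so every point of
    \<open>M\<close> or \<open>M'\<close> in \<open>Q\<close> has its parameter in the ball where
    the graphs agree.\<close>
  define Q where "Q = (W \<inter> W2) \<inter> ?\<pi> -` ball ?y \<rho>"
  have "open Q"
    unfolding Q_def using g(3) h(3)
    by (intro open_Int open_vimage open_ball linear_continuous_on bounded_linear_proj_conf)
  moreover have "f x \<in> Q" using g(4) h(4) \<rho>(1) by (simp add: Q_def)
  moreover have "M \<inter> Q = M' \<inter> Q"
  proof (intro set_eqI iffI)
    fix m assume m: "m \<in> M \<inter> Q"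
    then have "m \<in> M \<inter> W" by (simp add: Q_def)
    then obtain y where y: "y \<in> V" "m = f (g y)" using g(5) by auto
    then have b: "y \<in> ball ?y \<rho>" using m g(8)[OF y(1)] by (simp add: Q_def)
    then have "m = f' (h y)" "y \<in> V2" using eq y \<rho>(2) by auto
    then have "m \<in> M' \<inter> W2" using h(5) by blast
    then show "m \<in> M' \<inter> Q" using m by simp
  next
    fix m assume m: "m \<in> M' \<inter> Q"
    then have "m \<in> M' \<inter> W2" by (simp add: Q_def)
    then obtain y where y: "y \<in> V2" "m = f' (h y)" using h(5) by auto
    then have b: "y \<in> ball ?y \<rho>" using m h(8)[OF y(1)] by (simp add: Q_def)
    then have "m = f (g y)" "y \<in> V" using eq[OF b] y \<rho>(2) by auto
    then have "m \<in> M \<inter> W" using g(5) by blast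
    then show "m \<in> M \<inter> Q" using m by simp
  qed
  ultimately show ?thesis using q by (auto simp: same_germ_def)
qed

section \<open>The constants and their continuity in families\<close>

definition tangent_frame :: "conf set \<Rightarrow> conf \<Rightarrow> conf^4" where
  "tangent_frame M q = (SOME T. \<exists>U f x. local_chart M U f x \<and> f x = q \<and> T = integral_chart.P f x)"

text \<open>Any two charts of \<open>M\<close> at a point belong to the same germ there, so the
  frame does not depend on the choice made in the definition.\<close>

lemma tangent_frame_eq:
  assumes c: "local_chart M U f x"
  shows "tangent_frame M (f x) = integral_chart.P f x"
proof -
  have "\<exists>T U' f' x'. local_chart M U' f' x' \<and> f' x' = f x \<and> T = integral_chart.P f' x'" using c by blast
  from someI_ex[OF this] obtain U' f' x' where "local_chart M U' f' x'" "f' x' = f x"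
    "tangent_frame M (f x) = integral_chart.P f' x'"
    unfolding tangent_frame_def by blast
  moreover have "same_germ M (f x) M (f x)" by (auto simp: same_germ_def)
  ultimately show ?thesis using same_germ_tangent_frame[OF _ c] by metis
qed

lemma same_germ_iff_tangent_frame:
  assumes "integral_fold FL0_generic M" "integral_fold FL0_generic M'" "q \<in> M" "q' \<in> M'"
  shows "same_germ M q M' q' \<longleftrightarrow> q = q' \<and> tangent_frame M q = tangent_frame M' q'"
proof -
  obtain U f x where c: "local_chart M U f x" and q: "f x = q"
    using integral_fold_local_chart[OF assms(1,3)] by blast
  obtain U' f' x' where c': "local_chart M' U' f' x'" and q': "f' x' = q'"
    using integral_fold_local_chart[OF assms(2,4)] by blast
  have T: "tangent_frame M q = integral_chart.P f x" "tangent_frame M' q' = integral_chart.P f' x'"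
    using tangent_frame_eq[OF c] tangent_frame_eq[OF c'] q q' by simp_all
  show ?thesis
  proof
    assume s: "same_germ M q M' q'"
    then show "q = q' \<and> tangent_frame M q = tangent_frame M' q'"
      using same_germ_tangent_frame[OF c c', unfolded q q', OF s] unfolding T by (simp add: same_germ_def)
  next
    assume "q = q' \<and> tangent_frame M q = tangent_frame M' q'"
    then show "same_germ M q M' q'"
      using tangent_frame_same_germ[OF c c'] unfolding T q q' by simp
  qed
qed

lemma integral_family_local_chart:
  assumes "integral_family FL0_generic T U F" "t \<in> T" "x \<in> U"
  shows "local_chart (F t ` U) U (F t) x"
  using assms by (auto simp: integral_family_def local_chart_def intro!: exI[of _ UNIV])

text \<open>In the chart \<open>F t\<close> the tangent frame is a Cramer expression in partial
  derivatives of the joint map at \<open>(t, x)\<close>, and these are continuous in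
  \<open>t\<close> because the family is smooth in both variables together.\<close>

lemma continuous_tangent_frame:
  assumes F: "integral_family FL0_generic T U F" and x: "x \<in> U"
  shows "continuous_on T (\<lambda>t. (F t x, tangent_frame (F t ` U) (F t x)))"
proof -
  have chart: "integral_chart U (F t)" if "t \<in> T" for t
    using integral_family_local_chart[OF F that x] by unfold_locales (simp add: local_chart_def)
  define FF where "FF = (\<lambda>(t, x). F t x)"
  have FF: "smooth_on (T \<times> U) FF" using F by (simp add: integral_family_def FF_def)
  have pr: "(\<lambda>t. (t, x)) ` T \<subseteq> T \<times> U" using x by auto
  define D where "D v t = frechet_derivative FF (at (t, x)) (0, v)" for v t
  have "continuous_on T (\<lambda>t. FF (t, x))"
    by (rule continuous_on_compose2[OF smooth_on_continuous[OF FF] _ pr]) (intro continuous_intros)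
  then have cF: "continuous_on T (\<lambda>t. F t x)" by (simp add: FF_def)
  have cD: "continuous_on T (D v)" for v
    unfolding D_def
    by (rule continuous_on_compose2[OF smooth_on_continuous[OF smooth_on_directional[OF FF]] _ pr])
      (intro continuous_intros)
  have D: "integral_chart.Df (F t) x v = D v t" if t: "t \<in> T" for t v
  proof -
    have "((\<lambda>y. FF (t, y)) has_derivative (\<lambda>v. frechet_derivative FF (at (t, x)) (0, v))) (at x)"
      by (rule has_derivative_compose[OF _ smooth_on_has_derivative[OF FF]])
        (use t x in \<open>auto intro!: derivative_eq_intros\<close>)
    then have "(F t has_derivative (\<lambda>v. frechet_derivative FF (at (t, x)) (0, v))) (at x)"
      by (simp add: FF_def)
    from frechet_derivative_at[OF this] show ?thesis
      by (simp add: integral_chart.Df_def[OF chart[OF t]] D_def fun_eq_iff)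
  qed
  define A where "A t = (\<chi> i j. ctan (F t x)$i \<bullet> cpos (D (axis j 1) t))" for t
  have A: "integral_chart.coframe (F t) x = A t" if t: "t \<in> T" for t
    by (simp add: integral_chart.coframe_def[OF chart[OF t]] integral_chart.omega_eq[OF chart[OF t] x] A_def D[OF t])
  have cA: "continuous_on T A"
    unfolding A_def by (intro continuous_intros cF cD)
  define B where "B k t = cramer_vec (A t) (axis k 1)" for k t
  have cB: "continuous_on T (B k)" for k
    unfolding B_def using integral_chart.coframe_det[OF chart x] A
    by (intro continuous_on_cramer_vec cA continuous_on_const) metis
  have "tangent_frame (F t ` U) (F t x) = (\<chi> k. \<Sum>i\<in>UNIV. B k t$i *\<^sub>R D (axis i 1) t)" if t: "t \<in> T" for t
  proof -
    have "integral_chart.P (F t) x$k = (\<Sum>i\<in>UNIV. B k t$i *\<^sub>R D (axis i 1) t)" for k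
      using linear_sum_axis[OF integral_chart.linear_Df[OF chart[OF t] x], of "B k t"]
      by (simp add: integral_chart.P_def[OF chart[OF t]] integral_chart.dual_def[OF chart[OF t]] A[OF t] B_def D[OF t])
    then show ?thesis
      using tangent_frame_eq[OF integral_family_local_chart[OF F t x]] by (simp add: vec_eq_iff)
  qed
  moreover have "continuous_on T (\<lambda>t. (F t x, \<chi> k. \<Sum>i\<in>UNIV. B k t$i *\<^sub>R D (axis i 1) t))"
    by (intro continuous_intros cF cB cD)
  ultimately show ?thesis by (simp cong: continuous_on_cong)
qed

theorem mainTheorem7:
  shows "at_most_finite_dimensional FL0_generic"
proof -
  obtain bs :: "(conf \<times> (conf^4)) list" where bs: "set bs = Basis"
    using finite_list[OF finite_Basis] by blast
  \<comment> \<open>The constants are coordinates in a basis of the Euclidean space of pairs of a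
    configuration and four tangent vectors, so equality of all of them is equality of the
    pairs.\<close>
  define c where "c M q i = (q, tangent_frame M q) \<bullet> bs ! i" for M q i
  have eq: "(\<forall>i<length bs. c M q i = c M' q' i) \<longleftrightarrow> q = q' \<and> tangent_frame M q = tangent_frame M' q'" for M q M' q'
  proof -
    have "(\<forall>i<length bs. c M q i = c M' q' i) \<longleftrightarrow> (\<forall>b\<in>set bs. (q, tangent_frame M q) \<bullet> b = (q', tangent_frame M' q') \<bullet> b)"
      by (simp add: c_def all_set_conv_all_nth)
    also have "\<dots> \<longleftrightarrow> (q, tangent_frame M q) = (q', tangent_frame M' q')"
      unfolding bs by (rule euclidean_eq_iff[symmetric])
    finally show ?thesis by simp
  qed
  have "depends_on_constants (length bs) FL0_generic"
    unfolding depends_on_constants_def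
  proof (intro exI[of _ c] conjI allI impI)
    fix M M' q q'
    assume "integral_fold FL0_generic M \<and> integral_fold FL0_generic M' \<and> q \<in> M \<and> q' \<in> M'"
    then show "(\<forall>i<length bs. c M q i = c M' q' i) \<longleftrightarrow> same_germ M q M' q'"
      unfolding eq using same_germ_iff_tangent_frame by simp
  next
    fix T U F x i
    assume "integral_family FL0_generic T U F \<and> x \<in> U"
    then show "continuous_on T (\<lambda>t. c (F t ` U) (F t x) i)"
      unfolding c_def by (intro continuous_on_inner continuous_tangent_frame continuous_on_const) auto
  qed
  then show ?thesis by (auto simp: at_most_finite_dimensional_def)
qed

end
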